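(* Let $\mathscr{A}$ be a partial bialgebra with total algebra $A$, total comultiplication $\Delta$ and counit $\epsilon$. Then the following properties are satisfied. (1) Coassociativity: $(\Delta\otimes\mathrm{id})\Delta=(\mathrm{id}\otimes\Delta)\Delta$ (as maps $M(A)\to M(A^{\otimes3})$). (2) Counitality: $(\epsilon\otimes\mathrm{id})(\Delta(a)(1\otimes b))=ab=(\mathrm{id}\otimes\epsilon)((a\otimes1)\Delta(b))$ for all $a,b\in A$. (3) Weak comultiplicativity of the unit: $(\Delta(1)\otimes1)(1\otimes\Delta(1))=(\Delta\otimes\mathrm{id})\Delta(1)=(\mathrm{id}\otimes\Delta)\Delta(1)=(1\otimes\Delta(1))(\Delta(1)\otimes1)$. (4) Weak multiplicativity of the counit: for all $a,b,c\in A$, $$(\epsilon\otimes\mathrm{id})(\Delta(a)(b\otimes c))=(\epsilon\otimes\mathrm{id})((1\otimes a)\Delta(1)(b\otimes c)),$$ $$(\epsilon\otimes\mathrm{id})((a\otimes b)\Delta(c))=(\epsilon\otimes\mathrm{id})((a\otimes b)\Delta(1)(1\otimes c)).$$ (5) Strong multiplier property: $\Delta(A)(1\otimes A)\cup(A\otimes1)\Delta(A)\subseteq A\otimes A$.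
   Context: Let $I$ be a set. An assignment $(r,s)\mapsto x_{rs}$ is rcf if for each fixed $r$ only finitely many $x_{rs}$ are nonzero, and likewise for each fixed $s$. $M(B)$ denotes the multiplier algebra of a non-degenerate algebra $B$. PARTIAL BIALGEBRAS. An $I$-partial bialgebra $\mathscr{A}$ consists of complex vector spaces $A^{kl}_{mn}$ ($k,l,m,n\in I$); associative multiplications $A^{kl}_{mn}\otimes A^{lp}_{nq}\to A^{kp}_{mq}$ with unit elements $\mathbf{1}^k_m\in A^{kk}_{mm}$ (possibly zero), so $\mathbf 1^k_m a=a=a\mathbf 1^l_n$ for $a\in A^{kl}_{mn}$; comultiplications $\Delta_{rs}:A^{kl}_{mn}\to A^{kl}_{rs}\otimes A^{rs}_{mn}$ with $(\Delta_{pq}\otimes\mathrm{id})\Delta_{rs}=(\mathrm{id}\otimes\Delta_{rs})\Delta_{pq}$; and counits $\epsilon:A^{kl}_{kl}\to\mathbb{C}$, extended by $0$ to $A^{kl}_{mn}$ with $(k,l)\ne(m,n)$, with $(\epsilon\otimes\mathrm{id})\Delta_{kl}(a)=a=(\mathrm{id}\otimes\epsilon)\Delta_{mn}(a)$ for $a\in A^{kl}_{mn}$; such that: (1) $\Delta_{l,l'}(\mathbf 1^k_m)=\delta_{l,l'}\mathbf 1^k_l\otimes\mathbf 1^l_m$; (2) $\epsilon(ab)=\epsilon(a)\epsilon(b)$ for $a\in A^{kl}_{mn},b\in A^{lp}_{nq}$; (3) $\epsilon(\mathbf 1^k_k)=1$; (4) for each $a\in A^{kl}_{mn}$, $(r,s)\mapsto\Delta_{rs}(a)$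 is rcf; (5) $\Delta_{rs}(ab)=\sum_t\Delta_{rt}(a)\Delta_{ts}(b)$ for composable $a,b$. TOTAL OBJECTS. The total algebra is $A=\bigoplus A^{kl}_{mn}$ (non-composable products are $0$), and $\epsilon:A\to\mathbb C$ is extended linearly. In $M(A)$ put $\lambda_k=\sum_l\mathbf 1^k_l$, $\rho_l=\sum_k\mathbf 1^k_l$ (strictly convergent sums). The total comultiplication is the homomorphism $\Delta:A\to M(A\otimes A)$ such that $\Delta_{rs}(a)=(1\otimes\lambda_r)\Delta(a)(1\otimes\lambda_s)=(\rho_r\otimes1)\Delta(a)(\rho_s\otimes1)$ for all $r,s\in I$ and homogeneous $a$. With the idempotent $E=\sum_l\rho_l\otimes\lambda_l\in M(A\otimes A)$ one has $\Delta(A)(A\otimes A)=E(A\otimes A)$ and $(A\otimes A)\Delta(A)=(A\otimes A)E$; $\Delta$ extends uniquely to a homomorphism $\Delta:M(A)\to M(A\otimes A)$ with $\Delta(1)=E$, and similarly $\mathrm{id}\otimes\Delta$ and $\Delta\otimes\mathrm{id}$ extend to $M(A\otimes A)\to M(A\otimes A\otimes A)$ (with $1\mapsto 1\otimes E$, resp. $1\mapsto E\otimes 1$). *)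

theory Defs
  imports Complex_Main "HOL-Library.Poly_Mapping" "HOL-Library.FuncSet"
begin

section \<open>Complex vector spaces\<close>

class complex_vector = ab_group_add +
  fixes scaleC :: "complex \<Rightarrow> 'a \<Rightarrow> 'a"  (infixr \<open>*\<^sub>C\<close> 75)
  assumes scaleC_add_right: "c *\<^sub>C (x + y) = c *\<^sub>C x + c *\<^sub>C y"
    and scaleC_add_left: "(c + d) *\<^sub>C x = c *\<^sub>C x + d *\<^sub>C x"
    and scaleC_scaleC: "c *\<^sub>C d *\<^sub>C x = (c * d) *\<^sub>C x"
    and scaleC_one: "1 *\<^sub>C x = x"

global_interpretation complex_vector: vector_space "scaleC :: complex \<Rightarrow> 'a \<Rightarrow> 'a::complex_vector"
  defines csubspace = complex_vector.subspace
    and cspan = complex_vector.span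
  by unfold_locales (simp_all add: scaleC_add_right scaleC_add_left scaleC_scaleC scaleC_one)

definition clinear_on :: "'a::complex_vector set \<Rightarrow> ('a \<Rightarrow> 'b::complex_vector) \<Rightarrow> bool" where
  "clinear_on S f \<longleftrightarrow>
     (\<forall>x\<in>S. \<forall>y\<in>S. f (x + y) = f x + f y) \<and> (\<forall>c. \<forall>x\<in>S. f (c *\<^sub>C x) = c *\<^sub>C f x)"

abbreviation clinear :: "('a::complex_vector \<Rightarrow> 'b::complex_vector) \<Rightarrow> bool" where
  "clinear \<equiv> clinear_on UNIV"

instantiation complex :: complex_vector
begin
definition scaleC_complex :: "complex \<Rightarrow> complex \<Rightarrow> complex" where
  "scaleC_complex c z = c * z"
instance
  by standard (simp_all add: scaleC_complex_def algebra_simps)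
end

instantiation poly_mapping :: (type, complex_vector) complex_vector
begin
definition scaleC_poly_mapping :: "complex \<Rightarrow> ('a \<Rightarrow>\<^sub>0 'b) \<Rightarrow> ('a \<Rightarrow>\<^sub>0 'b)" where
  "scaleC_poly_mapping c p = Poly_Mapping.map (scaleC c) p"
instance
proof
  have lookup_scaleC: "Poly_Mapping.lookup (c *\<^sub>C p) k = c *\<^sub>C Poly_Mapping.lookup p k"
    for c and p :: "'a \<Rightarrow>\<^sub>0 'b" and k
    by (simp add: scaleC_poly_mapping_def Poly_Mapping.map.rep_eq when_def)
  fix c d :: complex and x y :: "'a \<Rightarrow>\<^sub>0 'b"
  show "c *\<^sub>C (x + y) = c *\<^sub>C x + c *\<^sub>C y"
    by (rule poly_mapping_eqI) (simp add: lookup_scaleC lookup_add scaleC_add_right)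
  show "(c + d) *\<^sub>C x = c *\<^sub>C x + d *\<^sub>C x"
    by (rule poly_mapping_eqI) (simp add: lookup_scaleC lookup_add scaleC_add_left)
  show "c *\<^sub>C d *\<^sub>C x = (c * d) *\<^sub>C x"
    by (rule poly_mapping_eqI) (simp add: lookup_scaleC scaleC_scaleC)
  show "1 *\<^sub>C x = x"
    by (rule poly_mapping_eqI) (simp add: lookup_scaleC scaleC_one)
qed
end


section \<open>Algebraic tensor products\<close>

text \<open>The tensor product of two complex vector spaces is the free vector space on the pairs
  modulo the span of the bilinearity relations.\<close>

definition bilinear_relators :: "(('a::complex_vector \<times> 'b::complex_vector) \<Rightarrow>\<^sub>0 complex) set" where
  "bilinear_relators =
     {Poly_Mapping.single (a + a', b) 1 - Poly_Mapping.single (a, b) 1 - Poly_Mapping.single (a', b) 1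
        | a a' b. True} \<union>
     {Poly_Mapping.single (a, b + b') 1 - Poly_Mapping.single (a, b) 1 - Poly_Mapping.single (a, b') 1
        | a b b'. True} \<union>
     {Poly_Mapping.single (c *\<^sub>C a, b) 1 - Poly_Mapping.single (a, b) c | a b c. True} \<union>
     {Poly_Mapping.single (a, c *\<^sub>C b) 1 - Poly_Mapping.single (a, b) c | a b c. True}"

definition tensor_rel ::
    "(('a::complex_vector \<times> 'b::complex_vector) \<Rightarrow>\<^sub>0 complex) \<Rightarrow> (('a \<times> 'b) \<Rightarrow>\<^sub>0 complex) \<Rightarrow> bool" where
  "tensor_rel p q \<longleftrightarrow> p - q \<in> cspan bilinear_relators"

quotient_type (overloaded) ('a, 'b) tensor =
    "(('a::complex_vector \<times> 'b::complex_vector) \<Rightarrow>\<^sub>0 complex)" / tensor_rel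
proof (rule equivpI)
  show "reflp (tensor_rel :: (('a \<times> 'b) \<Rightarrow>\<^sub>0 complex) \<Rightarrow> _)"
    by (rule reflpI) (simp add: tensor_rel_def complex_vector.span_zero)
  show "symp (tensor_rel :: (('a \<times> 'b) \<Rightarrow>\<^sub>0 complex) \<Rightarrow> _)"
  proof (rule sympI)
    fix p q :: "('a \<times> 'b) \<Rightarrow>\<^sub>0 complex"
    assume "tensor_rel p q"
    then show "tensor_rel q p"
      unfolding tensor_rel_def by (metis complex_vector.span_neg minus_diff_eq)
  qed
  show "transp (tensor_rel :: (('a \<times> 'b) \<Rightarrow>\<^sub>0 complex) \<Rightarrow> _)"
  proof (rule transpI)
    fix p q r :: "('a \<times> 'b) \<Rightarrow>\<^sub>0 complex"
    assume "tensor_rel p q" "tensor_rel q r"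
    then have "(p - q) + (q - r) \<in> cspan bilinear_relators"
      unfolding tensor_rel_def by (rule complex_vector.span_add)
    then show "tensor_rel p r"
      by (simp add: tensor_rel_def)
  qed
qed

instantiation tensor :: (complex_vector, complex_vector) complex_vector
begin

lift_definition zero_tensor :: "('a, 'b) tensor" is 0 .

lift_definition plus_tensor :: "('a, 'b) tensor \<Rightarrow> ('a, 'b) tensor \<Rightarrow> ('a, 'b) tensor" is plus
  unfolding tensor_rel_def by (metis add_diff_add complex_vector.span_add)

lift_definition uminus_tensor :: "('a, 'b) tensor \<Rightarrow> ('a, 'b) tensor" is uminus
  unfolding tensor_rel_def by (metis complex_vector.span_neg minus_diff_minus)

lift_definition minus_tensor :: "('a, 'b) tensor \<Rightarrow> ('a, 'b) tensor \<Rightarrow> ('a, 'b) tensor" is minus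
proof -
  fix p p' q q' :: "('a \<times> 'b) \<Rightarrow>\<^sub>0 complex"
  assume "tensor_rel p p'" "tensor_rel q q'"
  then have "(p - p') - (q - q') \<in> cspan bilinear_relators"
    unfolding tensor_rel_def by (rule complex_vector.span_diff)
  then show "tensor_rel (p - q) (p' - q')"
    by (simp add: tensor_rel_def algebra_simps)
qed

lift_definition scaleC_tensor :: "complex \<Rightarrow> ('a, 'b) tensor \<Rightarrow> ('a, 'b) tensor" is scaleC
  unfolding tensor_rel_def
  by (metis complex_vector.scale_right_diff_distrib complex_vector.span_scale)

instance
proof
  fix x y z :: "('a, 'b) tensor" and c d :: complex
  have eq: "tensor_rel p q" if "p = q" for p q :: "('a \<times> 'b) \<Rightarrow>\<^sub>0 complex"
    using that by (simp add: tensor_rel_def complex_vector.span_zero)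
  show "x + y + z = x + (y + z)" by transfer (rule eq, simp add: add.assoc)
  show "x + y = y + x" by transfer (rule eq, simp add: add.commute)
  show "0 + x = x" by transfer (rule eq, simp)
  show "- x + x = 0" by transfer (rule eq, simp)
  show "x - y = x + - y" by transfer (rule eq, simp)
  show "c *\<^sub>C (x + y) = c *\<^sub>C x + c *\<^sub>C y" by transfer (rule eq, simp add: scaleC_add_right)
  show "(c + d) *\<^sub>C x = c *\<^sub>C x + d *\<^sub>C x" by transfer (rule eq, simp add: scaleC_add_left)
  show "c *\<^sub>C d *\<^sub>C x = (c * d) *\<^sub>C x" by transfer (rule eq, simp add: scaleC_scaleC)
  show "1 *\<^sub>C x = x" by transfer (rule eq, simp add: scaleC_one)
qed

end

lift_definition pure_tensor :: "'a::complex_vector \<Rightarrow> 'b::complex_vector \<Rightarrow> ('a, 'b) tensor"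
    (infixl \<open>\<otimes>\<close> 70)
  is "\<lambda>a b. Poly_Mapping.single (a, b) 1" .

text \<open>The linear map on the tensor product induced by \<open>f\<close>; it does not depend on the chosen
  representative when \<open>f\<close> is bilinear, which is the only case of interest.\<close>

definition tensor_lift ::
    "('a::complex_vector \<Rightarrow> 'b::complex_vector \<Rightarrow> 'c::complex_vector) \<Rightarrow> ('a, 'b) tensor \<Rightarrow> 'c" where
  "tensor_lift f t =
     (let p = rep_tensor t
      in \<Sum>(a, b)\<in>Poly_Mapping.keys p. Poly_Mapping.lookup p (a, b) *\<^sub>C f a b)"

definition tensor_map ::
    "('a::complex_vector \<Rightarrow> 'c::complex_vector) \<Rightarrow> ('b::complex_vector \<Rightarrow> 'd::complex_vector)
      \<Rightarrow> ('a, 'b) tensor \<Rightarrow> ('c, 'd) tensor" where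
  "tensor_map f g = tensor_lift (\<lambda>a b. f a \<otimes> g b)"

text \<open>For subspaces \<open>V\<close>, \<open>W\<close> this is their tensor product: over a field the canonical map into the
  tensor product of the ambient spaces is injective, with the following image.\<close>

definition tensor_space ::
    "'a::complex_vector set \<Rightarrow> 'b::complex_vector set \<Rightarrow> ('a, 'b) tensor set" where
  "tensor_space V W = cspan {v \<otimes> w | v w. v \<in> V \<and> w \<in> W}"

definition tensor_assoc ::
    "('a::complex_vector, ('b::complex_vector, 'c::complex_vector) tensor) tensor
      \<Rightarrow> (('a, 'b) tensor, 'c) tensor" where
  "tensor_assoc = tensor_lift (\<lambda>a. tensor_lift (\<lambda>b c. (a \<otimes> b) \<otimes> c))"

definition tensor_assoc_inv ::
    "(('a::complex_vector, 'b::complex_vector) tensor, 'c::complex_vector) tensor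
      \<Rightarrow> ('a, ('b, 'c) tensor) tensor" where
  "tensor_assoc_inv = tensor_lift (\<lambda>t c. tensor_lift (\<lambda>a b. a \<otimes> (b \<otimes> c)) t)"

text \<open>For a functional \<open>\<phi>\<close>, the maps \<open>\<phi> \<otimes> id\<close> and \<open>id \<otimes> \<phi>\<close>, with \<open>\<complex> \<otimes> V\<close> and \<open>V \<otimes> \<complex>\<close>
  identified with \<open>V\<close>.\<close>

definition slice_left ::
    "('a::complex_vector \<Rightarrow> complex) \<Rightarrow> ('a, 'b::complex_vector) tensor \<Rightarrow> 'b" where
  "slice_left \<phi> = tensor_lift (\<lambda>a b. \<phi> a *\<^sub>C b)"

definition slice_right ::
    "('b::complex_vector \<Rightarrow> complex) \<Rightarrow> ('a::complex_vector, 'b) tensor \<Rightarrow> 'a" where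
  "slice_right \<phi> = tensor_lift (\<lambda>a b. \<phi> b *\<^sub>C a)"

text \<open>An algebra is a vector space type together with a multiplication, passed as a function.\<close>

definition tensor_mult ::
    "('a::complex_vector \<Rightarrow> 'a \<Rightarrow> 'a) \<Rightarrow> ('b::complex_vector \<Rightarrow> 'b \<Rightarrow> 'b)
      \<Rightarrow> ('a, 'b) tensor \<Rightarrow> ('a, 'b) tensor \<Rightarrow> ('a, 'b) tensor" where
  "tensor_mult mulA mulB s t =
     tensor_lift (\<lambda>a b. tensor_lift (\<lambda>a' b'. mulA a a' \<otimes> mulB b b') t) s"


section \<open>Multipliers\<close>

text \<open>A multiplier \<open>m\<close> is recorded by the maps \<open>x \<mapsto> m x\<close> (\<open>lact\<close>) and \<open>x \<mapsto> x m\<close> (\<open>ract\<close>).\<close>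

datatype 'b lr_pair = LR (lact: "'b \<Rightarrow> 'b") (ract: "'b \<Rightarrow> 'b")

definition multipliers :: "('b::complex_vector \<Rightarrow> 'b \<Rightarrow> 'b) \<Rightarrow> 'b lr_pair set" where
  "multipliers mul = {m. clinear (lact m) \<and> clinear (ract m) \<and>
     (\<forall>x y. lact m (mul x y) = mul (lact m x) y) \<and>
     (\<forall>x y. ract m (mul x y) = mul x (ract m y)) \<and>
     (\<forall>x y. mul (ract m x) y = mul x (lact m y))}"

instantiation lr_pair :: (type) monoid_mult
begin
definition one_lr_pair :: "'a lr_pair" where
  "one_lr_pair = LR (\<lambda>x. x) (\<lambda>x. x)"
definition times_lr_pair :: "'a lr_pair \<Rightarrow> 'a lr_pair \<Rightarrow> 'a lr_pair" where
  "times_lr_pair m n = LR (\<lambda>x. lact m (lact n x)) (\<lambda>x. ract n (ract m x))"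
instance
  by standard (simp_all add: one_lr_pair_def times_lr_pair_def)
end

instantiation lr_pair :: (complex_vector) complex_vector
begin
definition zero_lr_pair :: "'a lr_pair" where
  "zero_lr_pair = LR (\<lambda>x. 0) (\<lambda>x. 0)"
definition plus_lr_pair :: "'a lr_pair \<Rightarrow> 'a lr_pair \<Rightarrow> 'a lr_pair" where
  "plus_lr_pair m n = LR (\<lambda>x. lact m x + lact n x) (\<lambda>x. ract m x + ract n x)"
definition uminus_lr_pair :: "'a lr_pair \<Rightarrow> 'a lr_pair" where
  "uminus_lr_pair m = LR (\<lambda>x. - lact m x) (\<lambda>x. - ract m x)"
definition minus_lr_pair :: "'a lr_pair \<Rightarrow> 'a lr_pair \<Rightarrow> 'a lr_pair" where
  "minus_lr_pair m n = LR (\<lambda>x. lact m x - lact n x) (\<lambda>x. ract m x - ract n x)"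
definition scaleC_lr_pair :: "complex \<Rightarrow> 'a lr_pair \<Rightarrow> 'a lr_pair" where
  "scaleC_lr_pair c m = LR (\<lambda>x. c *\<^sub>C lact m x) (\<lambda>x. c *\<^sub>C ract m x)"
instance
  by standard (simp_all add: zero_lr_pair_def plus_lr_pair_def uminus_lr_pair_def
      minus_lr_pair_def scaleC_lr_pair_def algebra_simps scaleC_add_right scaleC_add_left
      scaleC_scaleC scaleC_one lr_pair.expand)
end

text \<open>The canonical map \<open>B \<rightarrow> M(B)\<close>, injective for non-degenerate \<open>B\<close>, and its partial inverse.\<close>

definition to_multiplier :: "('b \<Rightarrow> 'b \<Rightarrow> 'b) \<Rightarrow> 'b \<Rightarrow> 'b lr_pair" where
  "to_multiplier mul b = LR (\<lambda>x. mul b x) (\<lambda>x. mul x b)"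

definition from_multiplier :: "('b \<Rightarrow> 'b \<Rightarrow> 'b) \<Rightarrow> 'b lr_pair \<Rightarrow> 'b" where
  "from_multiplier mul m = (THE b. to_multiplier mul b = m)"

definition multiplier_tensor ::
    "'a::complex_vector lr_pair \<Rightarrow> 'b::complex_vector lr_pair \<Rightarrow> ('a, 'b) tensor lr_pair"
    (infixl \<open>\<otimes>\<^sub>M\<close> 70) where
  "m \<otimes>\<^sub>M n = LR (tensor_map (lact m) (lact n)) (tensor_map (ract m) (ract n))"

definition multiplier_assoc ::
    "('a::complex_vector, ('b::complex_vector, 'c::complex_vector) tensor) tensor lr_pair
      \<Rightarrow> (('a, 'b) tensor, 'c) tensor lr_pair" where
  "multiplier_assoc m =
     LR (\<lambda>x. tensor_assoc (lact m (tensor_assoc_inv x)))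
        (\<lambda>x. tensor_assoc (ract m (tensor_assoc_inv x)))"

text \<open>Strictly convergent sums: a family converges strictly iff, for every \<open>x\<close>, only finitely many
  of the terms \<open>f j x\<close> and \<open>x f j\<close> are nonzero.\<close>

definition strict_sum :: "'j set \<Rightarrow> ('j \<Rightarrow> 'b::complex_vector lr_pair) \<Rightarrow> 'b lr_pair" where
  "strict_sum J f =
     LR (\<lambda>x. \<Sum>j | j \<in> J \<and> lact (f j) x \<noteq> 0. lact (f j) x)
        (\<lambda>x. \<Sum>j | j \<in> J \<and> ract (f j) x \<noteq> 0. ract (f j) x)"

text \<open>The unique extension of a homomorphism \<open>f : B \<rightarrow> M(C)\<close> to a homomorphism \<open>M(B) \<rightarrow> M(C)\<close>
  with \<open>1 \<mapsto> e\<close>. Being extensional pins down the values outside \<open>M(B)\<close>, which are irrelevant.\<close>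

definition extend_hom ::
    "('b::complex_vector \<Rightarrow> 'b \<Rightarrow> 'b) \<Rightarrow> ('c::complex_vector \<Rightarrow> 'c \<Rightarrow> 'c)
      \<Rightarrow> ('b \<Rightarrow> 'c lr_pair) \<Rightarrow> 'c lr_pair \<Rightarrow> 'b lr_pair \<Rightarrow> 'c lr_pair" where
  "extend_hom mulB mulC f e = (THE F.
     F \<in> multipliers mulB \<rightarrow>\<^sub>E multipliers mulC \<and>
     clinear_on (multipliers mulB) F \<and>
     (\<forall>m\<in>multipliers mulB. \<forall>n\<in>multipliers mulB. F (m * n) = F m * F n) \<and>
     (\<forall>b. F (to_multiplier mulB b) = f b) \<and>
     F 1 = e)"


section \<open>Direct sums\<close>

text \<open>The type \<open>'a\<close> is the direct sum of the family of subspaces \<open>V j\<close>, \<open>j \<in> J\<close>.\<close>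

definition is_decomposition :: "'j set \<Rightarrow> ('j \<Rightarrow> 'a::complex_vector set) \<Rightarrow> 'a \<Rightarrow> ('j \<Rightarrow> 'a) \<Rightarrow> bool" where
  "is_decomposition J V x f \<longleftrightarrow>
     (\<forall>j\<in>J. f j \<in> V j) \<and> (\<forall>j. j \<notin> J \<longrightarrow> f j = 0) \<and>
     finite {j. f j \<noteq> 0} \<and> x = (\<Sum>j | f j \<noteq> 0. f j)"

definition is_direct_sum :: "'j set \<Rightarrow> ('j \<Rightarrow> 'a::complex_vector set) \<Rightarrow> bool" where
  "is_direct_sum J V \<longleftrightarrow> (\<forall>j\<in>J. csubspace (V j)) \<and> (\<forall>x. \<exists>!f. is_decomposition J V x f)"

definition component :: "'j set \<Rightarrow> ('j \<Rightarrow> 'a::complex_vector set) \<Rightarrow> 'a \<Rightarrow> 'j \<Rightarrow> 'a" where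
  "component J V x = (THE f. is_decomposition J V x f)"

definition direct_sum_lift ::
    "'j set \<Rightarrow> ('j \<Rightarrow> 'a::complex_vector set) \<Rightarrow> ('j \<Rightarrow> 'a \<Rightarrow> 'b::complex_vector) \<Rightarrow> 'a \<Rightarrow> 'b" where
  "direct_sum_lift J V g x = (\<Sum>j | component J V x j \<noteq> 0. g j (component J V x j))"


section \<open>Partial bialgebras\<close>

text \<open>The spaces \<open>A k l m n\<close> (upper indices \<open>k l\<close>, lower indices \<open>m n\<close>) are given inside their
  direct sum, the type \<open>'a\<close>. Since they are independent, a nonzero homogeneous element determines its
  indices, so that, as in the usual notation \<open>ab\<close>, \<open>\<Delta>\<^sub>r\<^sub>s(a)\<close>, \<open>\<epsilon>(a)\<close>, the structure maps of the
  various spaces need not carry the indices \<open>k l m n\<close>. The structure maps are only constrained on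
  homogeneous elements, and \<open>pmult\<close>, \<open>pcounit\<close> only on composable pairs and on the spaces
  \<open>A k l k l\<close>; their other values are never used.\<close>

record (overloaded) ('i, 'a::complex_vector) partial_bialgebra_data =
  pindex :: "'i set"
  pspace :: "'i \<Rightarrow> 'i \<Rightarrow> 'i \<Rightarrow> 'i \<Rightarrow> 'a set"
  pmult :: "'a \<Rightarrow> 'a \<Rightarrow> 'a"
  punit :: "'i \<Rightarrow> 'i \<Rightarrow> 'a"
  pcomult :: "'i \<Rightarrow> 'i \<Rightarrow> 'a \<Rightarrow> ('a, 'a) tensor"
  pcounit :: "'a \<Rightarrow> complex"

text \<open>The linear map on the total space with components \<open>g (k, l, m, n)\<close> on \<open>A k l m n\<close>.\<close>

definition total_lift ::
    "('i, 'a::complex_vector) partial_bialgebra_data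
      \<Rightarrow> ('i \<times> 'i \<times> 'i \<times> 'i \<Rightarrow> 'a \<Rightarrow> 'b::complex_vector) \<Rightarrow> 'a \<Rightarrow> 'b" where
  "total_lift X = direct_sum_lift (pindex X \<times> pindex X \<times> pindex X \<times> pindex X)
     (\<lambda>(k, l, m, n). pspace X k l m n)"

definition total_mult ::
    "('i, 'a::complex_vector) partial_bialgebra_data \<Rightarrow> 'a \<Rightarrow> 'a \<Rightarrow> 'a" where
  "total_mult X a b =
     total_lift X (\<lambda>(k, l, m, n) a'.
       total_lift X (\<lambda>(l', p, n', q) b'. if l' = l \<and> n' = n then pmult X a' b' else 0) b) a"

definition total_counit :: "('i, 'a::complex_vector) partial_bialgebra_data \<Rightarrow> 'a \<Rightarrow> complex" where
  "total_counit X =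
     total_lift X (\<lambda>(k, l, m, n) a. if (k, l) = (m, n) then pcounit X a else 0)"

text \<open>The direct sum over all \<open>k l m n\<close> of the maps \<open>\<Delta>\<^sub>r\<^sub>s\<close> on \<open>A k l m n\<close>; only needed to form
  \<open>\<Delta>\<^sub>r\<^sub>s \<otimes> id\<close> and \<open>id \<otimes> \<Delta>\<^sub>r\<^sub>s\<close>.\<close>

definition comult_at ::
    "('i, 'a::complex_vector) partial_bialgebra_data \<Rightarrow> 'i \<Rightarrow> 'i \<Rightarrow> 'a \<Rightarrow> ('a, 'a) tensor" where
  "comult_at X r s = total_lift X (\<lambda>_. pcomult X r s)"

abbreviation mult2 ::
    "('i, 'a::complex_vector) partial_bialgebra_data
      \<Rightarrow> ('a, 'a) tensor \<Rightarrow> ('a, 'a) tensor \<Rightarrow> ('a, 'a) tensor" where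
  "mult2 X \<equiv> tensor_mult (total_mult X) (total_mult X)"

abbreviation mult3 ::
    "('i, 'a::complex_vector) partial_bialgebra_data
      \<Rightarrow> (('a, 'a) tensor, 'a) tensor \<Rightarrow> (('a, 'a) tensor, 'a) tensor \<Rightarrow> (('a, 'a) tensor, 'a) tensor"
  where
  "mult3 X \<equiv> tensor_mult (mult2 X) (total_mult X)"

locale partial_bialgebra =
  fixes X :: "('i, 'a::complex_vector) partial_bialgebra_data"
    and I :: "'i set" and A :: "'i \<Rightarrow> 'i \<Rightarrow> 'i \<Rightarrow> 'i \<Rightarrow> 'a set"
  defines "I \<equiv> pindex X" and "A \<equiv> pspace X"
  assumes direct_sum: "is_direct_sum (I \<times> I \<times> I \<times> I) (\<lambda>(k, l, m, n). A k l m n)"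
    and mult_closed:
      "\<lbrakk>k \<in> I; l \<in> I; m \<in> I; n \<in> I; p \<in> I; q \<in> I; a \<in> A k l m n; b \<in> A l p n q\<rbrakk>
        \<Longrightarrow> pmult X a b \<in> A k p m q"
    and mult_linear_left:
      "\<lbrakk>k \<in> I; l \<in> I; m \<in> I; n \<in> I; p \<in> I; q \<in> I; b \<in> A l p n q\<rbrakk>
        \<Longrightarrow> clinear_on (A k l m n) (\<lambda>a. pmult X a b)"
    and mult_linear_right:
      "\<lbrakk>k \<in> I; l \<in> I; m \<in> I; n \<in> I; p \<in> I; q \<in> I; a \<in> A k l m n\<rbrakk>
        \<Longrightarrow> clinear_on (A l p n q) (\<lambda>b. pmult X a b)"
    and mult_assoc:
      "\<lbrakk>k \<in> I; l \<in> I; m \<in> I; n \<in> I; p \<in> I; q \<in> I; u \<in> I; v \<in> I;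
        a \<in> A k l m n; b \<in> A l p n q; c \<in> A p u q v\<rbrakk>
        \<Longrightarrow> pmult X (pmult X a b) c = pmult X a (pmult X b c)"
    and unit_closed: "\<lbrakk>k \<in> I; m \<in> I\<rbrakk> \<Longrightarrow> punit X k m \<in> A k k m m"
    and unit_left:
      "\<lbrakk>k \<in> I; l \<in> I; m \<in> I; n \<in> I; a \<in> A k l m n\<rbrakk> \<Longrightarrow> pmult X (punit X k m) a = a"
    and unit_right:
      "\<lbrakk>k \<in> I; l \<in> I; m \<in> I; n \<in> I; a \<in> A k l m n\<rbrakk> \<Longrightarrow> pmult X a (punit X l n) = a"
    and comult_closed:
      "\<lbrakk>r \<in> I; s \<in> I; k \<in> I; l \<in> I; m \<in> I; n \<in> I; a \<in> A k l m n\<rbrakk>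
        \<Longrightarrow> pcomult X r s a \<in> tensor_space (A k l r s) (A r s m n)"
    and comult_linear:
      "\<lbrakk>r \<in> I; s \<in> I; k \<in> I; l \<in> I; m \<in> I; n \<in> I\<rbrakk> \<Longrightarrow> clinear_on (A k l m n) (pcomult X r s)"
    and coassoc:
      "\<lbrakk>p \<in> I; q \<in> I; r \<in> I; s \<in> I; k \<in> I; l \<in> I; m \<in> I; n \<in> I; a \<in> A k l m n\<rbrakk>
        \<Longrightarrow> tensor_map (comult_at X p q) (\<lambda>x. x) (pcomult X r s a)
          = tensor_assoc (tensor_map (\<lambda>x. x) (comult_at X r s) (pcomult X p q a))"
    and counit_linear: "\<lbrakk>k \<in> I; l \<in> I\<rbrakk> \<Longrightarrow> clinear_on (A k l k l) (pcounit X)"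
    and counit_left:
      "\<lbrakk>k \<in> I; l \<in> I; m \<in> I; n \<in> I; a \<in> A k l m n\<rbrakk>
        \<Longrightarrow> slice_left (total_counit X) (pcomult X k l a) = a"
    and counit_right:
      "\<lbrakk>k \<in> I; l \<in> I; m \<in> I; n \<in> I; a \<in> A k l m n\<rbrakk>
        \<Longrightarrow> slice_right (total_counit X) (pcomult X m n a) = a"
    and comult_unit:
      "\<lbrakk>k \<in> I; m \<in> I; l \<in> I; l' \<in> I\<rbrakk>
        \<Longrightarrow> pcomult X l l' (punit X k m) = (if l = l' then punit X k l \<otimes> punit X l m else 0)"
    and counit_mult:
      "\<lbrakk>k \<in> I; l \<in> I; m \<in> I; n \<in> I; p \<in> I; q \<in> I; a \<in> A k l m n; b \<in> A l p n q\<rbrakk>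
        \<Longrightarrow> total_counit X (pmult X a b) = total_counit X a * total_counit X b"
    and counit_unit: "k \<in> I \<Longrightarrow> pcounit X (punit X k k) = 1"
    and comult_rcf_row:
      "\<lbrakk>k \<in> I; l \<in> I; m \<in> I; n \<in> I; a \<in> A k l m n; r \<in> I\<rbrakk>
        \<Longrightarrow> finite {s \<in> I. pcomult X r s a \<noteq> 0}"
    and comult_rcf_column:
      "\<lbrakk>k \<in> I; l \<in> I; m \<in> I; n \<in> I; a \<in> A k l m n; s \<in> I\<rbrakk>
        \<Longrightarrow> finite {r \<in> I. pcomult X r s a \<noteq> 0}"
    and comult_mult:
      "\<lbrakk>r \<in> I; s \<in> I; k \<in> I; l \<in> I; m \<in> I; n \<in> I; p \<in> I; q \<in> I; a \<in> A k l m n; b \<in> A l p n q\<rbrakk>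
        \<Longrightarrow> pcomult X r s (pmult X a b)
          = (\<Sum>t | t \<in> I \<and> mult2 X (pcomult X r t a) (pcomult X t s b) \<noteq> 0.
               mult2 X (pcomult X r t a) (pcomult X t s b))"


section \<open>Total objects\<close>

definition lam :: "('i, 'a::complex_vector) partial_bialgebra_data \<Rightarrow> 'i \<Rightarrow> 'a lr_pair" where
  "lam X k = strict_sum (pindex X) (\<lambda>l. to_multiplier (total_mult X) (punit X k l))"

definition rho :: "('i, 'a::complex_vector) partial_bialgebra_data \<Rightarrow> 'i \<Rightarrow> 'a lr_pair" where
  "rho X l = strict_sum (pindex X) (\<lambda>k. to_multiplier (total_mult X) (punit X k l))"

definition canonical_idempotent ::
    "('i, 'a::complex_vector) partial_bialgebra_data \<Rightarrow> ('a, 'a) tensor lr_pair" where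
  "canonical_idempotent X = strict_sum (pindex X) (\<lambda>l. rho X l \<otimes>\<^sub>M lam X l)"

definition total_comult ::
    "('i, 'a::complex_vector) partial_bialgebra_data \<Rightarrow> 'a \<Rightarrow> ('a, 'a) tensor lr_pair" where
  "total_comult X = (THE D.
     (\<forall>a. D a \<in> multipliers (mult2 X)) \<and>
     clinear D \<and>
     (\<forall>a b. D (total_mult X a b) = D a * D b) \<and>
     (\<forall>r\<in>pindex X. \<forall>s\<in>pindex X. \<forall>k\<in>pindex X. \<forall>l\<in>pindex X. \<forall>m\<in>pindex X. \<forall>n\<in>pindex X.
        \<forall>a\<in>pspace X k l m n.
          to_multiplier (mult2 X) (pcomult X r s a) = (1 \<otimes>\<^sub>M lam X r) * D a * (1 \<otimes>\<^sub>M lam X s) \<and>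
          to_multiplier (mult2 X) (pcomult X r s a) = (rho X r \<otimes>\<^sub>M 1) * D a * (rho X s \<otimes>\<^sub>M 1)))"

text \<open>The extensions of \<open>\<Delta>\<close>, \<open>\<Delta> \<otimes> id\<close> and \<open>id \<otimes> \<Delta>\<close> to multiplier algebras. The threefold tensor
  product is bracketed to the left.\<close>

definition comult ::
    "('i, 'a::complex_vector) partial_bialgebra_data \<Rightarrow> 'a lr_pair \<Rightarrow> ('a, 'a) tensor lr_pair" where
  "comult X = extend_hom (total_mult X) (mult2 X) (total_comult X) (canonical_idempotent X)"

definition comult_id ::
    "('i, 'a::complex_vector) partial_bialgebra_data
      \<Rightarrow> ('a, 'a) tensor lr_pair \<Rightarrow> (('a, 'a) tensor, 'a) tensor lr_pair" where
  "comult_id X = extend_hom (mult2 X) (mult3 X)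
     (tensor_lift (\<lambda>a b. total_comult X a \<otimes>\<^sub>M to_multiplier (total_mult X) b))
     (canonical_idempotent X \<otimes>\<^sub>M 1)"

definition id_comult ::
    "('i, 'a::complex_vector) partial_bialgebra_data
      \<Rightarrow> ('a, 'a) tensor lr_pair \<Rightarrow> (('a, 'a) tensor, 'a) tensor lr_pair" where
  "id_comult X = extend_hom (mult2 X) (mult3 X)
     (tensor_lift (\<lambda>a b. multiplier_assoc (to_multiplier (total_mult X) a \<otimes>\<^sub>M total_comult X b)))
     (multiplier_assoc (1 \<otimes>\<^sub>M canonical_idempotent X))"

end

theory Submission
  imports Defs
begin

text \<open>The total algebra \<open>A\<close> has no unit, but the elements \<open>1\<^sup>k\<^sub>m\<close> replace one: on each \<open>a\<close> only
  finitely many of them act nontrivially, from either side, and their actions add up to \<open>a\<close>. All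
  infinite sums of the theory are therefore pointwise finite sums of linear maps, and the proof
  rests on two consequences, each available also for \<open>A \<otimes> A\<close> and \<open>A \<otimes> A \<otimes> A\<close>.

  The first is extension. In an algebra with such a family of units (\<open>unit_family\<close>) a multiplier is
  determined by its left action. If \<open>f : B \<rightarrow> M(C)\<close> is a homomorphism whose values on the units \<open>e\<^sub>i\<close>
  of \<open>B\<close> sum strictly to \<open>E\<close>, then \<open>F(m) = \<Sum>\<^sub>i\<^sub>j f(e\<^sub>i m e\<^sub>j)\<close> is the unique extension to \<open>M(B)\<close> with
  \<open>F(1) = E\<close>, and \<open>F(m)\<close> is the only multiplier \<open>n\<close> with \<open>n E = n\<close> and \<open>n f(e\<^sub>i) = f(m e\<^sub>i)\<close>
  (\<open>extension_eqI\<close>). This criterion computes all values that are needed, such as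
  \<open>\<Delta>(\<lambda>\<^sub>k) = (\<lambda>\<^sub>k \<otimes> 1)E\<close>, \<open>\<Delta>(\<rho>\<^sub>m) = (1 \<otimes> \<rho>\<^sub>m)E\<close> and \<open>(\<Delta> \<otimes> id)(m \<otimes> n) = \<Delta>(m) \<otimes> n\<close>.

  The second is the calculus of block matrices. The \<open>1 \<otimes> \<lambda>\<^sub>r\<close> sum strictly to \<open>1\<close>, so a multiplier \<open>m\<close>
  of \<open>A \<otimes> A\<close> is determined by its blocks \<open>(1 \<otimes> \<lambda>\<^sub>r) m (1 \<otimes> \<lambda>\<^sub>s)\<close>. Conversely a matrix with finitely
  many nonzero entries in each row and column, which is what rcf says about the \<open>\<Delta>\<^sub>r\<^sub>s(a)\<close>, is the
  matrix of blocks of a multiplier. This constructs \<open>\<Delta>(a)\<close>; multiplicativity of \<open>\<Delta>\<close> is the axiom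
  \<open>\<Delta>\<^sub>r\<^sub>s(ab) = \<Sum>\<^sub>t \<Delta>\<^sub>r\<^sub>t(a) \<Delta>\<^sub>t\<^sub>s(b)\<close> read as a matrix product.

  Coassociativity on \<open>A\<close> compares blocks with respect to \<open>1 \<otimes> \<lambda>\<^sub>p \<otimes> \<lambda>\<^sub>r\<close>: those of \<open>(\<Delta> \<otimes> id)\<Delta>(a)\<close> are
  \<open>(\<Delta>\<^sub>p\<^sub>q \<otimes> id)\<Delta>\<^sub>r\<^sub>s(a)\<close> and those of \<open>(id \<otimes> \<Delta>)\<Delta>(a)\<close> are \<open>(id \<otimes> \<Delta>\<^sub>r\<^sub>s)\<Delta>\<^sub>p\<^sub>q(a)\<close>, which agree by the axiom
  (\<open>total_comult_coassoc\<close>). Cutting \<open>E\<close> into \<open>(1 \<otimes> \<lambda>\<^sub>r)E = \<rho>\<^sub>r \<otimes> \<lambda>\<^sub>r\<close> gives the two formulas for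
  \<open>(\<Delta> \<otimes> id)(E)\<close> and \<open>(id \<otimes> \<Delta>)(E)\<close>. As both composites are homomorphisms on \<open>M(A)\<close> that agree on \<open>A\<close>
  and on \<open>1\<close>, and the image of \<open>1\<close> is strictly generated by the image of \<open>A\<close>, they agree on \<open>M(A)\<close>
  (\<open>comult_coassoc\<close>).

  For the counit, \<open>\<Delta>(a)(1 \<otimes> \<lambda>\<^sub>s)\<close> is the column \<open>\<Sum>\<^sub>r \<Delta>\<^sub>r\<^sub>s(a)\<close>, a finite sum by rcf, hence an element of
  \<open>A \<otimes> A\<close>; this is the strong multiplier property. The map \<open>\<epsilon> \<otimes> id\<close> annihilates \<open>\<Delta>\<^sub>r\<^sub>s(a)\<close>, for \<open>a\<close> with
  upper indices \<open>k l\<close>, unless \<open>(r, s) = (k, l)\<close>, when it returns \<open>a\<close>. So it sends the column to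
  \<open>a\<lambda>\<^sub>s\<close> (\<open>slice_left_column\<close>), which is counitality; together with multiplicativity of \<open>\<epsilon>\<close> on
  composable elements this also yields both weak multiplicativity rules.\<close>


section \<open>Linear and bilinear maps\<close>

lemma clinearI:
  assumes "\<And>x y. f (x + y) = f x + f y" and "\<And>c x. f (c *\<^sub>C x) = c *\<^sub>C f x"
  shows "clinear f"
  using assms by (simp add: clinear_on_def)

lemma clinear_add: "clinear f \<Longrightarrow> f (x + y) = f x + f y"
  and clinear_scale: "clinear f \<Longrightarrow> f (c *\<^sub>C x) = c *\<^sub>C f x"
  by (simp_all add: clinear_on_def)

lemma clinear_diff: "clinear f \<Longrightarrow> f (x - y) = f x - f y"
  using clinear_add[of f "x - y" y] by (simp add: eq_diff_eq)

lemma clinear_0: "clinear f \<Longrightarrow> f 0 = 0"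
  using clinear_scale[of f 0 0] by simp

lemma clinear_sum: "clinear f \<Longrightarrow> f (sum g S) = (\<Sum>i\<in>S. f (g i))"
  by (induction S rule: infinite_finite_induct) (auto simp: clinear_0 clinear_add)

lemma clinear_id: "clinear (\<lambda>x. x)"
  and clinear_zero: "clinear (\<lambda>x. 0)"
  by (auto intro: clinearI)

lemma clinear_plus: "clinear f \<Longrightarrow> clinear g \<Longrightarrow> clinear (\<lambda>x. f x + g x)"
  by (rule clinearI) (simp_all add: clinear_add clinear_scale scaleC_add_right algebra_simps)

lemma clinear_scaleC: "clinear f \<Longrightarrow> clinear (\<lambda>x. c *\<^sub>C f x)"
  by (rule clinearI)
    (simp_all add: clinear_add clinear_scale scaleC_add_right scaleC_scaleC mult.commute)

lemma clinear_compose: "clinear f \<Longrightarrow> clinear g \<Longrightarrow> clinear (\<lambda>x. f (g x))"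
  by (rule clinearI) (simp_all add: clinear_add clinear_scale)

lemma clinear_if: "clinear f \<Longrightarrow> clinear g \<Longrightarrow> clinear (\<lambda>x. if b then f x else g x)"
  by (cases b) simp_all

definition cbilinear ::
    "('a::complex_vector \<Rightarrow> 'b::complex_vector \<Rightarrow> 'c::complex_vector) \<Rightarrow> bool" where
  "cbilinear f \<longleftrightarrow> (\<forall>b. clinear (\<lambda>a. f a b)) \<and> (\<forall>a. clinear (f a))"

lemma cbilinearI: "(\<And>b. clinear (\<lambda>a. f a b)) \<Longrightarrow> (\<And>a. clinear (f a)) \<Longrightarrow> cbilinear f"
  by (simp add: cbilinear_def)

lemma cbilinear_left: "cbilinear f \<Longrightarrow> clinear (\<lambda>a. f a b)"
  and cbilinear_right: "cbilinear f \<Longrightarrow> clinear (f a)"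
  by (simp_all add: cbilinear_def)

lemma cbilinear_compose:
  "cbilinear f \<Longrightarrow> clinear g \<Longrightarrow> clinear h \<Longrightarrow> cbilinear (\<lambda>a b. f (g a) (h b))"
  by (simp add: cbilinear_def clinear_compose[of _ h] clinear_compose[of "\<lambda>a. f a _" g])

lemma cbilinear_after: "clinear h \<Longrightarrow> cbilinear f \<Longrightarrow> cbilinear (\<lambda>a b. h (f a b))"
  by (rule cbilinearI; rule clinear_compose[of h]) (auto simp: cbilinear_def)

lemma clinear_eq_on_span:
  assumes "clinear f" "clinear g" "\<And>x. x \<in> S \<Longrightarrow> f x = g x" "x \<in> cspan S"
  shows "f x = g x"
  using assms(4)
proof (induction rule: complex_vector.span_induct_alt)
  case base
  then show ?case using assms by (simp add: clinear_0)
next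
  case (step c x y)
  then show ?case using assms by (simp add: clinear_add clinear_scale)
qed


section \<open>Tensor products\<close>

text \<open>The linear extension of \<open>f\<close> to the free vector space on pairs, of which the tensor product
  is a quotient.\<close>

definition free_lift ::
    "('a \<Rightarrow> 'b \<Rightarrow> 'c::complex_vector) \<Rightarrow> (('a \<times> 'b) \<Rightarrow>\<^sub>0 complex) \<Rightarrow> 'c" where
  "free_lift f p = (\<Sum>x\<in>Poly_Mapping.keys p. Poly_Mapping.lookup p x *\<^sub>C f (fst x) (snd x))"

lemma free_lift_superset:
  assumes "finite S" "Poly_Mapping.keys p \<subseteq> S"
  shows "free_lift f p = (\<Sum>x\<in>S. Poly_Mapping.lookup p x *\<^sub>C f (fst x) (snd x))"
  unfolding free_lift_def
  by (rule sum.mono_neutral_left) (use assms in \<open>auto simp: in_keys_iff\<close>)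

lemma lookup_scaleC_poly: "Poly_Mapping.lookup (c *\<^sub>C p) k = c *\<^sub>C Poly_Mapping.lookup p k"
  for p :: "'a \<Rightarrow>\<^sub>0 'b::complex_vector"
  by (simp add: scaleC_poly_mapping_def Poly_Mapping.map.rep_eq when_def)

lemma clinear_free_lift: "clinear (free_lift f)"
proof (rule clinearI)
  fix p q :: "('a \<times> 'b) \<Rightarrow>\<^sub>0 complex" and c :: complex
  let ?S = "Poly_Mapping.keys p \<union> Poly_Mapping.keys q"
  have "Poly_Mapping.keys (p + q) \<subseteq> ?S"
    by (rule Poly_Mapping.keys_add)
  then show "free_lift f (p + q) = free_lift f p + free_lift f q"
    by (simp add: free_lift_superset[of ?S] lookup_add scaleC_add_left sum.distrib)
  have "Poly_Mapping.keys (c *\<^sub>C p) \<subseteq> Poly_Mapping.keys p"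
    by (auto simp: in_keys_iff lookup_scaleC_poly)
  then show "free_lift f (c *\<^sub>C p) = c *\<^sub>C free_lift f p"
    by (simp add: free_lift_superset[of "Poly_Mapping.keys p"] lookup_scaleC_poly
        complex_vector.scale_sum_right scaleC_scaleC scaleC_complex_def)
qed

lemma free_lift_single: "free_lift f (Poly_Mapping.single (a, b) c) = c *\<^sub>C f a b"
  by (subst free_lift_superset[of "{(a, b)}"]) auto

lemma free_lift_relators:
  assumes "cbilinear f" "p \<in> cspan bilinear_relators"
  shows "free_lift f p = 0"
proof (rule clinear_eq_on_span[OF clinear_free_lift clinear_zero _ assms(2)])
  fix x assume "x \<in> (bilinear_relators :: (('a \<times> 'b) \<Rightarrow>\<^sub>0 complex) set)"
  then show "free_lift f x = 0"
    unfolding bilinear_relators_def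
    using clinear_add[OF cbilinear_left[OF assms(1)]] clinear_add[OF cbilinear_right[OF assms(1)]]
      clinear_scale[OF cbilinear_left[OF assms(1)]] clinear_scale[OF cbilinear_right[OF assms(1)]]
    by (auto simp: clinear_diff[OF clinear_free_lift] free_lift_single)
qed

text \<open>Although \<open>tensor_lift\<close> picks a representative, any other one gives the same value: two of them
  differ by an element of the span of the bilinearity relations, on which the linear extension of a
  bilinear map vanishes.\<close>

lemma tensor_lift_abs:
  assumes "cbilinear f"
  shows "tensor_lift f (abs_tensor p) = free_lift f p"
proof -
  have "tensor_rel (rep_tensor (abs_tensor p)) p"
    by (rule Quotient_rep_abs[OF Quotient_tensor]) (simp add: tensor_rel_def complex_vector.span_zero)
  then have "free_lift f (rep_tensor (abs_tensor p) - p) = 0"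
    unfolding tensor_rel_def by (rule free_lift_relators[OF assms])
  then have "free_lift f (rep_tensor (abs_tensor p)) = free_lift f p"
    by (simp add: clinear_diff[OF clinear_free_lift])
  then show ?thesis
    by (simp add: tensor_lift_def free_lift_def case_prod_beta)
qed

lemma tensor_lift_pure: "cbilinear f \<Longrightarrow> tensor_lift f (a \<otimes> b) = f a b"
  by (simp add: pure_tensor.abs_eq tensor_lift_abs free_lift_single)

lemma clinear_tensor_lift:
  assumes "cbilinear f"
  shows "clinear (tensor_lift f)"
proof (rule clinearI)
  fix s t :: "('a, 'b) tensor" and c
  obtain p q where [simp]: "s = abs_tensor p" "t = abs_tensor q"
    by (metis Quotient_tensor Quotient_abs_rep)
  show "tensor_lift f (s + t) = tensor_lift f s + tensor_lift f t"
    by (simp add: plus_tensor.abs_eq tensor_lift_abs[OF assms] clinear_add[OF clinear_free_lift])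
  show "tensor_lift f (c *\<^sub>C s) = c *\<^sub>C tensor_lift f s"
    by (simp add: scaleC_tensor.abs_eq tensor_lift_abs[OF assms] clinear_scale[OF clinear_free_lift])
qed

lemma cbilinear_pure: "cbilinear (\<otimes>)"
proof -
  have rel: "abs_tensor p = abs_tensor q" if "p - q \<in> bilinear_relators"
    for p q :: "('a \<times> 'b) \<Rightarrow>\<^sub>0 complex"
    using that by (simp add: tensor.abs_eq_iff tensor_rel_def complex_vector.span_base)
  have sc: "c *\<^sub>C Poly_Mapping.single (a, b) 1 = Poly_Mapping.single (a, b) c" for a :: 'a and b :: 'b and c
    by (rule poly_mapping_eqI) (simp add: lookup_scaleC_poly lookup_single when_def scaleC_complex_def)
  show ?thesis
    by (intro cbilinearI clinearI;
        simp only: pure_tensor.abs_eq plus_tensor.abs_eq scaleC_tensor.abs_eq sc)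
       (rule rel, fastforce simp: bilinear_relators_def diff_diff_eq[symmetric])+
qed

lemma pure_add_left: "(a + a') \<otimes> b = a \<otimes> b + a' \<otimes> b"
  and pure_add_right: "a \<otimes> (b + b') = a \<otimes> b + a \<otimes> b'"
  and pure_scale_left: "(c *\<^sub>C a) \<otimes> b = c *\<^sub>C (a \<otimes> b)"
  and pure_scale_right: "a \<otimes> (c *\<^sub>C b) = c *\<^sub>C (a \<otimes> b)"
  and pure_zero_left [simp]: "0 \<otimes> b = 0"
  and pure_zero_right [simp]: "a \<otimes> 0 = 0"
  and pure_sum_left: "sum g S \<otimes> b = (\<Sum>i\<in>S. g i \<otimes> b)"
  and pure_sum_right: "a \<otimes> sum h T = (\<Sum>j\<in>T. a \<otimes> h j)"
  by (rule clinear_add[OF cbilinear_left[OF cbilinear_pure]]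
      clinear_add[OF cbilinear_right[OF cbilinear_pure]]
      clinear_scale[OF cbilinear_left[OF cbilinear_pure]]
      clinear_scale[OF cbilinear_right[OF cbilinear_pure]]
      clinear_0[OF cbilinear_left[OF cbilinear_pure]]
      clinear_0[OF cbilinear_right[OF cbilinear_pure]]
      clinear_sum[OF cbilinear_left[OF cbilinear_pure]]
      clinear_sum[OF cbilinear_right[OF cbilinear_pure]])+

text \<open>Scalars need no case of their own, because \<open>c (a \<otimes> b) = (c a) \<otimes> b\<close> is again a pure tensor.\<close>

lemma tensor_induct [case_names pure add]:
  assumes pure: "\<And>a b. P (a \<otimes> b)" and add: "\<And>s t. P s \<Longrightarrow> P t \<Longrightarrow> P (s + t)"
  shows "P t"
proof -
  obtain p where t: "t = abs_tensor p"
    by (metis Quotient_tensor Quotient_abs_rep)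
  have p: "p = (\<Sum>x\<in>Poly_Mapping.keys p. Poly_Mapping.single x (Poly_Mapping.lookup p x))"
    by (rule poly_mapping_eqI)
      (auto simp: lookup_sum lookup_single when_def in_keys_iff sum.delta)
  have single: "abs_tensor (Poly_Mapping.single (a, b) c) = (c *\<^sub>C a) \<otimes> b" for a :: 'a and b :: 'b and c
  proof -
    have "Poly_Mapping.single (c *\<^sub>C a, b) 1 - Poly_Mapping.single (a, b) c \<in> bilinear_relators"
      by (fastforce simp: bilinear_relators_def)
    then have "tensor_rel (Poly_Mapping.single (c *\<^sub>C a, b) 1) (Poly_Mapping.single (a, b) c)"
      by (simp add: tensor_rel_def complex_vector.span_base)
    then show ?thesis
      by (simp add: pure_tensor.abs_eq tensor.abs_eq_iff[symmetric])
  qed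
  have zero: "P 0"
    using pure[of 0 0] by simp
  have "P (abs_tensor (\<Sum>x\<in>S. Poly_Mapping.single x (Poly_Mapping.lookup p x)))" if "finite S" for S
    using that
  proof (induction S)
    case empty
    then show ?case using zero by (simp add: zero_tensor.abs_eq[symmetric])
  next
    case (insert x S)
    obtain a b where "x = (a, b)" by fastforce
    then show ?case
      using insert add pure by (simp add: plus_tensor.abs_eq[symmetric] single)
  qed
  then show ?thesis
    using p t by (metis finite_keys)
qed

lemma clinear_eq_on_pure:
  assumes "clinear f" "clinear g" "\<And>a b. f (a \<otimes> b) = g (a \<otimes> b)"
  shows "f t = g t"
  by (induction t rule: tensor_induct) (simp_all add: assms clinear_add)

text \<open>Linearity in a parameter of the bilinear map; iterated liftings such as the multiplication of a
  tensor product need it in the outer argument.\<close>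

lemma clinear_tensor_lift_param:
  assumes "\<And>x. cbilinear (h x)" "\<And>a b. clinear (\<lambda>x. h x a b)"
  shows "clinear (\<lambda>x. tensor_lift (h x) t)"
proof (induction t rule: tensor_induct)
  case (pure a b)
  then show ?case by (simp add: tensor_lift_pure assms)
next
  case (add s t)
  then show ?case by (simp add: clinear_add[OF clinear_tensor_lift] assms clinear_plus)
qed

lemma cbilinear_pure_compose: "clinear f \<Longrightarrow> clinear g \<Longrightarrow> cbilinear (\<lambda>a b. f a \<otimes> g b)"
  using cbilinear_compose[OF cbilinear_pure] .

lemma tensor_map_pure: "clinear f \<Longrightarrow> clinear g \<Longrightarrow> tensor_map f g (a \<otimes> b) = f a \<otimes> g b"
  and clinear_tensor_map: "clinear f \<Longrightarrow> clinear g \<Longrightarrow> clinear (tensor_map f g)"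
  by (simp_all add: tensor_map_def tensor_lift_pure clinear_tensor_lift cbilinear_pure_compose)

lemma tensor_map_id: "tensor_map (\<lambda>x. x) (\<lambda>x. x) = (\<lambda>t. t)"
  by (rule ext, rule clinear_eq_on_pure) (simp_all add: tensor_map_pure clinear_tensor_map clinear_id)

lemma slice_left_pure: "clinear \<phi> \<Longrightarrow> slice_left \<phi> (a \<otimes> b) = \<phi> a *\<^sub>C b"
  and slice_right_pure: "clinear \<phi> \<Longrightarrow> slice_right \<phi> (b \<otimes> a) = \<phi> a *\<^sub>C b"
  and clinear_slice_left: "clinear \<phi> \<Longrightarrow> clinear (slice_left \<phi>)"
  and clinear_slice_right: "clinear \<phi> \<Longrightarrow> clinear (slice_right \<phi>)"
proof -
  assume \<phi>: "clinear \<phi>"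
  have *: "cbilinear (\<lambda>a b. \<phi> a *\<^sub>C b)" "cbilinear (\<lambda>b a. \<phi> a *\<^sub>C b)"
    by (auto intro!: cbilinearI clinearI simp: \<phi> clinear_add clinear_scale scaleC_add_left
        scaleC_add_right scaleC_scaleC scaleC_complex_def mult.commute)
  show "slice_left \<phi> (a \<otimes> b) = \<phi> a *\<^sub>C b" "slice_right \<phi> (b \<otimes> a) = \<phi> a *\<^sub>C b"
    "clinear (slice_left \<phi>)" "clinear (slice_right \<phi>)"
    unfolding slice_left_def slice_right_def
    by (intro tensor_lift_pure clinear_tensor_lift *)+
qed

lemma cbilinear_tensor_mult_inner:
  assumes "cbilinear mulA" "cbilinear mulB"
  shows "cbilinear (\<lambda>a' b'. mulA a a' \<otimes> mulB b b')"
  by (intro cbilinear_pure_compose cbilinear_right assms)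

lemma cbilinear_tensor_mult_outer:
  assumes "cbilinear mulA" "cbilinear mulB"
  shows "cbilinear (\<lambda>a b. tensor_lift (\<lambda>a' b'. mulA a a' \<otimes> mulB b b') t)"
  by (intro cbilinearI clinear_tensor_lift_param cbilinear_tensor_mult_inner assms
      clinear_compose[OF cbilinear_left[OF cbilinear_pure]]
      clinear_compose[OF cbilinear_right[OF cbilinear_pure]] cbilinear_left[OF assms(1)]
      cbilinear_left[OF assms(2)])

lemma tensor_mult_pure:
  assumes "cbilinear mulA" "cbilinear mulB"
  shows "tensor_mult mulA mulB (a \<otimes> b) (a' \<otimes> b') = mulA a a' \<otimes> mulB b b'"
  unfolding tensor_mult_def
  by (subst tensor_lift_pure, rule cbilinear_tensor_mult_outer[OF assms])
    (rule tensor_lift_pure, rule cbilinear_tensor_mult_inner[OF assms])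

lemma cbilinear_tensor_mult:
  assumes "cbilinear mulA" "cbilinear mulB"
  shows "cbilinear (tensor_mult mulA mulB)"
proof (rule cbilinearI)
  show "clinear (\<lambda>s. tensor_mult mulA mulB s t)" for t
    unfolding tensor_mult_def by (intro clinear_tensor_lift cbilinear_tensor_mult_outer assms)
  show "clinear (tensor_mult mulA mulB s)" for s
    unfolding tensor_mult_def
  proof (induction s rule: tensor_induct)
    case (pure a b)
    then show ?case
      by (simp add: tensor_lift_pure cbilinear_tensor_mult_outer[OF assms] clinear_tensor_lift
        cbilinear_tensor_mult_inner[OF assms])
  next
    case (add s t)
    then show ?case
      by (simp add: clinear_add[OF clinear_tensor_lift] cbilinear_tensor_mult_outer[OF assms]
          clinear_plus)
  qed
qed

lemma tensor_mult_assoc: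
  assumes "cbilinear mulA" "cbilinear mulB"
    and "\<And>x y z. mulA (mulA x y) z = mulA x (mulA y z)"
    and "\<And>x y z. mulB (mulB x y) z = mulB x (mulB y z)"
  shows "tensor_mult mulA mulB (tensor_mult mulA mulB r s) t
    = tensor_mult mulA mulB r (tensor_mult mulA mulB s t)"
proof -
  note bl = cbilinear_tensor_mult[OF assms(1,2)]
  note add = clinear_add[OF cbilinear_left[OF bl]] clinear_add[OF cbilinear_right[OF bl]]
  show ?thesis
  proof (induction r rule: tensor_induct)
    case (pure a b)
    show ?case
    proof (induction s rule: tensor_induct)
      case (pure a' b')
      show ?case
        by (induction t rule: tensor_induct) (simp_all add: tensor_mult_pure assms add)
    qed (simp add: add)
  qed (simp add: add)
qed

lemma tensor_space_mult_zero:
  assumes bl: "cbilinear mulA" "cbilinear mulB"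
    and zero: "(\<forall>v\<in>V. \<forall>v'\<in>V'. mulA v v' = 0) \<or> (\<forall>w\<in>W. \<forall>w'\<in>W'. mulB w w' = 0)"
    and s: "s \<in> tensor_space V W" and t: "t \<in> tensor_space V' W'"
  shows "tensor_mult mulA mulB s t = 0"
proof -
  note bl2 = cbilinear_tensor_mult[OF bl]
  show ?thesis
    using s unfolding tensor_space_def
  proof (rule clinear_eq_on_span[of "\<lambda>s. tensor_mult mulA mulB s t" "\<lambda>_. 0", rotated 3])
    fix x assume "x \<in> {v \<otimes> w |v w. v \<in> V \<and> w \<in> W}"
    then obtain v w where x: "x = v \<otimes> w" "v \<in> V" "w \<in> W" by blast
    show "tensor_mult mulA mulB x t = 0"
      using t unfolding tensor_space_def
    proof (rule clinear_eq_on_span[of "tensor_mult mulA mulB x" "\<lambda>_. 0", rotated 3])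
      fix y assume "y \<in> {v \<otimes> w |v w. v \<in> V' \<and> w \<in> W'}"
      then show "tensor_mult mulA mulB x y = 0"
        using x zero by (auto simp: tensor_mult_pure[OF bl])
    qed (intro cbilinear_right bl2 clinear_zero)+
  qed (intro cbilinear_left bl2 clinear_zero)+
qed

lemma cbilinear_assoc_inner: "cbilinear (\<lambda>b c. (a \<otimes> b) \<otimes> c)"
  by (intro cbilinear_pure_compose cbilinear_right cbilinear_pure clinear_id)

lemma cbilinear_assoc_inv_inner: "cbilinear (\<lambda>a b. a \<otimes> (b \<otimes> c))"
  by (intro cbilinear_pure_compose cbilinear_left cbilinear_pure clinear_id)

lemma cbilinear_assoc_outer: "cbilinear (\<lambda>a. tensor_lift (\<lambda>b c. (a \<otimes> b) \<otimes> c))"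
  by (intro cbilinearI clinear_tensor_lift_param clinear_tensor_lift cbilinear_assoc_inner
      clinear_compose[OF cbilinear_left[OF cbilinear_pure]] cbilinear_left[OF cbilinear_pure])

lemma cbilinear_assoc_inv_outer: "cbilinear (\<lambda>t c. tensor_lift (\<lambda>a b. a \<otimes> (b \<otimes> c)) t)"
  by (intro cbilinearI clinear_tensor_lift_param clinear_tensor_lift cbilinear_assoc_inv_inner
      clinear_compose[OF cbilinear_right[OF cbilinear_pure]] cbilinear_right[OF cbilinear_pure])

lemma tensor_assoc_pure: "tensor_assoc (a \<otimes> (b \<otimes> c)) = (a \<otimes> b) \<otimes> c"
  and tensor_assoc_inv_pure: "tensor_assoc_inv ((a \<otimes> b) \<otimes> c) = a \<otimes> (b \<otimes> c)"
  and clinear_tensor_assoc: "clinear tensor_assoc"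
  and clinear_tensor_assoc_inv: "clinear tensor_assoc_inv"
  unfolding tensor_assoc_def tensor_assoc_inv_def
  by (simp_all add: tensor_lift_pure clinear_tensor_lift cbilinear_assoc_inner
      cbilinear_assoc_inv_inner cbilinear_assoc_outer cbilinear_assoc_inv_outer)

lemma tensor3_induct_right [case_names pure add]:
  assumes pure: "\<And>a b c. P (a \<otimes> (b \<otimes> c))" and add: "\<And>s t. P s \<Longrightarrow> P t \<Longrightarrow> P (s + t)"
  shows "P t"
proof (induction t rule: tensor_induct)
  case (pure a t)
  show ?case
    by (induction t rule: tensor_induct) (simp_all add: assms pure_add_right)
qed (rule add)

lemma tensor3_induct_left [case_names pure add]:
  assumes pure: "\<And>a b c. P ((a \<otimes> b) \<otimes> c)" and add: "\<And>s t. P s \<Longrightarrow> P t \<Longrightarrow> P (s + t)"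
  shows "P t"
proof (induction t rule: tensor_induct)
  case (pure t c)
  show ?case
    by (induction t rule: tensor_induct) (simp_all add: assms pure_add_left)
qed (rule add)

lemma tensor_assoc_inverse: "tensor_assoc (tensor_assoc_inv t) = t"
  by (induction t rule: tensor3_induct_left)
    (simp_all add: tensor_assoc_pure tensor_assoc_inv_pure
      clinear_add[OF clinear_tensor_assoc] clinear_add[OF clinear_tensor_assoc_inv])

lemma tensor_assoc_inv_inverse: "tensor_assoc_inv (tensor_assoc t) = t"
  by (induction t rule: tensor3_induct_right)
    (simp_all add: tensor_assoc_pure tensor_assoc_inv_pure
      clinear_add[OF clinear_tensor_assoc] clinear_add[OF clinear_tensor_assoc_inv])

lemma tensor_assoc_mult:
  assumes "cbilinear mulA" "cbilinear mulB" "cbilinear mulC"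
  shows "tensor_assoc (tensor_mult mulA (tensor_mult mulB mulC) s t)
    = tensor_mult (tensor_mult mulA mulB) mulC (tensor_assoc s) (tensor_assoc t)"
proof -
  note bl = cbilinear_tensor_mult[OF assms(1) cbilinear_tensor_mult[OF assms(2,3)]]
    cbilinear_tensor_mult[OF cbilinear_tensor_mult[OF assms(1,2)] assms(3)]
  note add = bl[THEN cbilinear_left, THEN clinear_add] bl[THEN cbilinear_right, THEN clinear_add]
    clinear_add[OF clinear_tensor_assoc]
  show ?thesis
  proof (induction s rule: tensor3_induct_right)
    case (pure a b c)
    show ?case
      by (induction t rule: tensor3_induct_right)
        (simp_all add: tensor_mult_pure assms cbilinear_tensor_mult tensor_assoc_pure add)
  qed (simp add: add)
qed


section \<open>Pointwise finite families of linear maps\<close>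

text \<open>Strict convergence of a sum of multipliers is a condition on two families of linear maps, the
  left and the right actions: each vector is annihilated by all but finitely many members.\<close>

definition summable_family :: "'j set \<Rightarrow> ('j \<Rightarrow> 'b::complex_vector \<Rightarrow> 'c::complex_vector) \<Rightarrow> bool" where
  "summable_family J u \<longleftrightarrow> (\<forall>j\<in>J. clinear (u j)) \<and> (\<forall>x. finite {j \<in> J. u j x \<noteq> 0})"

definition family_sum :: "'j set \<Rightarrow> ('j \<Rightarrow> 'b \<Rightarrow> 'c::complex_vector) \<Rightarrow> 'b \<Rightarrow> 'c" where
  "family_sum J u x = (\<Sum>j | j \<in> J \<and> u j x \<noteq> 0. u j x)"

lemma family_sum_eq:
  assumes "finite T" "T \<subseteq> J" "\<And>j. j \<in> J - T \<Longrightarrow> u j x = 0"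
  shows "family_sum J u x = (\<Sum>j\<in>T. u j x)"
  unfolding family_sum_def by (rule sum.mono_neutral_left) (use assms in auto)

lemma family_sum_eq_support:
  assumes "finite T" "T \<subseteq> J" "{j \<in> J. u j x \<noteq> 0} \<subseteq> T"
  shows "family_sum J u x = (\<Sum>j\<in>T. u j x)"
  by (rule family_sum_eq) (use assms in auto)

lemma family_sum_single:
  assumes "i \<in> J" "\<And>j. j \<in> J \<Longrightarrow> j \<noteq> i \<Longrightarrow> u j x = 0"
  shows "family_sum J u x = u i x"
  by (subst family_sum_eq[of "{i}"]) (use assms in auto)

lemma family_sum_cong: "(\<And>j. j \<in> J \<Longrightarrow> u j x = v j y) \<Longrightarrow> family_sum J u x = family_sum J v y"
  unfolding family_sum_def by (rule sum.cong) auto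

lemma summable_familyD:
  "summable_family J u \<Longrightarrow> j \<in> J \<Longrightarrow> clinear (u j)"
  "summable_family J u \<Longrightarrow> finite {j \<in> J. u j x \<noteq> 0}"
  by (auto simp: summable_family_def)

lemma summable_family_cong:
  assumes "\<And>j. j \<in> J \<Longrightarrow> u j = v j" "summable_family J v"
  shows "summable_family J u"
proof -
  have "{j \<in> J. u j x \<noteq> 0} = {j \<in> J. v j x \<noteq> 0}" for x
    using assms(1) by auto
  then show ?thesis using assms by (simp add: summable_family_def)
qed

lemma finite_support_add:
  assumes "\<And>j. j \<in> J \<Longrightarrow> clinear (u j)"
    and "finite {j \<in> J. u j x \<noteq> 0}" "finite {j \<in> J. u j y \<noteq> 0}"
  shows "finite {j \<in> J. u j (x + y) \<noteq> 0}"
proof (rule finite_subset)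
  show "{j \<in> J. u j (x + y) \<noteq> 0} \<subseteq> {j \<in> J. u j x \<noteq> 0} \<union> {j \<in> J. u j y \<noteq> 0}"
    using assms(1) by (auto simp: clinear_add)
qed (use assms in auto)

text \<open>Two vectors may have different supports, but both sums can be taken over the union.\<close>

lemma clinear_family_sum:
  assumes "summable_family J u"
  shows "clinear (family_sum J u)"
proof (rule clinearI)
  fix x y c
  note fin = summable_familyD(2)[OF assms] and lin = summable_familyD(1)[OF assms]
  let ?T = "{j \<in> J. u j x \<noteq> 0} \<union> {j \<in> J. u j y \<noteq> 0}"
  have "family_sum J u (x + y) = (\<Sum>j\<in>?T. u j (x + y))" "family_sum J u x = (\<Sum>j\<in>?T. u j x)"
    "family_sum J u y = (\<Sum>j\<in>?T. u j y)" "family_sum J u (c *\<^sub>C x) = (\<Sum>j\<in>?T. u j (c *\<^sub>C x))"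
    using fin by (auto intro!: family_sum_eq simp: clinear_add[OF lin] clinear_scale[OF lin])
  moreover have "(\<Sum>j\<in>?T. u j (x + y)) = (\<Sum>j\<in>?T. u j x) + (\<Sum>j\<in>?T. u j y)"
    unfolding sum.distrib[symmetric] by (rule sum.cong) (auto simp: clinear_add[OF lin])
  moreover have "(\<Sum>j\<in>?T. u j (c *\<^sub>C x)) = c *\<^sub>C (\<Sum>j\<in>?T. u j x)"
    unfolding complex_vector.scale_sum_right by (rule sum.cong) (auto simp: clinear_scale[OF lin])
  ultimately show "family_sum J u (x + y) = family_sum J u x + family_sum J u y"
    "family_sum J u (c *\<^sub>C x) = c *\<^sub>C family_sum J u x"
    by simp_all
qed

lemma summable_family_after:
  assumes "summable_family J u" "clinear w"
  shows "summable_family J (\<lambda>j x. w (u j x))"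
    and "family_sum J (\<lambda>j x. w (u j x)) x = w (family_sum J u x)"
proof -
  have *: "{j \<in> J. w (u j y) \<noteq> 0} \<subseteq> {j \<in> J. u j y \<noteq> 0}" for y
    using clinear_0[OF assms(2)] by auto
  show "summable_family J (\<lambda>j x. w (u j x))"
    using assms finite_subset[OF *] unfolding summable_family_def
    by (auto intro: clinear_compose)
  show "family_sum J (\<lambda>j x. w (u j x)) x = w (family_sum J u x)"
    unfolding family_sum_def[of J u x] clinear_sum[OF assms(2)]
    by (rule family_sum_eq_support) (use * summable_familyD(2)[OF assms(1)] in auto)
qed

lemma summable_family_before:
  assumes "summable_family J u" "clinear w"
  shows "summable_family J (\<lambda>j x. u j (w x))"
  using assms unfolding summable_family_def by (auto intro: clinear_compose)

text \<open>Pure tensors span, and finiteness of the support as well as the value of the sum pass to sums of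
  tensors.\<close>

lemma summable_family_tensorI:
  assumes lin: "\<And>j. j \<in> J \<Longrightarrow> clinear (u j)" and w: "clinear w"
    and T: "\<And>a b. finite (T a b)" "\<And>a b. T a b \<subseteq> J" "\<And>a b j. j \<in> J - T a b \<Longrightarrow> u j (a \<otimes> b) = 0"
    and sum: "\<And>a b. (\<Sum>j\<in>T a b. u j (a \<otimes> b)) = w (a \<otimes> b)"
  shows "summable_family J u" and "family_sum J u = w"
proof -
  have "finite {j \<in> J. u j t \<noteq> 0}" for t
  proof (induction t rule: tensor_induct)
    case (pure a b)
    have "{j \<in> J. u j (a \<otimes> b) \<noteq> 0} \<subseteq> T a b" using T(3) by blast
    then show ?case using T(1) by (rule finite_subset)
  qed (auto intro: lin finite_support_add)
  then show s: "summable_family J u" using lin by (simp add: summable_family_def)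
  show "family_sum J u = w"
  proof (rule ext, rule clinear_eq_on_pure[OF clinear_family_sum[OF s] w])
    show "family_sum J u (a \<otimes> b) = w (a \<otimes> b)" for a b
      unfolding sum[symmetric] by (rule family_sum_eq) (use T in auto)
  qed
qed

lemma summable_family_tensor_map:
  assumes u: "summable_family J u" and v: "summable_family K v"
  shows "summable_family (J \<times> K) (\<lambda>(i, j). tensor_map (u i) (v j))"
    and "family_sum (J \<times> K) (\<lambda>(i, j). tensor_map (u i) (v j)) = tensor_map (family_sum J u) (family_sum K v)"
proof -
  let ?T = "\<lambda>a b. {i \<in> J. u i a \<noteq> 0} \<times> {j \<in> K. v j b \<noteq> 0}"
  note lin = summable_familyD(1)[OF u] summable_familyD(1)[OF v]
  note fin = summable_familyD(2)[OF u] summable_familyD(2)[OF v]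
  have w: "clinear (tensor_map (family_sum J u) (family_sum K v))"
    by (intro clinear_tensor_map clinear_family_sum u v)
  have sum: "(\<Sum>p\<in>?T a b. (case p of (i, j) \<Rightarrow> tensor_map (u i) (v j)) (a \<otimes> b))
      = tensor_map (family_sum J u) (family_sum K v) (a \<otimes> b)" for a b
  proof -
    have "(\<Sum>p\<in>?T a b. (case p of (i, j) \<Rightarrow> tensor_map (u i) (v j)) (a \<otimes> b)) = (\<Sum>(i, j)\<in>?T a b. u i a \<otimes> v j b)"
      by (rule sum.cong) (auto simp: tensor_map_pure lin)
    also have "\<dots> = family_sum J u a \<otimes> family_sum K v b"
      unfolding family_sum_def pure_sum_left unfolding pure_sum_right sum.cartesian_product by simp
    finally show ?thesis by (simp add: tensor_map_pure clinear_family_sum u v)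
  qed
  show "summable_family (J \<times> K) (\<lambda>(i, j). tensor_map (u i) (v j))"
    "family_sum (J \<times> K) (\<lambda>(i, j). tensor_map (u i) (v j)) = tensor_map (family_sum J u) (family_sum K v)"
    by (rule summable_family_tensorI[of "J \<times> K" "\<lambda>(i, j). tensor_map (u i) (v j)", OF _ w _ _ _ sum];
        use lin fin in \<open>auto simp: tensor_map_pure intro: clinear_tensor_map\<close>)+
qed

lemma summable_family_tensor_map_right:
  assumes w: "clinear w" and v: "summable_family K v"
  shows "summable_family K (\<lambda>j. tensor_map w (v j))"
    and "family_sum K (\<lambda>j. tensor_map w (v j)) = tensor_map w (family_sum K v)"
proof -
  note lin = summable_familyD(1)[OF v]
  have sum: "(\<Sum>j | j \<in> K \<and> v j b \<noteq> 0. tensor_map w (v j) (a \<otimes> b)) = tensor_map w (family_sum K v) (a \<otimes> b)" for a b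
    by (simp add: tensor_map_pure w lin clinear_family_sum v family_sum_def pure_sum_right)
  show "summable_family K (\<lambda>j. tensor_map w (v j))"
    "family_sum K (\<lambda>j. tensor_map w (v j)) = tensor_map w (family_sum K v)"
    by (rule summable_family_tensorI[OF _ clinear_tensor_map[OF w clinear_family_sum[OF v]] _ _ _ sum];
        use w lin summable_familyD(2)[OF v] in \<open>auto simp: tensor_map_pure intro: clinear_tensor_map\<close>)+
qed

lemma summable_family_tensor_map_left:
  assumes w: "clinear w" and v: "summable_family K v"
  shows "summable_family K (\<lambda>j. tensor_map (v j) w)"
    and "family_sum K (\<lambda>j. tensor_map (v j) w) = tensor_map (family_sum K v) w"
proof -
  note lin = summable_familyD(1)[OF v]
  have sum: "(\<Sum>j | j \<in> K \<and> v j a \<noteq> 0. tensor_map (v j) w (a \<otimes> b)) = tensor_map (family_sum K v) w (a \<otimes> b)" for a b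
    by (simp add: tensor_map_pure w lin clinear_family_sum v family_sum_def pure_sum_left)
  show "summable_family K (\<lambda>j. tensor_map (v j) w)"
    "family_sum K (\<lambda>j. tensor_map (v j) w) = tensor_map (family_sum K v) w"
    by (rule summable_family_tensorI[OF _ clinear_tensor_map[OF clinear_family_sum[OF v] w] _ _ _ sum];
        use w lin summable_familyD(2)[OF v] in \<open>auto simp: tensor_map_pure intro: clinear_tensor_map\<close>)+
qed


section \<open>Multipliers\<close>

lemma lr_pair_eqI: "(\<And>x. lact m x = lact n x) \<Longrightarrow> (\<And>x. ract m x = ract n x) \<Longrightarrow> m = n"
  by (rule lr_pair.expand) auto

lemma lact_times [simp]: "lact (m * n) x = lact m (lact n x)"
  and ract_times [simp]: "ract (m * n) x = ract n (ract m x)"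
  and lact_one [simp]: "lact 1 x = x"
  and ract_one [simp]: "ract 1 x = x"
  by (simp_all add: times_lr_pair_def one_lr_pair_def)

lemma lact_plus [simp]: "lact (m + n) x = lact m x + lact n x"
  and ract_plus [simp]: "ract (m + n) x = ract m x + ract n x"
  and lact_scaleC [simp]: "lact (c *\<^sub>C m) x = c *\<^sub>C lact m x"
  and ract_scaleC [simp]: "ract (c *\<^sub>C m) x = c *\<^sub>C ract m x"
  and lact_zero [simp]: "lact 0 x = 0"
  and ract_zero [simp]: "ract 0 x = 0"
  by (simp_all add: plus_lr_pair_def scaleC_lr_pair_def zero_lr_pair_def)

lemma lact_sum: "lact (sum f T) x = (\<Sum>j\<in>T. lact (f j) x)"
  by (induction T rule: infinite_finite_induct) auto

lemma lact_strict_sum: "lact (strict_sum J f) = family_sum J (\<lambda>j. lact (f j))"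
  and ract_strict_sum: "ract (strict_sum J f) = family_sum J (\<lambda>j. ract (f j))"
  by (auto simp: strict_sum_def family_sum_def)

lemma lact_to_multiplier [simp]: "lact (to_multiplier mul b) x = mul b x"
  and ract_to_multiplier [simp]: "ract (to_multiplier mul b) x = mul x b"
  by (simp_all add: to_multiplier_def)

lemma clinear_lact: "clinear (\<lambda>m. lact m x)"
  by (rule clinearI) simp_all

text \<open>The multiplier laws refer to a multiplication, but the calculus of \<open>\<otimes>\<^sub>M\<close> and \<open>*\<close> only uses that both
  actions are linear.\<close>

definition linear_pair :: "'b::complex_vector lr_pair \<Rightarrow> bool" where
  "linear_pair m \<longleftrightarrow> clinear (lact m) \<and> clinear (ract m)"

lemma linear_pair_lact: "linear_pair m \<Longrightarrow> clinear (lact m)"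
  and linear_pair_ract: "linear_pair m \<Longrightarrow> clinear (ract m)"
  by (simp_all add: linear_pair_def)

lemma linear_pair_one [simp]: "linear_pair 1"
  and linear_pair_zero [simp]: "linear_pair 0"
  by (auto simp: linear_pair_def intro: clinearI)

lemma linear_pair_times [intro]: "linear_pair m \<Longrightarrow> linear_pair n \<Longrightarrow> linear_pair (m * n)"
  and linear_pair_plus [intro]: "linear_pair m \<Longrightarrow> linear_pair n \<Longrightarrow> linear_pair (m + n)"
  by (auto simp: linear_pair_def clinear_add clinear_scale scaleC_add_right intro!: clinearI)

lemma times_plus_lr_pair: "linear_pair k \<Longrightarrow> k * (m + n) = k * m + k * n"
  and plus_times_lr_pair: "linear_pair k \<Longrightarrow> (m + n) * k = m * k + n * k"
  and times_scaleC_lr_pair: "linear_pair k \<Longrightarrow> k * (c *\<^sub>C m) = c *\<^sub>C (k * m)"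
  and scaleC_times_lr_pair: "linear_pair k \<Longrightarrow> (c *\<^sub>C m) * k = c *\<^sub>C (m * k)"
  and times_zero_lr_pair: "linear_pair k \<Longrightarrow> k * 0 = 0"
  and zero_times_lr_pair: "linear_pair k \<Longrightarrow> 0 * k = 0"
  by (auto intro!: lr_pair_eqI simp: linear_pair_def clinear_add clinear_scale clinear_0)

lemma clinear_times_left: "linear_pair k \<Longrightarrow> clinear (\<lambda>m. m * k)"
  and clinear_times_right: "linear_pair k \<Longrightarrow> clinear (\<lambda>m. k * m)"
  by (auto intro!: clinearI simp: times_plus_lr_pair plus_times_lr_pair times_scaleC_lr_pair
      scaleC_times_lr_pair)

lemma lact_tensor_pure: "linear_pair m \<Longrightarrow> linear_pair n \<Longrightarrow> lact (m \<otimes>\<^sub>M n) (a \<otimes> b) = lact m a \<otimes> lact n b"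
  and ract_tensor_pure: "linear_pair m \<Longrightarrow> linear_pair n \<Longrightarrow> ract (m \<otimes>\<^sub>M n) (a \<otimes> b) = ract m a \<otimes> ract n b"
  by (simp_all add: multiplier_tensor_def tensor_map_pure linear_pair_def)

lemma lact_tensor: "lact (m \<otimes>\<^sub>M n) = tensor_map (lact m) (lact n)"
  and ract_tensor: "ract (m \<otimes>\<^sub>M n) = tensor_map (ract m) (ract n)"
  by (simp_all add: multiplier_tensor_def)

lemma linear_pair_tensor [intro]: "linear_pair m \<Longrightarrow> linear_pair n \<Longrightarrow> linear_pair (m \<otimes>\<^sub>M n)"
  by (auto simp: linear_pair_def multiplier_tensor_def intro: clinear_tensor_map)

lemma linear_pair_eq_on_pure:
  assumes "linear_pair m" "linear_pair n" "\<And>a b. lact m (a \<otimes> b) = lact n (a \<otimes> b)"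
    "\<And>a b. ract m (a \<otimes> b) = ract n (a \<otimes> b)"
  shows "m = n"
  by (rule lr_pair_eqI; rule clinear_eq_on_pure) (use assms in \<open>auto simp: linear_pair_def\<close>)

lemma tensor_times_tensor:
  assumes "linear_pair m" "linear_pair n" "linear_pair m'" "linear_pair n'"
  shows "(m \<otimes>\<^sub>M n) * (m' \<otimes>\<^sub>M n') = (m * m') \<otimes>\<^sub>M (n * n')"
  by (rule linear_pair_eq_on_pure)
    (use assms in \<open>auto simp: lact_tensor_pure ract_tensor_pure linear_pair_times\<close>)

lemma one_tensor_one [simp]: "1 \<otimes>\<^sub>M 1 = 1"
  by (rule linear_pair_eq_on_pure)
    (auto simp: lact_tensor_pure ract_tensor_pure)

lemma plus_tensor_lr_pair: "\<lbrakk>linear_pair m; linear_pair m'; linear_pair n\<rbrakk>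
    \<Longrightarrow> (m + m') \<otimes>\<^sub>M n = m \<otimes>\<^sub>M n + m' \<otimes>\<^sub>M n"
  and tensor_plus_lr_pair: "\<lbrakk>linear_pair m; linear_pair m'; linear_pair n\<rbrakk>
    \<Longrightarrow> n \<otimes>\<^sub>M (m + m') = n \<otimes>\<^sub>M m + n \<otimes>\<^sub>M m'"
  by (rule linear_pair_eq_on_pure;
      auto simp: lact_tensor_pure ract_tensor_pure linear_pair_plus pure_add_left pure_add_right)+

lemma linear_pair_scaleC [intro]: "linear_pair m \<Longrightarrow> linear_pair (c *\<^sub>C m)"
  by (auto simp: linear_pair_def clinear_add clinear_scale scaleC_add_right scaleC_scaleC mult.commute
      intro!: clinearI)

lemma scaleC_tensor_lr_pair: "\<lbrakk>linear_pair m; linear_pair n\<rbrakk> \<Longrightarrow> (c *\<^sub>C m) \<otimes>\<^sub>M n = c *\<^sub>C (m \<otimes>\<^sub>M n)"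
  and tensor_scaleC_lr_pair: "\<lbrakk>linear_pair m; linear_pair n\<rbrakk> \<Longrightarrow> n \<otimes>\<^sub>M (c *\<^sub>C m) = c *\<^sub>C (n \<otimes>\<^sub>M m)"
  by (rule linear_pair_eq_on_pure;
      auto simp: lact_tensor_pure ract_tensor_pure linear_pair_scaleC pure_scale_left pure_scale_right)+

lemma zero_tensor_lr_pair: "linear_pair n \<Longrightarrow> 0 \<otimes>\<^sub>M n = 0"
  and tensor_zero_lr_pair: "linear_pair n \<Longrightarrow> n \<otimes>\<^sub>M 0 = 0"
  by (rule linear_pair_eq_on_pure; auto simp: lact_tensor_pure ract_tensor_pure)+

lemma cbilinear_multiplier_tensor:
  assumes "clinear f" "clinear g" "\<And>a. linear_pair (f a)" "\<And>b. linear_pair (g b)"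
  shows "cbilinear (\<lambda>a b. f a \<otimes>\<^sub>M g b)"
  by (intro cbilinearI clinearI)
    (simp_all add: clinear_add[OF assms(1)] clinear_add[OF assms(2)] clinear_scale[OF assms(1)]
      clinear_scale[OF assms(2)] assms(3,4) plus_tensor_lr_pair tensor_plus_lr_pair
      scaleC_tensor_lr_pair tensor_scaleC_lr_pair)

lemma multipliersI:
  assumes "linear_pair m"
    and "\<And>x y. lact m (mul x y) = mul (lact m x) y"
    and "\<And>x y. ract m (mul x y) = mul x (ract m y)"
    and "\<And>x y. mul (ract m x) y = mul x (lact m y)"
  shows "m \<in> multipliers mul"
  using assms by (simp add: multipliers_def linear_pair_def)

lemma multiplier_linear_pair: "m \<in> multipliers mul \<Longrightarrow> linear_pair m"
  and multiplier_lact_mult: "m \<in> multipliers mul \<Longrightarrow> lact m (mul x y) = mul (lact m x) y"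
  and multiplier_ract_mult: "m \<in> multipliers mul \<Longrightarrow> ract m (mul x y) = mul x (ract m y)"
  and multiplier_balance: "m \<in> multipliers mul \<Longrightarrow> mul (ract m x) y = mul x (lact m y)"
  by (simp_all add: multipliers_def linear_pair_def)

lemma multipliers_times: "m \<in> multipliers mul \<Longrightarrow> n \<in> multipliers mul \<Longrightarrow> m * n \<in> multipliers mul"
  by (rule multipliersI)
    (auto intro: multiplier_linear_pair simp: multiplier_lact_mult multiplier_ract_mult multiplier_balance)

lemma multipliers_one: "1 \<in> multipliers mul"
  by (rule multipliersI) auto

lemma multipliers_plus:
  assumes "cbilinear mul" "m \<in> multipliers mul" "n \<in> multipliers mul"
  shows "m + n \<in> multipliers mul"
  using assms(2,3)
  by (intro multipliersI)
    (auto intro: multiplier_linear_pair simp: multiplier_lact_mult multiplier_ract_mult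
      multiplier_balance clinear_add[OF cbilinear_left[OF assms(1)]]
      clinear_add[OF cbilinear_right[OF assms(1)]])

lemma multipliers_scaleC:
  assumes "cbilinear mul" "m \<in> multipliers mul"
  shows "c *\<^sub>C m \<in> multipliers mul"
  using assms(2)
  by (intro multipliersI)
    (auto intro: multiplier_linear_pair simp: multiplier_lact_mult multiplier_ract_mult
      multiplier_balance clinear_scale[OF cbilinear_left[OF assms(1)]]
      clinear_scale[OF cbilinear_right[OF assms(1)]])

lemma multipliers_tensor:
  assumes "cbilinear mulA" "cbilinear mulB" "m \<in> multipliers mulA" "n \<in> multipliers mulB"
  shows "m \<otimes>\<^sub>M n \<in> multipliers (tensor_mult mulA mulB)"
proof -
  note lin = assms(3,4)[THEN multiplier_linear_pair]
  note lp = linear_pair_tensor[OF lin]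
  note bl = cbilinear_tensor_mult[OF assms(1,2)]
  note add = bl[THEN cbilinear_left, THEN clinear_add] bl[THEN cbilinear_right, THEN clinear_add]
    clinear_add[OF linear_pair_lact[OF lp]] clinear_add[OF linear_pair_ract[OF lp]]
  note simps = tensor_mult_pure[OF assms(1,2)] lact_tensor_pure[OF lin] ract_tensor_pure[OF lin]
    assms(3,4)[THEN multiplier_lact_mult] assms(3,4)[THEN multiplier_ract_mult]
    assms(3,4)[THEN multiplier_balance]
  have "lact (m \<otimes>\<^sub>M n) (tensor_mult mulA mulB x y) = tensor_mult mulA mulB (lact (m \<otimes>\<^sub>M n) x) y
    \<and> ract (m \<otimes>\<^sub>M n) (tensor_mult mulA mulB x y) = tensor_mult mulA mulB x (ract (m \<otimes>\<^sub>M n) y)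
    \<and> tensor_mult mulA mulB (ract (m \<otimes>\<^sub>M n) x) y = tensor_mult mulA mulB x (lact (m \<otimes>\<^sub>M n) y)" for x y
  proof (induction x rule: tensor_induct)
    case (pure a b)
    show ?case
      by (induction y rule: tensor_induct) (simp_all add: simps add)
  qed (simp add: add)
  then show ?thesis
    by (intro multipliersI lp) blast+
qed

text \<open>Each multiplier law says that two linear expressions in the actions agree, so it passes to
  pointwise finite sums.\<close>

lemma strict_sum_multiplier:
  assumes mul: "cbilinear mul"
    and f: "\<And>j. j \<in> J \<Longrightarrow> f j \<in> multipliers mul"
    and l: "summable_family J (\<lambda>j. lact (f j))" and r: "summable_family J (\<lambda>j. ract (f j))"
  shows "strict_sum J f \<in> multipliers mul"
proof (rule multipliersI)
  show "linear_pair (strict_sum J f)"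
    by (simp add: linear_pair_def lact_strict_sum ract_strict_sum clinear_family_sum l r)
  fix x y
  note left = cbilinear_left[OF mul] and right = cbilinear_right[OF mul]
  show "lact (strict_sum J f) (mul x y) = mul (lact (strict_sum J f) x) y"
    unfolding lact_strict_sum summable_family_after(2)[OF l left, symmetric]
    by (rule family_sum_cong) (simp add: f multiplier_lact_mult)
  show "ract (strict_sum J f) (mul x y) = mul x (ract (strict_sum J f) y)"
    unfolding ract_strict_sum summable_family_after(2)[OF r right, symmetric]
    by (rule family_sum_cong) (simp add: f multiplier_ract_mult)
  show "mul (ract (strict_sum J f) x) y = mul x (lact (strict_sum J f) y)"
    unfolding ract_strict_sum lact_strict_sum
      summable_family_after(2)[OF r left, symmetric] summable_family_after(2)[OF l right, symmetric]
    by (rule family_sum_cong) (simp add: f multiplier_balance)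
qed

lemma linear_pair_multiplier_assoc: "linear_pair m \<Longrightarrow> linear_pair (multiplier_assoc m)"
  unfolding linear_pair_def multiplier_assoc_def
  by (auto intro!: clinear_compose[OF clinear_tensor_assoc] clinear_compose[OF _ clinear_tensor_assoc_inv])

lemma multiplier_assoc_times: "multiplier_assoc (m * n) = multiplier_assoc m * multiplier_assoc n"
  by (simp add: multiplier_assoc_def times_lr_pair_def tensor_assoc_inv_inverse)

lemma clinear_multiplier_assoc: "clinear multiplier_assoc"
  by (rule clinearI; rule lr_pair_eqI)
    (simp_all add: multiplier_assoc_def clinear_add[OF clinear_tensor_assoc] clinear_scale[OF clinear_tensor_assoc])

lemma multiplier_assoc_pure:
  assumes "linear_pair a" "linear_pair b" "linear_pair c"
  shows "multiplier_assoc (a \<otimes>\<^sub>M (b \<otimes>\<^sub>M c)) = (a \<otimes>\<^sub>M b) \<otimes>\<^sub>M c"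
proof (rule lr_pair_eqI)
  note lp = linear_pair_multiplier_assoc[OF linear_pair_tensor[OF assms(1) linear_pair_tensor[OF assms(2,3)]]]
    linear_pair_tensor[OF linear_pair_tensor[OF assms(1,2)] assms(3)]
  note add = lp[THEN linear_pair_lact, THEN clinear_add] lp[THEN linear_pair_ract, THEN clinear_add]
  note simps = lact_tensor_pure ract_tensor_pure assms linear_pair_tensor multiplier_assoc_def
    tensor_assoc_pure tensor_assoc_inv_pure
  show "lact (multiplier_assoc (a \<otimes>\<^sub>M (b \<otimes>\<^sub>M c))) x = lact ((a \<otimes>\<^sub>M b) \<otimes>\<^sub>M c) x" for x
  proof (induction x rule: tensor3_induct_left)
    case (pure a b c)
    show ?case by (simp add: simps)
  qed (simp add: add)
  show "ract (multiplier_assoc (a \<otimes>\<^sub>M (b \<otimes>\<^sub>M c))) x = ract ((a \<otimes>\<^sub>M b) \<otimes>\<^sub>M c) x" for x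
  proof (induction x rule: tensor3_induct_left)
    case (pure a b c)
    show ?case by (simp add: simps)
  qed (simp add: add)
qed

text \<open>Rebracketing the tensor factors is an isomorphism of algebras, so conjugation with it maps
  multipliers to multipliers.\<close>

lemma multiplier_assoc_multiplier:
  fixes mulA :: "'a::complex_vector \<Rightarrow> 'a \<Rightarrow> 'a" and mulB :: "'b::complex_vector \<Rightarrow> 'b \<Rightarrow> 'b"
    and mulC :: "'c::complex_vector \<Rightarrow> 'c \<Rightarrow> 'c"
  assumes "cbilinear mulA" "cbilinear mulB" "cbilinear mulC"
    and m: "m \<in> multipliers (tensor_mult mulA (tensor_mult mulB mulC))"
  shows "multiplier_assoc m \<in> multipliers (tensor_mult (tensor_mult mulA mulB) mulC)"
proof (rule multipliersI)
  show "linear_pair (multiplier_assoc m)"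
    by (intro linear_pair_multiplier_assoc multiplier_linear_pair[OF m])
  fix x y :: "(('a, 'b) tensor, 'c) tensor"
  obtain x' y' where [simp]: "x = tensor_assoc x'" "y = tensor_assoc y'"
    by (metis tensor_assoc_inverse)
  note [simp] = tensor_assoc_mult[OF assms(1-3), symmetric] tensor_assoc_inv_inverse
  let ?mul = "tensor_mult (tensor_mult mulA mulB) mulC"
  show "lact (multiplier_assoc m) (?mul x y) = ?mul (lact (multiplier_assoc m) x) y"
    "ract (multiplier_assoc m) (?mul x y) = ?mul x (ract (multiplier_assoc m) y)"
    "?mul (ract (multiplier_assoc m) x) y = ?mul x (lact (multiplier_assoc m) y)"
    by (simp_all add: multiplier_assoc_def multiplier_lact_mult[OF m] multiplier_ract_mult[OF m]
        multiplier_balance[OF m])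
qed


section \<open>Algebras with a strict family of units\<close>

text \<open>A family that replaces the unit: it acts on each element through finitely many members, and the
  actions add up to the identity on both sides. The elements \<open>1\<^sup>k\<^sub>m\<close> of a total algebra are the example,
  and tensor products inherit such a family.\<close>

locale unit_family =
  fixes mul :: "'b::complex_vector \<Rightarrow> 'b \<Rightarrow> 'b" and J :: "'j set" and e :: "'j \<Rightarrow> 'b"
  assumes bilinear: "cbilinear mul"
    and assoc: "mul (mul x y) z = mul x (mul y z)"
    and summable_left: "summable_family J (\<lambda>j. mul (e j))"
    and sum_left: "family_sum J (\<lambda>j. mul (e j)) x = x"
    and summable_right: "summable_family J (\<lambda>j x. mul x (e j))"
    and sum_right: "family_sum J (\<lambda>j x. mul x (e j)) x = x"
begin

abbreviation "M \<equiv> multipliers mul"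
abbreviation "\<iota> \<equiv> to_multiplier mul"

text \<open>An element is recovered from its right multiples as \<open>x = \<Sum>\<^sub>j x e\<^sub>j\<close>.\<close>

lemma nondegenerate_left:
  assumes "\<And>y. mul x y = mul x' y"
  shows "x = x'"
proof -
  have "family_sum J (\<lambda>j x. mul x (e j)) x = family_sum J (\<lambda>j x. mul x (e j)) x'"
    by (rule family_sum_cong) (rule assms)
  then show ?thesis by (simp only: sum_right)
qed

text \<open>By nondegeneracy the law \<open>(x m) y = x (m y)\<close> determines the right action from the left one.\<close>

lemma multiplier_eqI:
  assumes m: "m \<in> M" and n: "n \<in> M" and eq: "\<And>x. lact m x = lact n x"
  shows "m = n"
proof (rule lr_pair_eqI[OF eq])
  show "ract m x = ract n x" for x
    by (rule nondegenerate_left) (simp add: multiplier_balance[OF m] multiplier_balance[OF n] eq)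
qed

lemma to_multiplier_mem: "\<iota> b \<in> M"
  by (rule multipliersI)
    (simp_all add: linear_pair_def to_multiplier_def assoc cbilinear_left[OF bilinear]
      cbilinear_right[OF bilinear])

lemma to_multiplier_inject: "\<iota> a = \<iota> b \<Longrightarrow> a = b"
  by (rule nondegenerate_left) (metis lact_to_multiplier)

lemma from_multiplier_to_multiplier: "from_multiplier mul (\<iota> b) = b"
  unfolding from_multiplier_def by (rule the_equality) (auto dest: to_multiplier_inject)

lemma clinear_to_multiplier: "clinear \<iota>"
  by (rule clinearI; rule lr_pair_eqI)
    (simp_all add: clinear_add[OF cbilinear_left[OF bilinear]] clinear_add[OF cbilinear_right[OF bilinear]]
      clinear_scale[OF cbilinear_left[OF bilinear]] clinear_scale[OF cbilinear_right[OF bilinear]])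

lemma to_multiplier_mult: "\<iota> (mul a b) = \<iota> a * \<iota> b"
  by (rule lr_pair_eqI) (simp_all add: assoc)

lemma times_to_multiplier: "m \<in> M \<Longrightarrow> m * \<iota> b = \<iota> (lact m b)"
  and to_multiplier_times: "m \<in> M \<Longrightarrow> \<iota> b * m = \<iota> (ract m b)"
  by (rule lr_pair_eqI; simp add: multiplier_lact_mult multiplier_ract_mult multiplier_balance)+

lemma multiplier_zero: "0 \<in> M"
  using to_multiplier_mem[of 0] clinear_0[OF clinear_to_multiplier] by simp

lemma strict_sum_to_multiplier: "strict_sum J (\<lambda>j. \<iota> (e j)) = 1"
  by (rule lr_pair_eqI) (simp_all add: lact_strict_sum ract_strict_sum to_multiplier_def sum_left sum_right)

end

lemma unit_family_tensor:
  assumes "unit_family mulA J e" "unit_family mulB K g"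
  shows "unit_family (tensor_mult mulA mulB) (J \<times> K) (\<lambda>(i, j). e i \<otimes> g j)"
proof -
  interpret A: unit_family mulA J e by fact
  interpret B: unit_family mulB K g by fact
  note bl = cbilinear_tensor_mult[OF A.bilinear B.bilinear]
  have left: "(\<lambda>p. tensor_mult mulA mulB (case p of (i, j) \<Rightarrow> e i \<otimes> g j))
      = (\<lambda>(i, j). tensor_map (mulA (e i)) (mulB (g j)))"
  proof (rule ext, clarify)
    fix i j
    have "tensor_mult mulA mulB (e i \<otimes> g j) t = tensor_map (mulA (e i)) (mulB (g j)) t" for t
      by (rule clinear_eq_on_pure)
        (simp_all add: cbilinear_right bl clinear_tensor_map A.bilinear B.bilinear tensor_map_pure
          tensor_mult_pure)
    then show "tensor_mult mulA mulB (e i \<otimes> g j) = tensor_map (mulA (e i)) (mulB (g j))" by blast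
  qed
  have right: "(\<lambda>p t. tensor_mult mulA mulB t (case p of (i, j) \<Rightarrow> e i \<otimes> g j))
      = (\<lambda>(i, j). tensor_map (\<lambda>x. mulA x (e i)) (\<lambda>x. mulB x (g j)))"
  proof (rule ext, clarify)
    fix i j
    have "tensor_mult mulA mulB t (e i \<otimes> g j) = tensor_map (\<lambda>x. mulA x (e i)) (\<lambda>x. mulB x (g j)) t" for t
      by (rule clinear_eq_on_pure[of "\<lambda>t. tensor_mult mulA mulB t (e i \<otimes> g j)"])
        (simp_all add: cbilinear_left bl clinear_tensor_map A.bilinear B.bilinear tensor_map_pure
          tensor_mult_pure)
    then show "(\<lambda>t. tensor_mult mulA mulB t (e i \<otimes> g j))
        = tensor_map (\<lambda>x. mulA x (e i)) (\<lambda>x. mulB x (g j))" by blast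
  qed
  have id: "family_sum J (\<lambda>j. mulA (e j)) = (\<lambda>x. x)" "family_sum J (\<lambda>j x. mulA x (e j)) = (\<lambda>x. x)"
    "family_sum K (\<lambda>j. mulB (g j)) = (\<lambda>x. x)" "family_sum K (\<lambda>j x. mulB x (g j)) = (\<lambda>x. x)"
    by (simp_all add: fun_eq_iff A.sum_left A.sum_right B.sum_left B.sum_right)
  show ?thesis
  proof
    show "cbilinear (tensor_mult mulA mulB)" by (rule bl)
    show "tensor_mult mulA mulB (tensor_mult mulA mulB x y) z
      = tensor_mult mulA mulB x (tensor_mult mulA mulB y z)" for x y z
      by (rule tensor_mult_assoc[OF A.bilinear B.bilinear A.assoc B.assoc])
  qed (simp_all only: left right summable_family_tensor_map A.summable_left A.summable_right
      B.summable_left B.summable_right id tensor_map_id)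
qed


section \<open>Extension of nondegenerate homomorphisms\<close>

text \<open>The strict sum \<open>E\<close> of the values on the units is the value that any strictly continuous extension
  has to take at \<open>1\<close>.\<close>

locale nondegenerate_hom = B: unit_family mulB J e + C: unit_family mulC K g
  for mulB :: "'b::complex_vector \<Rightarrow> 'b \<Rightarrow> 'b" and J :: "'j set" and e :: "'j \<Rightarrow> 'b"
    and mulC :: "'c::complex_vector \<Rightarrow> 'c \<Rightarrow> 'c" and K :: "'k set" and g :: "'k \<Rightarrow> 'c" +
  fixes f :: "'b \<Rightarrow> 'c lr_pair" and E :: "'c lr_pair"
  assumes f_mem: "f b \<in> multipliers mulC"
    and f_linear: "clinear f"
    and f_mult: "f (mulB a b) = f a * f b"
    and f_summable_left: "summable_family J (\<lambda>j. lact (f (e j)))"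
    and f_summable_right: "summable_family J (\<lambda>j. ract (f (e j)))"
    and f_sum: "E = strict_sum J (\<lambda>j. f (e j))"
begin

lemma E_mem: "E \<in> C.M"
  unfolding f_sum
  by (rule strict_sum_multiplier[OF C.bilinear f_mem f_summable_left f_summable_right])

lemma f_linear_pair: "linear_pair (f b)"
  by (rule multiplier_linear_pair[OF f_mem])

lemma lact_f: "clinear (\<lambda>b. lact (f b) c)"
  by (rule clinear_compose[OF clinear_lact f_linear])

text \<open>This and the next lemma come from \<open>f(e\<^sub>j) f(b) = f(e\<^sub>j b)\<close> and \<open>f(b) f(e\<^sub>j) = f(b e\<^sub>j)\<close>, summed over the
  finitely many \<open>j\<close> with \<open>e\<^sub>j b \<noteq> 0\<close> or \<open>b e\<^sub>j \<noteq> 0\<close>.\<close>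

lemma E_times: "E * f b = f b"
proof (rule C.multiplier_eqI[OF multipliers_times[OF E_mem f_mem] f_mem])
  fix c
  have "lact (E * f b) c = family_sum J (\<lambda>j. lact (f (e j))) (lact (f b) c)"
    by (simp add: f_sum lact_strict_sum)
  also have "\<dots> = family_sum J (\<lambda>j b. lact (f (mulB (e j) b)) c) b"
    by (rule family_sum_cong) (simp add: f_mult)
  also have "\<dots> = lact (f b) c"
    by (simp add: summable_family_after(2)[OF B.summable_left lact_f] B.sum_left)
  finally show "lact (E * f b) c = lact (f b) c" .
qed

lemma times_E: "f b * E = f b"
proof (rule C.multiplier_eqI[OF multipliers_times[OF f_mem E_mem] f_mem])
  fix c
  have "lact (f b * E) c = lact (f b) (family_sum J (\<lambda>j. lact (f (e j))) c)"
    by (simp add: f_sum lact_strict_sum)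
  also have "\<dots> = family_sum J (\<lambda>j c. lact (f b) (lact (f (e j)) c)) c"
    by (rule summable_family_after(2)[OF f_summable_left linear_pair_lact[OF f_linear_pair], symmetric])
  also have "\<dots> = family_sum J (\<lambda>j b. lact (f (mulB b (e j))) c) b"
    by (rule family_sum_cong) (simp add: f_mult)
  also have "\<dots> = lact (f b) c"
    by (simp add: summable_family_after(2)[OF B.summable_right lact_f] B.sum_right)
  finally show "lact (f b * E) c = lact (f b) c" .
qed

text \<open>For each \<open>c\<close> the vector \<open>E c\<close> is a finite sum of vectors \<open>f(e\<^sub>j) c\<close>.\<close>

lemma eq_on_units:
  assumes n: "n \<in> C.M" "n' \<in> C.M" and eq: "\<And>j. j \<in> J \<Longrightarrow> n * f (e j) = n' * f (e j)"
  shows "n * E = n' * E"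
proof (rule C.multiplier_eqI)
  fix c
  have "lact (n * E) c = family_sum J (\<lambda>j c. lact n (lact (f (e j)) c)) c" if "n \<in> C.M" for n
    by (simp add: f_sum lact_strict_sum summable_family_after(2)[OF f_summable_left
        linear_pair_lact[OF multiplier_linear_pair[OF that]]])
  moreover have "family_sum J (\<lambda>j c. lact n (lact (f (e j)) c)) c
      = family_sum J (\<lambda>j c. lact n' (lact (f (e j)) c)) c"
    by (rule family_sum_cong) (metis eq lact_times)
  ultimately show "lact (n * E) c = lact (n' * E) c" using n by simp
qed (intro multipliers_times n E_mem)+

lemma E_idem: "E * E = E"
  using eq_on_units[OF E_mem multipliers_one] by (simp add: E_times)

lemma E_in_span: "lact E c \<in> cspan {lact (f b) c | b. True}"
  unfolding f_sum lact_strict_sum family_sum_def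
  by (rule complex_vector.span_sum) (blast intro: complex_vector.span_base)

text \<open>Cutting \<open>m\<close> on both sides produces elements \<open>e\<^sub>i m e\<^sub>j\<close> of the algebra, to which \<open>f\<close> applies, and
  treats the two actions symmetrically.\<close>

definition extension :: "'b lr_pair \<Rightarrow> 'c lr_pair" where
  "extension m = strict_sum (J \<times> J) (\<lambda>(i, j). f (mulB (e i) (lact m (e j))))"

context
  fixes m assumes m: "m \<in> B.M"
begin

text \<open>In \<open>f(e\<^sub>i m e\<^sub>j) c = f(e\<^sub>i m) f(e\<^sub>j) c\<close> only finitely many \<open>j\<close> contribute, and for each of them only
  finitely many \<open>i\<close>, since \<open>m e\<^sub>j\<close> is an element of the algebra. On the right the roles of \<open>i\<close> and \<open>j\<close>
  are exchanged.\<close>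

lemma extension_summable:
  "summable_family (J \<times> J) (\<lambda>p. lact (case p of (i, j) \<Rightarrow> f (mulB (e i) (lact m (e j)))))"
  "summable_family (J \<times> J) (\<lambda>p. ract (case p of (i, j) \<Rightarrow> f (mulB (e i) (lact m (e j)))))"
proof -
  have fac: "f (mulB (e i) (lact m (e j))) = f (ract m (e i)) * f (e j)" for i j
    by (simp add: multiplier_balance[OF m, symmetric] f_mult)
  have fac': "f (mulB (e i) (lact m (e j))) = f (e i) * f (lact m (e j))" for i j
    by (simp add: f_mult)
  have lin: "clinear (lact (f b))" "clinear (ract (f b))" for b
    using f_linear_pair by (simp_all add: linear_pair_def)
  have z: "f 0 = 0" by (rule clinear_0[OF f_linear])
  have fin1: "finite {p \<in> J \<times> J. lact (f (mulB (e (fst p)) (lact m (e (snd p))))) c \<noteq> 0}" for c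
  proof (rule finite_subset)
    let ?T = "{j \<in> J. lact (f (e j)) c \<noteq> 0}"
    show "{p \<in> J \<times> J. lact (f (mulB (e (fst p)) (lact m (e (snd p))))) c \<noteq> 0}
        \<subseteq> (\<Union>j\<in>?T. (\<lambda>i. (i, j)) ` {i \<in> J. mulB (e i) (lact m (e j)) \<noteq> 0})"
      using z by (auto simp: image_iff) (metis fac lact_times clinear_0 lin(1))
    show "finite (\<Union>j\<in>?T. (\<lambda>i. (i, j)) ` {i \<in> J. mulB (e i) (lact m (e j)) \<noteq> 0})"
      using summable_familyD(2)[OF f_summable_left] summable_familyD(2)[OF B.summable_left] by auto
  qed
  have fin2: "finite {p \<in> J \<times> J. ract (f (mulB (e (fst p)) (lact m (e (snd p))))) c \<noteq> 0}" for c
  proof (rule finite_subset)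
    let ?T = "{i \<in> J. ract (f (e i)) c \<noteq> 0}"
    show "{p \<in> J \<times> J. ract (f (mulB (e (fst p)) (lact m (e (snd p))))) c \<noteq> 0}
        \<subseteq> (\<Union>i\<in>?T. (\<lambda>j. (i, j)) ` {j \<in> J. mulB (ract m (e i)) (e j) \<noteq> 0})"
      using z by (auto simp: image_iff multiplier_balance[OF m]) (metis fac' ract_times clinear_0 lin(2))
    show "finite (\<Union>i\<in>?T. (\<lambda>j. (i, j)) ` {j \<in> J. mulB (ract m (e i)) (e j) \<noteq> 0})"
      using summable_familyD(2)[OF f_summable_right] summable_familyD(2)[OF B.summable_right] by auto
  qed
  show "summable_family (J \<times> J) (\<lambda>p. lact (case p of (i, j) \<Rightarrow> f (mulB (e i) (lact m (e j)))))"
    "summable_family (J \<times> J) (\<lambda>p. ract (case p of (i, j) \<Rightarrow> f (mulB (e i) (lact m (e j)))))"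
    using lin fin1 fin2 by (auto simp: summable_family_def case_prod_beta)
qed

lemma extension_mem: "extension m \<in> C.M"
  unfolding extension_def
  by (rule strict_sum_multiplier[OF C.bilinear _ extension_summable]) (auto simp: f_mem)

lemma extension_times_E: "extension m * E = extension m"
proof (rule C.multiplier_eqI[OF multipliers_times[OF extension_mem E_mem] extension_mem])
  fix c
  have "lact (f b) (lact E c) = lact (f b) c" for b
    by (metis lact_times times_E)
  then show "lact (extension m * E) c = lact (extension m) c"
    by (simp add: extension_def lact_strict_sum) (rule family_sum_cong, auto)
qed

lemma extension_times_f: "extension m * f b = f (lact m b)"
proof (rule C.multiplier_eqI[OF multipliers_times[OF extension_mem f_mem] f_mem])
  fix c
  let ?h = "\<lambda>i j. f (mulB (e i) (lact m (e j)))"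
  let ?F = "{p \<in> J \<times> J. lact (?h (fst p) (snd p)) (lact (f b) c) \<noteq> 0}"
  let ?S = "{i \<in> J. mulB (e i) (lact m b) \<noteq> 0}" and ?T = "{j \<in> J. mulB (e j) b \<noteq> 0}"
  (* a rectangle that contains the support of the double sum and both supports of the unit sums *)
  let ?S' = "fst ` ?F \<union> ?S" and ?T' = "snd ` ?F \<union> ?T"
  have F: "finite ?F"
    using summable_familyD(2)[OF extension_summable(1), of "lact (f b) c"] by (simp add: case_prod_beta)
  have fin: "finite ?S'" "finite ?T'"
    using F summable_familyD(2)[OF B.summable_left] by auto
  have sub: "?F \<subseteq> ?S' \<times> ?T'" using subset_fst_snd[of ?F] by blast
  have subJ: "?S' \<subseteq> J" "?T' \<subseteq> J" by auto
  have S: "(\<Sum>i\<in>?S'. mulB (e i) (lact m b)) = lact m b"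
    using family_sum_eq_support[of ?S' J "\<lambda>j. mulB (e j)" "lact m b"] fin(1) subJ(1) by (simp add: B.sum_left)
  have T: "(\<Sum>j\<in>?T'. mulB (e j) b) = b"
    using family_sum_eq_support[of ?T' J "\<lambda>j. mulB (e j)" b] fin(2) subJ(2) by (simp add: B.sum_left)
  have "lact (extension m * f b) c = (\<Sum>(i, j)\<in>?S' \<times> ?T'. lact (?h i j) (lact (f b) c))"
    unfolding extension_def lact_times lact_strict_sum
    by (subst family_sum_eq_support[of "?S' \<times> ?T'"]) (use fin sub in \<open>auto simp: case_prod_beta\<close>)
  also have "\<dots> = (\<Sum>i\<in>?S'. \<Sum>j\<in>?T'. lact (f (mulB (e i) (lact m (mulB (e j) b)))) c)"
    unfolding sum.cartesian_product
    by (rule sum.cong) (auto simp: f_mult B.assoc multiplier_lact_mult[OF m])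
  also have "\<dots> = (\<Sum>i\<in>?S'. lact (f (mulB (e i) (lact m (\<Sum>j\<in>?T'. mulB (e j) b)))) c)"
    by (simp add: clinear_sum[OF lact_f] clinear_sum[OF linear_pair_lact[OF multiplier_linear_pair[OF m]]]
        clinear_sum[OF cbilinear_right[OF B.bilinear]])
  also have "\<dots> = lact (f (lact m b)) c"
    unfolding T clinear_sum[OF lact_f, symmetric] S ..
  finally show "lact (extension m * f b) c = lact (f (lact m b)) c" .
qed

text \<open>All values of extensions are computed through this characterisation.\<close>

lemma extension_eqI:
  assumes "n \<in> C.M" "n * E = n" "\<And>j. j \<in> J \<Longrightarrow> n * f (e j) = f (lact m (e j))"
  shows "extension m = n"
  using eq_on_units[OF extension_mem assms(1)] assms(2,3) by (simp add: extension_times_f extension_times_E)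

end

lemma extension_to_multiplier: "extension (B.\<iota> b) = f b"
  by (rule extension_eqI[OF B.to_multiplier_mem f_mem times_E]) (simp add: f_mult)

lemma extension_one: "extension 1 = E"
  by (rule extension_eqI[OF multipliers_one E_mem E_idem]) (simp add: E_times)

lemma extension_times:
  assumes "m \<in> B.M" "n \<in> B.M"
  shows "extension (m * n) = extension m * extension n"
  by (rule extension_eqI)
    (use assms in \<open>simp_all add: multipliers_times extension_mem mult.assoc extension_times_E
      extension_times_f\<close>)

lemma extension_plus:
  assumes "m \<in> B.M" "n \<in> B.M"
  shows "extension (m + n) = extension m + extension n"
  by (rule extension_eqI)
    (use assms in \<open>simp_all add: multipliers_plus B.bilinear C.bilinear extension_mem
      plus_times_lr_pair multiplier_linear_pair[OF E_mem] f_linear_pair extension_times_E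
      extension_times_f clinear_add[OF f_linear]\<close>)

lemma extension_scaleC:
  assumes "m \<in> B.M"
  shows "extension (c *\<^sub>C m) = c *\<^sub>C extension m"
  by (rule extension_eqI)
    (use assms in \<open>simp_all add: multipliers_scaleC B.bilinear C.bilinear extension_mem
      scaleC_times_lr_pair multiplier_linear_pair[OF E_mem] f_linear_pair extension_times_E
      extension_times_f clinear_scale[OF f_linear]\<close>)

text \<open>Any competitor \<open>F\<close> satisfies \<open>F(m) E = F(m) F(1) = F(m)\<close> and \<open>F(m) f(e\<^sub>j) = F(m e\<^sub>j) = f(m e\<^sub>j)\<close>, so
  \<open>extension_eqI\<close> identifies it.\<close>

lemma extend_hom_eq: "extend_hom mulB mulC f E = restrict extension B.M"
  unfolding extend_hom_def
proof (rule the_equality)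
  show "restrict extension B.M \<in> B.M \<rightarrow>\<^sub>E C.M \<and>
     clinear_on B.M (restrict extension B.M) \<and>
     (\<forall>m\<in>B.M. \<forall>n\<in>B.M. restrict extension B.M (m * n)
        = restrict extension B.M m * restrict extension B.M n) \<and>
     (\<forall>b. restrict extension B.M (B.\<iota> b) = f b) \<and>
     restrict extension B.M 1 = E"
    using B.bilinear
    by (auto simp: extension_mem clinear_on_def multipliers_plus multipliers_scaleC multipliers_times
        extension_plus extension_scaleC extension_times B.to_multiplier_mem extension_to_multiplier
        multipliers_one extension_one)
next
  fix F
  assume F: "F \<in> B.M \<rightarrow>\<^sub>E C.M \<and> clinear_on B.M F \<and> (\<forall>m\<in>B.M. \<forall>n\<in>B.M. F (m * n) = F m * F n) \<and>
    (\<forall>b. F (B.\<iota> b) = f b) \<and> F 1 = E"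
  show "F = restrict extension B.M"
  proof (rule extensionalityI[of _ B.M])
    fix m assume m: "m \<in> B.M"
    have "extension m = F m"
    proof (rule extension_eqI[OF m])
      show "F m \<in> C.M" using F m by auto
      show "F m * E = F m" using F m multipliers_one by (metis mult.right_neutral)
      show "F m * f (e j) = f (lact m (e j))" for j
        using F m B.to_multiplier_mem by (metis B.times_to_multiplier)
    qed
    then show "F m = restrict extension B.M m" using m by simp
  qed (use F in \<open>auto simp: PiE_def\<close>)
qed

lemma extend_hom: "m \<in> B.M \<Longrightarrow> extend_hom mulB mulC f E m = extension m"
  by (simp add: extend_hom_eq)

end


section \<open>Tensor products of nondegenerate homomorphisms\<close>

lemma nondegenerate_hom_id:
  assumes "unit_family mul J e"
  shows "nondegenerate_hom mul J e mul J e (to_multiplier mul) 1"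
proof -
  interpret unit_family mul J e by fact
  have "lact (\<iota> b) = mul b" "ract (\<iota> b) = (\<lambda>x. mul x b)" for b
    by auto
  then show ?thesis
    by unfold_locales
      (simp_all add: to_multiplier_mem clinear_to_multiplier to_multiplier_mult strict_sum_to_multiplier
        summable_left summable_right)
qed

lemma extend_hom_id:
  assumes "unit_family mul J e" "m \<in> multipliers mul"
  shows "extend_hom mul mul (to_multiplier mul) 1 m = m"
proof -
  interpret unit_family mul J e by fact
  interpret nondegenerate_hom mul J e mul J e "to_multiplier mul" 1
    by (rule nondegenerate_hom_id) fact
  show ?thesis
    using extend_hom[OF assms(2)] extension_eqI[OF assms(2,2)] times_to_multiplier[OF assms(2)] by simp
qed

text \<open>The units of \<open>B \<otimes> B'\<close> are the \<open>e\<^sub>i \<otimes> e'\<^sub>j\<close>, and the sum of \<open>f(e\<^sub>i) \<otimes> f'(e'\<^sub>j)\<close> factorises. With one factor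
  the canonical map \<open>A \<rightarrow> M(A)\<close> this covers \<open>\<Delta> \<otimes> id\<close> and \<open>id \<otimes> \<Delta>\<close>.\<close>

lemma nondegenerate_hom_tensor:
  assumes "nondegenerate_hom mulB J e mulC K g f E" "nondegenerate_hom mulB' J' e' mulC' K' g' f' E'"
  shows "nondegenerate_hom (tensor_mult mulB mulB') (J \<times> J') (\<lambda>(i, j). e i \<otimes> e' j)
      (tensor_mult mulC mulC') (K \<times> K') (\<lambda>(i, j). g i \<otimes> g' j)
      (tensor_lift (\<lambda>a b. f a \<otimes>\<^sub>M f' b)) (E \<otimes>\<^sub>M E')" (is "nondegenerate_hom _ _ _ _ _ _ ?h _")
    and "\<And>a b. tensor_lift (\<lambda>a b. f a \<otimes>\<^sub>M f' b) (a \<otimes> b) = f a \<otimes>\<^sub>M f' b"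
proof -
  interpret F: nondegenerate_hom mulB J e mulC K g f E by fact
  interpret F': nondegenerate_hom mulB' J' e' mulC' K' g' f' E' by fact
  interpret BB: unit_family "tensor_mult mulB mulB'" "J \<times> J'" "\<lambda>(i, j). e i \<otimes> e' j"
    by (rule unit_family_tensor) unfold_locales
  interpret CC: unit_family "tensor_mult mulC mulC'" "K \<times> K'" "\<lambda>(i, j). g i \<otimes> g' j"
    by (rule unit_family_tensor) unfold_locales
  have bl: "cbilinear (\<lambda>a b. f a \<otimes>\<^sub>M f' b)"
    by (intro cbilinear_multiplier_tensor F.f_linear F'.f_linear F.f_linear_pair F'.f_linear_pair)
  show h_pure: "?h (a \<otimes> b) = f a \<otimes>\<^sub>M f' b" for a b
    by (rule tensor_lift_pure[OF bl])
  have lin: "clinear ?h"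
    by (rule clinear_tensor_lift[OF bl])
  note add = clinear_add[OF lin]
  have mem: "?h t \<in> multipliers (tensor_mult mulC mulC')" for t
    by (induction t rule: tensor_induct)
      (auto simp: h_pure add intro: multipliers_tensor multipliers_plus F.C.bilinear F'.C.bilinear
        F.f_mem F'.f_mem CC.bilinear)
  note lp = multiplier_linear_pair[OF mem]
  have mult: "?h (tensor_mult mulB mulB' s t) = ?h s * ?h t" for s t
  proof (induction s rule: tensor_induct)
    case (pure a b)
    show ?case
    proof (induction t rule: tensor_induct)
      case (pure a' b')
      show ?case
        by (simp add: tensor_mult_pure F.B.bilinear F'.B.bilinear h_pure F.f_mult F'.f_mult
            tensor_times_tensor F.f_linear_pair F'.f_linear_pair)
    qed (simp add: add clinear_add[OF cbilinear_right[OF BB.bilinear]] times_plus_lr_pair lp)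
  qed (simp add: add clinear_add[OF cbilinear_left[OF BB.bilinear]] plus_times_lr_pair lp)
  have l: "(\<lambda>p. lact (?h (case p of (i, j) \<Rightarrow> e i \<otimes> e' j)))
      = (\<lambda>(i, j). tensor_map (lact (f (e i))) (lact (f' (e' j))))"
    and r: "(\<lambda>p. ract (?h (case p of (i, j) \<Rightarrow> e i \<otimes> e' j)))
      = (\<lambda>(i, j). tensor_map (ract (f (e i))) (ract (f' (e' j))))"
    by (auto simp: fun_eq_iff h_pure lact_tensor ract_tensor)
  have "E \<otimes>\<^sub>M E' = strict_sum (J \<times> J') (\<lambda>p. ?h (case p of (i, j) \<Rightarrow> e i \<otimes> e' j))"
    by (rule lr_pair.expand, intro conjI)
      (simp_all only: lact_tensor ract_tensor F.f_sum F'.f_sum lact_strict_sum ract_strict_sum l r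
        summable_family_tensor_map(2)[OF F.f_summable_left F'.f_summable_left]
        summable_family_tensor_map(2)[OF F.f_summable_right F'.f_summable_right])
  then show "nondegenerate_hom (tensor_mult mulB mulB') (J \<times> J') (\<lambda>(i, j). e i \<otimes> e' j)
      (tensor_mult mulC mulC') (K \<times> K') (\<lambda>(i, j). g i \<otimes> g' j) ?h (E \<otimes>\<^sub>M E')"
    by unfold_locales
      (simp_all only: mem lin mult l r summable_family_tensor_map F.f_summable_left
        F'.f_summable_left F.f_summable_right F'.f_summable_right)
qed

text \<open>On the units both sides multiply \<open>f(e\<^sub>i) \<otimes> f'(e'\<^sub>j)\<close> to \<open>f(m e\<^sub>i) \<otimes> f'(n e'\<^sub>j)\<close>.\<close>

lemma extend_hom_tensor:
  assumes F: "nondegenerate_hom mulB J e mulC K g f E"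
    and F': "nondegenerate_hom mulB' J' e' mulC' K' g' f' E'"
    and m: "m \<in> multipliers mulB" and n: "n \<in> multipliers mulB'"
  shows "extend_hom (tensor_mult mulB mulB') (tensor_mult mulC mulC')
      (tensor_lift (\<lambda>a b. f a \<otimes>\<^sub>M f' b)) (E \<otimes>\<^sub>M E') (m \<otimes>\<^sub>M n)
    = extend_hom mulB mulC f E m \<otimes>\<^sub>M extend_hom mulB' mulC' f' E' n"
proof -
  interpret F: nondegenerate_hom mulB J e mulC K g f E by fact
  interpret F': nondegenerate_hom mulB' J' e' mulC' K' g' f' E' by fact
  interpret T: nondegenerate_hom "tensor_mult mulB mulB'" "J \<times> J'" "\<lambda>(i, j). e i \<otimes> e' j"
    "tensor_mult mulC mulC'" "K \<times> K'" "\<lambda>(i, j). g i \<otimes> g' j"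
    "tensor_lift (\<lambda>a b. f a \<otimes>\<^sub>M f' b)" "E \<otimes>\<^sub>M E'"
    by (rule nondegenerate_hom_tensor[OF F F'])
  have mn: "m \<otimes>\<^sub>M n \<in> T.B.M"
    by (intro multipliers_tensor F.B.bilinear F'.B.bilinear m n)
  note mem = F.extension_mem[OF m] F'.extension_mem[OF n]
  note lp = mem[THEN multiplier_linear_pair] F.E_mem[THEN multiplier_linear_pair]
    F'.E_mem[THEN multiplier_linear_pair] F.f_linear_pair F'.f_linear_pair
    m[THEN multiplier_linear_pair] n[THEN multiplier_linear_pair]
  have "T.extension (m \<otimes>\<^sub>M n) = F.extension m \<otimes>\<^sub>M F'.extension n"
  proof (rule T.extension_eqI[OF mn])
    show "F.extension m \<otimes>\<^sub>M F'.extension n \<in> T.C.M"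
      by (intro multipliers_tensor F.C.bilinear F'.C.bilinear mem)
    show "F.extension m \<otimes>\<^sub>M F'.extension n * (E \<otimes>\<^sub>M E') = F.extension m \<otimes>\<^sub>M F'.extension n"
      by (simp add: tensor_times_tensor lp F.extension_times_E F'.extension_times_E m n)
    show "F.extension m \<otimes>\<^sub>M F'.extension n * tensor_lift (\<lambda>a b. f a \<otimes>\<^sub>M f' b) (case p of (i, j) \<Rightarrow> e i \<otimes> e' j)
        = tensor_lift (\<lambda>a b. f a \<otimes>\<^sub>M f' b) (lact (m \<otimes>\<^sub>M n) (case p of (i, j) \<Rightarrow> e i \<otimes> e' j))" for p
      by (cases p) (simp add: nondegenerate_hom_tensor(2)[OF F F'] tensor_times_tensor lp
          lact_tensor_pure F.extension_times_f F'.extension_times_f m n)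
  qed
  then show ?thesis
    by (simp add: T.extend_hom mn F.extend_hom m F'.extend_hom n)
qed

lemma multiplier_assoc_strict_sum:
  assumes "summable_family J (\<lambda>j. lact (f j))" "summable_family J (\<lambda>j. ract (f j))"
  shows "multiplier_assoc (strict_sum J f) = strict_sum J (\<lambda>j. multiplier_assoc (f j))"
  by (rule lr_pair_eqI;
      simp only: multiplier_assoc_def lr_pair.sel lact_strict_sum ract_strict_sum
        summable_family_after(2)[OF assms(1) clinear_tensor_assoc, symmetric]
        summable_family_after(2)[OF assms(2) clinear_tensor_assoc, symmetric];
      simp only: family_sum_def)

text \<open>Threefold tensor products are bracketed to the left, while \<open>id \<otimes> \<Delta>\<close> naturally lands in the other
  bracketing; this lemma and the next move such homomorphisms and their extensions across.\<close>

lemma nondegenerate_hom_assoc: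
  assumes F: "nondegenerate_hom mulB J e (tensor_mult mul1 (tensor_mult mul2 mul3)) K g f E"
    and bl: "cbilinear mul1" "cbilinear mul2" "cbilinear mul3"
    and C: "unit_family (tensor_mult (tensor_mult mul1 mul2) mul3) K' g'"
  shows "nondegenerate_hom mulB J e (tensor_mult (tensor_mult mul1 mul2) mul3) K' g'
      (\<lambda>b. multiplier_assoc (f b)) (multiplier_assoc E)"
proof -
  interpret F: nondegenerate_hom mulB J e "tensor_mult mul1 (tensor_mult mul2 mul3)" K g f E by fact
  interpret C: unit_family "tensor_mult (tensor_mult mul1 mul2) mul3" K' g' by fact
  show ?thesis
  proof
    show "multiplier_assoc (f b) \<in> multipliers (tensor_mult (tensor_mult mul1 mul2) mul3)" for b
      by (rule multiplier_assoc_multiplier[OF bl F.f_mem])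
    show "clinear (\<lambda>b. multiplier_assoc (f b))"
      by (rule clinear_compose[OF clinear_multiplier_assoc F.f_linear])
    show "multiplier_assoc (f (mulB a b)) = multiplier_assoc (f a) * multiplier_assoc (f b)" for a b
      by (simp add: F.f_mult multiplier_assoc_times)
    show "summable_family J (\<lambda>j. lact (multiplier_assoc (f (e j))))"
      "summable_family J (\<lambda>j. ract (multiplier_assoc (f (e j))))"
      unfolding multiplier_assoc_def lr_pair.sel
      by (intro summable_family_after(1)[OF _ clinear_tensor_assoc]
          summable_family_before[OF _ clinear_tensor_assoc_inv] F.f_summable_left F.f_summable_right)+
    show "multiplier_assoc E = strict_sum J (\<lambda>j. multiplier_assoc (f (e j)))"
      unfolding F.f_sum
      by (rule multiplier_assoc_strict_sum[OF F.f_summable_left F.f_summable_right])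
  qed
qed

lemma extend_hom_assoc:
  assumes F: "nondegenerate_hom mulB J e (tensor_mult mul1 (tensor_mult mul2 mul3)) K g f E"
    and bl: "cbilinear mul1" "cbilinear mul2" "cbilinear mul3"
    and C: "unit_family (tensor_mult (tensor_mult mul1 mul2) mul3) K' g'"
    and m: "m \<in> multipliers mulB"
  shows "extend_hom mulB (tensor_mult (tensor_mult mul1 mul2) mul3)
      (\<lambda>b. multiplier_assoc (f b)) (multiplier_assoc E) m
    = multiplier_assoc (extend_hom mulB (tensor_mult mul1 (tensor_mult mul2 mul3)) f E m)"
proof -
  interpret F: nondegenerate_hom mulB J e "tensor_mult mul1 (tensor_mult mul2 mul3)" K g f E by fact
  interpret G: nondegenerate_hom mulB J e "tensor_mult (tensor_mult mul1 mul2) mul3" K' g'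
    "\<lambda>b. multiplier_assoc (f b)" "multiplier_assoc E"
    by (rule nondegenerate_hom_assoc) fact+
  have "G.extension m = multiplier_assoc (F.extension m)"
    by (rule G.extension_eqI[OF m multiplier_assoc_multiplier[OF bl F.extension_mem[OF m]]])
      (simp_all add: multiplier_assoc_times[symmetric] F.extension_times_E[OF m] F.extension_times_f[OF m])
  then show ?thesis by (simp add: F.extend_hom G.extend_hom m)
qed


section \<open>Partitions of the unit and block matrices\<close>

text \<open>The model is \<open>\<Sum>\<^sub>r \<lambda>\<^sub>r = 1\<close> in \<open>M(A)\<close>, where the summands are multipliers but not elements of \<open>A\<close>.\<close>

definition partition_of_one :: "('b::complex_vector \<Rightarrow> 'b \<Rightarrow> 'b) \<Rightarrow> 'i set \<Rightarrow> ('i \<Rightarrow> 'b lr_pair) \<Rightarrow> bool" where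
  "partition_of_one mul I P \<longleftrightarrow> (\<forall>r\<in>I. P r \<in> multipliers mul) \<and>
     summable_family I (\<lambda>r. lact (P r)) \<and> summable_family I (\<lambda>r. ract (P r)) \<and> strict_sum I P = 1"

lemma partition_of_oneD:
  assumes "partition_of_one mul I P"
  shows "r \<in> I \<Longrightarrow> P r \<in> multipliers mul" "r \<in> I \<Longrightarrow> linear_pair (P r)"
    "summable_family I (\<lambda>r. lact (P r))"
    "summable_family I (\<lambda>r. ract (P r))" "family_sum I (\<lambda>r. lact (P r)) x = x"
proof -
  show "family_sum I (\<lambda>r. lact (P r)) x = x"
    using assms by (simp add: partition_of_one_def flip: lact_strict_sum)
qed (use assms in \<open>auto simp: partition_of_one_def intro: multiplier_linear_pair\<close>)

lemma partition_of_one_tensor_left: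
  assumes "cbilinear mulA" "cbilinear mulB" "partition_of_one mulA I P"
  shows "partition_of_one (tensor_mult mulA mulB) I (\<lambda>r. P r \<otimes>\<^sub>M 1)"
proof -
  have one: "lact 1 = (\<lambda>x. x)" "ract 1 = (\<lambda>x. x)" by auto
  have P: "family_sum I (\<lambda>r. lact (P r)) = (\<lambda>x. x)" "family_sum I (\<lambda>r. ract (P r)) = (\<lambda>x. x)"
    using assms(3) by (simp_all add: partition_of_one_def lact_strict_sum[symmetric] ract_strict_sum[symmetric] one)
  have "strict_sum I (\<lambda>r. P r \<otimes>\<^sub>M 1) = 1"
    by (rule lr_pair.expand)
      (use assms(3) in \<open>simp add: lact_strict_sum ract_strict_sum lact_tensor ract_tensor one P tensor_map_id
        partition_of_one_def summable_family_tensor_map_left[OF clinear_id]\<close>)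
  then show ?thesis
    using assms unfolding partition_of_one_def lact_tensor ract_tensor one
    by (auto intro: multipliers_tensor multipliers_one summable_family_tensor_map_left clinear_id)
qed

lemma partition_of_one_tensor_right:
  assumes "cbilinear mulA" "cbilinear mulB" "partition_of_one mulB I P"
  shows "partition_of_one (tensor_mult mulA mulB) I (\<lambda>r. 1 \<otimes>\<^sub>M P r)"
proof -
  have one: "lact 1 = (\<lambda>x. x)" "ract 1 = (\<lambda>x. x)" by auto
  have P: "family_sum I (\<lambda>r. lact (P r)) = (\<lambda>x. x)" "family_sum I (\<lambda>r. ract (P r)) = (\<lambda>x. x)"
    using assms(3) by (simp_all add: partition_of_one_def lact_strict_sum[symmetric] ract_strict_sum[symmetric] one)
  have "strict_sum I (\<lambda>r. 1 \<otimes>\<^sub>M P r) = 1"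
    by (rule lr_pair.expand)
      (use assms(3) in \<open>simp add: lact_strict_sum ract_strict_sum lact_tensor ract_tensor one P tensor_map_id
        partition_of_one_def summable_family_tensor_map_right[OF clinear_id]\<close>)
  then show ?thesis
    using assms unfolding partition_of_one_def lact_tensor ract_tensor one
    by (auto intro: multipliers_tensor multipliers_one summable_family_tensor_map_right clinear_id)
qed

lemma lact_family_sum_partition:
  assumes "partition_of_one mul I P" "clinear w"
  shows "w x = family_sum I (\<lambda>r x. w (lact (P r) x)) x"
  by (simp add: summable_family_after(2)[OF partition_of_oneD(3)[OF assms(1)] assms(2)]
      partition_of_oneD(5)[OF assms(1)])

context unit_family
begin

lemma partition_cancel_left:
  assumes "partition_of_one mul I P" "m \<in> M" "n \<in> M" "\<And>r. r \<in> I \<Longrightarrow> P r * m = P r * n"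
  shows "m = n"
proof (rule multiplier_eqI[OF assms(2,3)])
  fix x
  have "family_sum I (\<lambda>r. lact (P r)) (lact m x) = family_sum I (\<lambda>r. lact (P r)) (lact n x)"
    by (rule family_sum_cong) (metis assms(4) lact_times)
  then show "lact m x = lact n x" by (simp only: partition_of_oneD(5)[OF assms(1)])
qed

lemma partition_cancel_right:
  assumes "partition_of_one mul I P" "m \<in> M" "n \<in> M" "\<And>r. r \<in> I \<Longrightarrow> m * P r = n * P r"
  shows "m = n"
proof (rule multiplier_eqI[OF assms(2,3)])
  fix x
  note P = lact_family_sum_partition[OF assms(1)]
    assms(2,3)[THEN multiplier_linear_pair, THEN linear_pair_lact]
  show "lact m x = lact n x"
    by (subst (1 2) P(1)) (rule P(2) P(3), rule P(2) P(3), rule family_sum_cong, metis assms(4) lact_times)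
qed

lemma partition_sandwich:
  assumes P: "partition_of_one mul I P" and m: "m \<in> M" and n: "n \<in> M"
    and eq: "\<And>r s. r \<in> I \<Longrightarrow> s \<in> I \<Longrightarrow> P r * m * P s = P r * n * P s"
  shows "m = n"
  by (rule partition_cancel_left[OF P m n], rule partition_cancel_right[OF P])
    (auto intro: multipliers_times m n partition_of_oneD(1)[OF P] eq)

text \<open>A strict sum of diagonal blocks, such as \<open>E = \<Sum>\<^sub>l \<rho>\<^sub>l \<otimes> \<lambda>\<^sub>l\<close>: cutting with \<open>P\<^sub>r\<close> on one side already
  isolates the block at \<open>r\<close>.\<close>

lemma strict_sum_diagonal:
  assumes P: "partition_of_one mul I P" and f: "\<And>l. l \<in> I \<Longrightarrow> f l \<in> M"
    and left: "\<And>r l. r \<in> I \<Longrightarrow> l \<in> I \<Longrightarrow> P r * f l = (if r = l then f l else 0)"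
    and right: "\<And>r l. r \<in> I \<Longrightarrow> l \<in> I \<Longrightarrow> f l * P r = (if r = l then f l else 0)"
  shows "strict_sum I f \<in> M"
    and "r \<in> I \<Longrightarrow> P r * strict_sum I f = f r"
    and "r \<in> I \<Longrightarrow> strict_sum I f * P r = f r"
proof -
  have fl: "lact (f l) (lact (P l) x) = lact (f l) x" "ract (f l) (ract (P l) x) = ract (f l) x"
    if "l \<in> I" for l x
    using left[OF that that] right[OF that that] by (metis lact_times ract_times)+
  have lin: "clinear (lact (f l))" "clinear (ract (f l))" "clinear (lact (P l))" "clinear (ract (P l))"
    if "l \<in> I" for l
    using multiplier_linear_pair[OF f[OF that]] multiplier_linear_pair[OF partition_of_oneD(1)[OF P that]]
    by (simp_all add: linear_pair_def)
  have sub: "{l \<in> I. lact (f l) x \<noteq> 0} \<subseteq> {l \<in> I. lact (P l) x \<noteq> 0}"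
    "{l \<in> I. ract (f l) x \<noteq> 0} \<subseteq> {l \<in> I. ract (P l) x \<noteq> 0}" for x
    using fl lin by (auto, (metis clinear_0)+)
  have sl: "summable_family I (\<lambda>l. lact (f l))" and sr: "summable_family I (\<lambda>l. ract (f l))"
    using lin finite_subset[OF sub(1) summable_familyD(2)[OF partition_of_oneD(3)[OF P]]]
      finite_subset[OF sub(2) summable_familyD(2)[OF partition_of_oneD(4)[OF P]]]
    by (auto simp: summable_family_def)
  show S: "strict_sum I f \<in> M"
    by (rule strict_sum_multiplier[OF bilinear f sl sr])
  assume r: "r \<in> I"
  have lP: "lact (P r) (lact (f l) x) = (if r = l then lact (f l) x else 0)"
    "lact (f l) (lact (P r) x) = (if r = l then lact (f l) x else 0)" if "l \<in> I" for l x
    using left[OF r that] right[OF r that] by (metis lact_times lact_zero)+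
  show "P r * strict_sum I f = f r"
  proof (rule multiplier_eqI[OF multipliers_times[OF partition_of_oneD(1)[OF P r] S] f[OF r]])
    fix x
    have "lact (P r * strict_sum I f) x = family_sum I (\<lambda>l x. lact (P r) (lact (f l) x)) x"
      by (simp add: lact_strict_sum summable_family_after(2)[OF sl lin(3)[OF r]])
    also have "\<dots> = lact (f r) x"
      by (subst family_sum_eq[of "{r}"]) (auto simp: r lP)
    finally show "lact (P r * strict_sum I f) x = lact (f r) x" .
  qed
  show "strict_sum I f * P r = f r"
  proof (rule multiplier_eqI[OF multipliers_times[OF S partition_of_oneD(1)[OF P r]] f[OF r]])
    fix x
    show "lact (strict_sum I f * P r) x = lact (f r) x"
      by (simp add: lact_strict_sum, subst family_sum_eq[of "{r}"]) (auto simp: r lP)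
  qed
qed

end

text \<open>The first two equations place \<open>d r s\<close> in position \<open>(r, s)\<close>; the two finiteness conditions are rcf.\<close>

definition strict_matrix ::
    "('b::complex_vector \<Rightarrow> 'b \<Rightarrow> 'b) \<Rightarrow> 'i set \<Rightarrow> ('i \<Rightarrow> 'b lr_pair) \<Rightarrow> ('i \<Rightarrow> 'i \<Rightarrow> 'b lr_pair) \<Rightarrow> bool" where
  "strict_matrix mul I P d \<longleftrightarrow>
     (\<forall>r\<in>I. \<forall>s\<in>I. d r s \<in> multipliers mul) \<and>
     (\<forall>r\<in>I. \<forall>r'\<in>I. \<forall>s\<in>I. P r * d r' s = (if r = r' then d r' s else 0)) \<and>
     (\<forall>r\<in>I. \<forall>s\<in>I. \<forall>s'\<in>I. d r s' * P s = (if s = s' then d r s' else 0)) \<and>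
     (\<forall>s\<in>I. finite {r \<in> I. d r s \<noteq> 0}) \<and> (\<forall>r\<in>I. finite {s \<in> I. d r s \<noteq> 0})"

context unit_family
begin

text \<open>On \<open>x\<close> only columns \<open>s\<close> with \<open>P\<^sub>s x \<noteq> 0\<close> contribute, and each column is finite; for the right action
  this holds with rows.\<close>

lemma strict_matrix_summable:
  assumes P: "partition_of_one mul I P" and d: "strict_matrix mul I P d"
  shows "summable_family (I \<times> I) (\<lambda>p. lact (case p of (r, s) \<Rightarrow> d r s))"
    and "summable_family (I \<times> I) (\<lambda>p. ract (case p of (r, s) \<Rightarrow> d r s))"
proof -
  have lin: "clinear (lact (d r s))" "clinear (ract (d r s))" if "r \<in> I" "s \<in> I" for r s
  proof -
    have "d r s \<in> M" using that d by (simp add: strict_matrix_def)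
    then show "clinear (lact (d r s))" "clinear (ract (d r s))"
      by (auto dest: multiplier_linear_pair simp: linear_pair_def)
  qed
  have dP: "lact (d r s) (lact (P s) x) = lact (d r s) x" "ract (d r s) (ract (P r) x) = ract (d r s) x"
    if "r \<in> I" "s \<in> I" for r s x
    using that d unfolding strict_matrix_def by (metis lact_times, metis ract_times)
  have "finite {p \<in> I \<times> I. lact (case p of (r, s) \<Rightarrow> d r s) x \<noteq> 0}" for x
  proof (rule finite_subset)
    show "{p \<in> I \<times> I. lact (case p of (r, s) \<Rightarrow> d r s) x \<noteq> 0}
      \<subseteq> (\<Union>s\<in>{s \<in> I. lact (P s) x \<noteq> 0}. (\<lambda>r. (r, s)) ` {r \<in> I. d r s \<noteq> 0})"
      using dP lin by (auto simp: image_iff, (metis clinear_0)+)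
    show "finite (\<Union>s\<in>{s \<in> I. lact (P s) x \<noteq> 0}. (\<lambda>r. (r, s)) ` {r \<in> I. d r s \<noteq> 0})"
      using d summable_familyD(2)[OF partition_of_oneD(3)[OF P]] by (auto simp: strict_matrix_def)
  qed
  moreover have "finite {p \<in> I \<times> I. ract (case p of (r, s) \<Rightarrow> d r s) x \<noteq> 0}" for x
  proof (rule finite_subset)
    show "{p \<in> I \<times> I. ract (case p of (r, s) \<Rightarrow> d r s) x \<noteq> 0}
      \<subseteq> (\<Union>r\<in>{r \<in> I. ract (P r) x \<noteq> 0}. (\<lambda>s. (r, s)) ` {s \<in> I. d r s \<noteq> 0})"
      using dP lin by (auto simp: image_iff, (metis clinear_0)+)
    show "finite (\<Union>r\<in>{r \<in> I. ract (P r) x \<noteq> 0}. (\<lambda>s. (r, s)) ` {s \<in> I. d r s \<noteq> 0})"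
      using d summable_familyD(2)[OF partition_of_oneD(4)[OF P]] by (auto simp: strict_matrix_def)
  qed
  ultimately show "summable_family (I \<times> I) (\<lambda>p. lact (case p of (r, s) \<Rightarrow> d r s))"
    "summable_family (I \<times> I) (\<lambda>p. ract (case p of (r, s) \<Rightarrow> d r s))"
    using lin by (auto simp: summable_family_def)
qed

lemma strict_matrix_sum_mem:
  assumes P: "partition_of_one mul I P" and d: "strict_matrix mul I P d"
  shows "strict_sum (I \<times> I) (\<lambda>(r, s). d r s) \<in> M"
  by (rule strict_sum_multiplier[OF bilinear _ strict_matrix_summable[OF assms]])
    (use d in \<open>auto simp: strict_matrix_def\<close>)

text \<open>The second partition \<open>Q\<close> may differ from the one that is used for convergence: \<open>\<Delta>\<^sub>r\<^sub>s(a)\<close> is at the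
  same time the block of \<open>\<Delta>(a)\<close> for \<open>1 \<otimes> \<lambda>\<close> and for \<open>\<rho> \<otimes> 1\<close>.\<close>

lemma strict_matrix_entry:
  assumes P: "partition_of_one mul I P" and d: "strict_matrix mul I P d"
    and Q: "partition_of_one mul I Q" and d': "strict_matrix mul I Q d"
    and r: "r \<in> I" and s: "s \<in> I"
  shows "Q r * strict_sum (I \<times> I) (\<lambda>(r, s). d r s) * Q s = d r s"
proof (rule multiplier_eqI)
  show "Q r * strict_sum (I \<times> I) (\<lambda>(r, s). d r s) * Q s \<in> M"
    by (intro multipliers_times partition_of_oneD(1)[OF Q] r s strict_matrix_sum_mem[OF P d])
  show "d r s \<in> M" using d r s by (simp add: strict_matrix_def)
  fix x
  have Qd: "Q r * d r' s' * Q s = (if r = r' \<and> s = s' then d r s else 0)"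
    if "r' \<in> I" "s' \<in> I" for r' s'
    using that r s d' by (simp add: strict_matrix_def zero_times_lr_pair partition_of_oneD(2)[OF Q])
  have Qd': "lact (Q r) (lact (d r' s') (lact (Q s) x)) = (if r = r' \<and> s = s' then lact (d r s) x else 0)"
    if "r' \<in> I" "s' \<in> I" for r' s'
    using Qd[OF that] by (metis lact_times lact_zero)
  have "lact (Q r * strict_sum (I \<times> I) (\<lambda>(r, s). d r s) * Q s) x
      = family_sum (I \<times> I) (\<lambda>p x. lact (Q r) (lact (case p of (r, s) \<Rightarrow> d r s) x)) (lact (Q s) x)"
    by (simp add: lact_strict_sum summable_family_after(2)[OF strict_matrix_summable(1)[OF P d]
        linear_pair_lact[OF partition_of_oneD(2)[OF Q r]]])
  also have "\<dots> = lact (d r s) x"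
    by (subst family_sum_eq[of "{(r, s)}"]) (use r s in \<open>auto simp: Qd' split: if_splits\<close>)
  finally show "lact (Q r * strict_sum (I \<times> I) (\<lambda>(r, s). d r s) * Q s) x = lact (d r s) x" .
qed

text \<open>Inserting \<open>\<Sum>\<^sub>t P\<^sub>t = 1\<close> between the two factors gives the usual product of matrices.\<close>

lemma strict_matrix_times:
  assumes P: "partition_of_one mul I P" and d: "strict_matrix mul I P d" and d': "strict_matrix mul I P d'"
    and r: "r \<in> I" and s: "s \<in> I"
    and T: "finite T" "T \<subseteq> I" "\<And>t. t \<in> I - T \<Longrightarrow> d r t * d' t s = 0"
  shows "P r * (strict_sum (I \<times> I) (\<lambda>(r, s). d r s) * strict_sum (I \<times> I) (\<lambda>(r, s). d' r s)) * P s
    = (\<Sum>t\<in>T. d r t * d' t s)"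
proof -
  let ?S = "strict_sum (I \<times> I) (\<lambda>(r, s). d r s)" and ?S' = "strict_sum (I \<times> I) (\<lambda>(r, s). d' r s)"
  have mem: "d r t * d' t s \<in> M" if "t \<in> I" for t
    using that d d' r s by (auto simp: strict_matrix_def intro: multipliers_times)
  have rhs: "(\<Sum>t\<in>T. d r t * d' t s) \<in> M"
    using T(1,2) by (induction T rule: finite_induct) (auto intro!: multipliers_plus mem bilinear multiplier_zero)
  have lhs: "P r * (?S * ?S') * P s \<in> M"
    by (intro multipliers_times partition_of_oneD(1)[OF P] r s strict_matrix_sum_mem[OF P] d d')
  show ?thesis
  proof (rule multiplier_eqI[OF lhs rhs])
    fix x
    define y where "y = lact (?S' * P s) x"
    have PS: "clinear (lact (P r * ?S))"
      by (rule linear_pair_lact[OF multiplier_linear_pair[OF multipliers_times[OF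
          partition_of_oneD(1)[OF P r] strict_matrix_sum_mem[OF P d]]]])
    have step: "lact (P r * ?S) (lact (P t) y) = lact (d r t * d' t s) x" if t: "t \<in> I" for t
    proof -
      have "P t * ?S' * P s = d' t s"
        by (rule strict_matrix_entry[OF P d' P d' t s])
      also have "\<dots> = P t * d' t s"
        using d' t s by (simp add: strict_matrix_def)
      finally have "lact (P t) y = lact (P t * d' t s) x"
        unfolding y_def by (metis lact_times)
      moreover have "P r * ?S * P t = d r t"
        by (rule strict_matrix_entry[OF P d P d r t])
      ultimately show ?thesis by (metis lact_times)
    qed
    have "lact (P r * (?S * ?S') * P s) x = lact (P r * ?S) y"
      by (simp add: y_def)
    also have "\<dots> = family_sum I (\<lambda>t y. lact (P r * ?S) (lact (P t) y)) y"
      by (rule lact_family_sum_partition[OF P PS])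
    also have "\<dots> = (\<Sum>t\<in>T. lact (d r t * d' t s) x)"
    proof (subst family_sum_eq[OF T(1,2)])
      show "lact (P r * ?S) (lact (P t) y) = 0" if "t \<in> I - T" for t
        using step[of t] T(3)[OF that] that by (metis DiffD1 lact_zero)
      show "(\<Sum>t\<in>T. lact (P r * ?S) (lact (P t) y)) = (\<Sum>t\<in>T. lact (d r t * d' t s) x)"
        by (rule sum.cong) (use step T in auto)
    qed
    finally show "lact (P r * (?S * ?S') * P s) x = lact (\<Sum>t\<in>T. d r t * d' t s) x"
      by (simp only: lact_sum)
  qed
qed

end


section \<open>Direct sums\<close>

lemma clinear_on_0: "clinear_on S f \<Longrightarrow> 0 \<in> S \<Longrightarrow> f 0 = 0"
  unfolding clinear_on_def by (metis complex_vector.scale_zero_left)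

context
  fixes J :: "'j set" and V :: "'j \<Rightarrow> 'a::complex_vector set"
  assumes ds: "is_direct_sum J V"
begin

lemma component_decomposition: "is_decomposition J V x (component J V x)"
  using ds unfolding is_direct_sum_def component_def by (metis theI')

lemma component_eqI: "is_decomposition J V x f \<Longrightarrow> component J V x = f"
  using ds component_decomposition unfolding is_direct_sum_def by blast

lemma direct_sum_subspace: "j \<in> J \<Longrightarrow> csubspace (V j)"
  using ds by (simp add: is_direct_sum_def)

lemma direct_sum_induct:
  assumes "P 0" "\<And>j x. j \<in> J \<Longrightarrow> x \<in> V j \<Longrightarrow> P x" "\<And>x y. P x \<Longrightarrow> P y \<Longrightarrow> P (x + y)"
  shows "P x"
proof -
  let ?f = "component J V x"
  have d: "\<forall>j\<in>J. ?f j \<in> V j" "\<forall>j. j \<notin> J \<longrightarrow> ?f j = 0" "finite {j. ?f j \<noteq> 0}"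
    and x: "x = (\<Sum>j | ?f j \<noteq> 0. ?f j)"
    using component_decomposition[of x] by (auto simp: is_decomposition_def)
  have "P (\<Sum>j\<in>T. ?f j)" if "finite T" "T \<subseteq> {j. ?f j \<noteq> 0}" for T
    using that
  proof (induction T rule: finite_induct)
    case (insert j T)
    then have "j \<in> J" using d(2) by auto
    then have "P (?f j)" using assms(2) d(1) by blast
    then show ?case using insert assms(3) by simp
  qed (simp add: assms(1))
  then show ?thesis using d(3) x by fastforce
qed

lemma direct_sum_lift_homogeneous:
  assumes "j \<in> J" "x \<in> V j" "clinear_on (V j) (g j)"
  shows "direct_sum_lift J V g x = g j x"
proof -
  have sub: "0 \<in> V i" if "i \<in> J" for i
    using direct_sum_subspace[OF that] by (rule complex_vector.subspace_0)
  (* the case x = 0, where the support is empty, is included *)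
  have f: "component J V x = (\<lambda>i. if i = j then x else 0)"
  proof (rule component_eqI)
    have "{i. (if i = j then x else 0) \<noteq> 0} = (if x = 0 then {} else {j})" by auto
    then show "is_decomposition J V x (\<lambda>i. if i = j then x else 0)"
      using assms sub by (auto simp: is_decomposition_def)
  qed
  have "{i. (if i = j then x else 0) \<noteq> 0} = (if x = 0 then {} else {j})" by auto
  then show ?thesis
    using clinear_on_0[OF assms(3) sub[OF assms(1)]] by (simp add: direct_sum_lift_def f)
qed

text \<open>The decompositions of \<open>x\<close>, \<open>y\<close>, \<open>x + y\<close> and \<open>c x\<close> are compared over one finite set of indices that
  contains the supports of those of \<open>x\<close> and \<open>y\<close>.\<close>

lemma clinear_direct_sum_lift:
  assumes g: "\<And>j. j \<in> J \<Longrightarrow> clinear_on (V j) (g j)"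
  shows "clinear (direct_sum_lift J V g)"
proof (rule clinearI)
  fix x y c
  let ?f = "component J V x" and ?h = "component J V y"
  have f: "\<And>j. j \<in> J \<Longrightarrow> ?f j \<in> V j" "\<And>j. j \<notin> J \<Longrightarrow> ?f j = 0" "finite {j. ?f j \<noteq> 0}"
    "x = (\<Sum>j | ?f j \<noteq> 0. ?f j)"
    using component_decomposition[of x] by (auto simp: is_decomposition_def)
  have h: "\<And>j. j \<in> J \<Longrightarrow> ?h j \<in> V j" "\<And>j. j \<notin> J \<Longrightarrow> ?h j = 0" "finite {j. ?h j \<noteq> 0}"
    "y = (\<Sum>j | ?h j \<noteq> 0. ?h j)"
    using component_decomposition[of y] by (auto simp: is_decomposition_def)
  let ?T = "{j. ?f j \<noteq> 0} \<union> {j. ?h j \<noteq> 0}"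
  have T: "finite ?T" "?T \<subseteq> J" using f h by auto
  have sup: "(\<Sum>j | u j \<noteq> 0. w j (u j)) = (\<Sum>j\<in>?T. w j (u j))"
    if "{j. u j \<noteq> 0} \<subseteq> ?T" "\<And>j. j \<in> J \<Longrightarrow> w j 0 = 0"
    for u :: "'j \<Rightarrow> 'a" and w :: "'j \<Rightarrow> 'a \<Rightarrow> 'z::complex_vector"
  proof (rule sum.mono_neutral_left[OF T(1) that(1)], rule ballI)
    fix i assume i: "i \<in> ?T - {j. u j \<noteq> 0}"
    then have "i \<in> J" using T(2) by blast
    then show "w i (u i) = 0" using i that(2) by simp
  qed
  have x: "x = (\<Sum>j\<in>?T. ?f j)" and y: "y = (\<Sum>j\<in>?T. ?h j)"
    by (subst f(4), rule sup[of _ "\<lambda>j x. x"]; auto) (subst h(4), rule sup[of _ "\<lambda>j x. x"]; auto)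
  have xy: "component J V (x + y) = (\<lambda>j. ?f j + ?h j)"
  proof (rule component_eqI, unfold is_decomposition_def, intro conjI ballI allI impI)
    show "finite {j. ?f j + ?h j \<noteq> 0}" by (rule finite_subset[OF _ T(1)]) auto
    have "(\<Sum>j | ?f j + ?h j \<noteq> 0. ?f j + ?h j) = (\<Sum>j\<in>?T. ?f j + ?h j)"
      by (rule sup[of "\<lambda>j. ?f j + ?h j" "\<lambda>j x. x"]) auto
    then show "x + y = (\<Sum>j | ?f j + ?h j \<noteq> 0. ?f j + ?h j)"
      using x y by (simp add: sum.distrib)
  qed (use f h in \<open>auto intro: complex_vector.subspace_add direct_sum_subspace\<close>)
  have cx: "component J V (c *\<^sub>C x) = (\<lambda>j. c *\<^sub>C ?f j)"
  proof (rule component_eqI, unfold is_decomposition_def, intro conjI ballI allI impI)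
    show "finite {j. c *\<^sub>C ?f j \<noteq> 0}" by (rule finite_subset[OF _ T(1)]) auto
    have "(\<Sum>j | c *\<^sub>C ?f j \<noteq> 0. c *\<^sub>C ?f j) = (\<Sum>j\<in>?T. c *\<^sub>C ?f j)"
      by (rule sup[of "\<lambda>j. c *\<^sub>C ?f j" "\<lambda>j x. x"]) auto
    then show "c *\<^sub>C x = (\<Sum>j | c *\<^sub>C ?f j \<noteq> 0. c *\<^sub>C ?f j)"
      using arg_cong[OF x, of "scaleC c"] by (simp only: complex_vector.scale_sum_right)
  qed (use f in \<open>auto intro: complex_vector.subspace_scale direct_sum_subspace\<close>)
  have g0: "g j 0 = 0" if "j \<in> J" for j
    by (rule clinear_on_0[OF g[OF that]]) (rule complex_vector.subspace_0[OF direct_sum_subspace[OF that]])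
  have L: "direct_sum_lift J V g (x + y) = (\<Sum>j\<in>?T. g j (?f j + ?h j))"
    "direct_sum_lift J V g (c *\<^sub>C x) = (\<Sum>j\<in>?T. g j (c *\<^sub>C ?f j))"
    "direct_sum_lift J V g x = (\<Sum>j\<in>?T. g j (?f j))"
    "direct_sum_lift J V g y = (\<Sum>j\<in>?T. g j (?h j))"
    unfolding direct_sum_lift_def xy cx by (rule sup[of _ g]; auto simp: g0)+
  show "direct_sum_lift J V g (x + y) = direct_sum_lift J V g x + direct_sum_lift J V g y"
    unfolding L sum.distrib[symmetric]
    by (rule sum.cong) (use g f h T in \<open>auto simp: clinear_on_def\<close>)
  show "direct_sum_lift J V g (c *\<^sub>C x) = c *\<^sub>C direct_sum_lift J V g x"
    unfolding L complex_vector.scale_sum_right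
    by (rule sum.cong) (use g f T in \<open>auto simp: clinear_on_def\<close>)
qed

end


section \<open>The total algebra\<close>

context partial_bialgebra
begin

text \<open>The axioms speak about homogeneous elements with indices in \<open>I\<close>; this predicate collects the five
  conditions.\<close>

definition homog :: "'i \<Rightarrow> 'i \<Rightarrow> 'i \<Rightarrow> 'i \<Rightarrow> 'a \<Rightarrow> bool" where
  "homog k l m n a \<longleftrightarrow> k \<in> I \<and> l \<in> I \<and> m \<in> I \<and> n \<in> I \<and> a \<in> A k l m n"

lemma homogD: "homog k l m n a \<Longrightarrow> k \<in> I" "homog k l m n a \<Longrightarrow> l \<in> I" "homog k l m n a \<Longrightarrow> m \<in> I"
  "homog k l m n a \<Longrightarrow> n \<in> I" "homog k l m n a \<Longrightarrow> a \<in> A k l m n"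
  by (simp_all add: homog_def)

abbreviation "mul \<equiv> total_mult X"

lemma total_induct [case_names zero homog add]:
  assumes "P 0" "\<And>k l m n a. homog k l m n a \<Longrightarrow> P a" "\<And>x y. P x \<Longrightarrow> P y \<Longrightarrow> P (x + y)"
  shows "P x"
  by (rule direct_sum_induct[OF direct_sum]) (use assms in \<open>auto simp: homog_def\<close>)

lemma clinear_total_lift:
  assumes "\<And>k l m n. \<lbrakk>k \<in> I; l \<in> I; m \<in> I; n \<in> I\<rbrakk> \<Longrightarrow> clinear_on (A k l m n) (g (k, l, m, n))"
  shows "clinear (total_lift X g)"
  unfolding total_lift_def I_def[symmetric] A_def[symmetric]
  by (rule clinear_direct_sum_lift[OF direct_sum]) (use assms in auto)

lemma total_lift_homog:
  assumes "homog k l m n a" "clinear_on (A k l m n) (g (k, l, m, n))"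
  shows "total_lift X g a = g (k, l, m, n) a"
  unfolding total_lift_def I_def[symmetric] A_def[symmetric]
  using direct_sum_lift_homogeneous[OF direct_sum, of "(k, l, m, n)" a g] assms
  by (simp add: homog_def)

lemma clinear_eq_on_homog:
  assumes "clinear f" "clinear g" "\<And>k l m n a. homog k l m n a \<Longrightarrow> f a = g a"
  shows "f x = g x"
proof (induction x rule: total_induct)
  case (homog k l m n a)
  then show ?case by (rule assms(3))
qed (simp_all add: assms(1,2) clinear_0 clinear_add)

lemma summable_family_totalI:
  assumes "\<And>j. j \<in> J \<Longrightarrow> clinear (u j)" "\<And>k l m n a. homog k l m n a \<Longrightarrow> finite {j \<in> J. u j a \<noteq> 0}"
  shows "summable_family J u"
proof -
  have "finite {j \<in> J. u j x \<noteq> 0}" for x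
  proof (induction x rule: total_induct)
    case zero
    have "{j \<in> J. u j 0 \<noteq> 0} = {}" using assms(1) by (auto simp: clinear_0)
    then show ?case by (simp only: finite.emptyI)
  qed (auto intro: assms finite_support_add)
  then show ?thesis using assms by (simp add: summable_family_def)
qed

text \<open>Often a homogeneous element meets exactly one member of a family, the one that \<open>h\<close> reads off from
  the indices.\<close>

lemma summable_family_homogI:
  assumes "\<And>j. j \<in> J \<Longrightarrow> clinear (u j)"
    and "\<And>k l m n a j. homog k l m n a \<Longrightarrow> j \<in> J \<Longrightarrow> j \<noteq> h k l m n \<Longrightarrow> u j a = 0"
  shows "summable_family J u"
proof (rule summable_family_totalI[OF assms(1)])
  fix k l m n a assume "homog k l m n a"
  then have "{j \<in> J. u j a \<noteq> 0} \<subseteq> {h k l m n}" using assms(2) by blast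
  then show "finite {j \<in> J. u j a \<noteq> 0}" by (rule finite_subset) simp
qed

lemma A_subspace: "\<lbrakk>k \<in> I; l \<in> I; m \<in> I; n \<in> I\<rbrakk> \<Longrightarrow> csubspace (A k l m n)"
  using direct_sum_subspace[OF direct_sum, of "(k, l, m, n)"] by simp

text \<open>The inner lifting in the definition of the total multiplication: the action on \<open>b\<close> of a homogeneous
  element \<open>a\<close> with right indices \<open>l\<close> and \<open>n\<close>.\<close>

definition right_mult :: "'i \<Rightarrow> 'i \<Rightarrow> 'a \<Rightarrow> 'a \<Rightarrow> 'a" where
  "right_mult l n a b = total_lift X (\<lambda>(l', p, n', q) b'. if l' = l \<and> n' = n then pmult X a b' else 0) b"

lemma right_mult_summand_linear:
  assumes "homog k l m n a" "k' \<in> I" "p \<in> I" "m' \<in> I" "q \<in> I"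
  shows "clinear_on (A k' p m' q) (\<lambda>b'. if k' = l \<and> m' = n then pmult X a b' else 0)"
  using assms mult_linear_right[of k l m n p q a]
  by (auto simp: homog_def clinear_on_def)

lemma clinear_right_mult:
  assumes "homog k l m n a"
  shows "clinear (right_mult l n a)"
proof -
  have "clinear (total_lift X (\<lambda>(l', p, n', q) b'. if l' = l \<and> n' = n then pmult X a b' else 0))"
    by (rule clinear_total_lift) (use right_mult_summand_linear[OF assms] in simp)
  then show ?thesis by (simp add: right_mult_def[abs_def])
qed

lemma right_mult_homog:
  assumes "homog k l m n a" "homog l' p n' q b"
  shows "right_mult l n a b = (if l' = l \<and> n' = n then pmult X a b else 0)"
  unfolding right_mult_def
  by (subst total_lift_homog[OF assms(2)])
    (use right_mult_summand_linear[OF assms(1)] assms in \<open>simp_all add: homog_def\<close>)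

lemma clinear_on_right_mult:
  assumes klmn: "k \<in> I" "l \<in> I" "m \<in> I" "n \<in> I"
  shows "clinear_on (A k l m n) (\<lambda>a. right_mult l n a b)"
proof -
  have hom: "homog k l m n a" if "a \<in> A k l m n" for a using that klmn by (simp add: homog_def)
  have "(\<forall>a\<in>A k l m n. \<forall>a'\<in>A k l m n. right_mult l n (a + a') b = right_mult l n a b + right_mult l n a' b)
     \<and> (\<forall>c. \<forall>a\<in>A k l m n. right_mult l n (c *\<^sub>C a) b = c *\<^sub>C right_mult l n a b)"
  proof (intro conjI ballI allI)
    fix a a' assume a: "a \<in> A k l m n" and a': "a' \<in> A k l m n"
    then have s: "homog k l m n (a + a')"
      by (intro hom complex_vector.subspace_add A_subspace klmn)
    show "right_mult l n (a + a') b = right_mult l n a b + right_mult l n a' b"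
    proof (rule clinear_eq_on_homog[of "right_mult l n (a + a')" "\<lambda>b. right_mult l n a b + right_mult l n a' b"])
      fix l' p n' q b assume b: "homog l' p n' q b"
      then show "right_mult l n (a + a') b = right_mult l n a b + right_mult l n a' b"
        using mult_linear_left[of k l m n p q b] a a' klmn
        by (auto simp: right_mult_homog[OF s b] right_mult_homog[OF hom b] clinear_on_def homog_def)
    qed (intro clinear_plus clinear_right_mult[OF s] clinear_right_mult[OF hom] a a')+
  next
    fix a c assume a: "a \<in> A k l m n"
    then have s: "homog k l m n (c *\<^sub>C a)"
      by (intro hom complex_vector.subspace_scale A_subspace klmn)
    show "right_mult l n (c *\<^sub>C a) b = c *\<^sub>C right_mult l n a b"
    proof (rule clinear_eq_on_homog[of "right_mult l n (c *\<^sub>C a)" "\<lambda>b. c *\<^sub>C right_mult l n a b"])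
      fix l' p n' q b assume b: "homog l' p n' q b"
      then show "right_mult l n (c *\<^sub>C a) b = c *\<^sub>C right_mult l n a b"
        using mult_linear_left[of k l m n p q b] a klmn
        by (auto simp: right_mult_homog[OF s b] right_mult_homog[OF hom b] clinear_on_def homog_def)
    qed (intro clinear_scaleC clinear_right_mult[OF s] clinear_right_mult[OF hom] a)+
  qed
  then show ?thesis by (simp add: clinear_on_def)
qed

lemma total_mult_eq: "mul a b = total_lift X (\<lambda>(k, l, m, n) a'. right_mult l n a' b) a"
  by (simp add: total_mult_def right_mult_def)

lemma total_mult_right_mult: "homog k l m n a \<Longrightarrow> mul a b = right_mult l n a b"
  unfolding total_mult_eq
  using total_lift_homog[of k l m n a "\<lambda>(k, l, m, n) a'. right_mult l n a' b"]
  by (simp add: clinear_on_right_mult homog_def)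

lemma total_mult_homog:
  assumes "homog k l m n a" "homog l' p n' q b"
  shows "mul a b = (if l' = l \<and> n' = n then pmult X a b else 0)"
  by (simp add: total_mult_right_mult[OF assms(1)] right_mult_homog[OF assms])

lemma cbilinear_total_mult: "cbilinear mul"
proof (rule cbilinearI)
  show "clinear (\<lambda>a. mul a b)" for b
    unfolding total_mult_eq by (rule clinear_total_lift) (simp add: clinear_on_right_mult)
  show "clinear (mul a)" for a
  proof (rule clinearI)
    fix x y c
    show "mul a (x + y) = mul a x + mul a y"
      by (rule clinear_eq_on_homog[of "\<lambda>a. mul a (x + y)" "\<lambda>a. mul a x + mul a y"])
        (auto intro!: clinear_plus \<open>\<And>b. clinear (\<lambda>a. mul a b)\<close>
          simp: total_mult_right_mult clinear_add[OF clinear_right_mult])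
    show "mul a (c *\<^sub>C x) = c *\<^sub>C mul a x"
      by (rule clinear_eq_on_homog[of "\<lambda>a. mul a (c *\<^sub>C x)" "\<lambda>a. c *\<^sub>C mul a x"])
        (auto intro!: clinear_scaleC \<open>\<And>b. clinear (\<lambda>a. mul a b)\<close>
          simp: total_mult_right_mult clinear_scale[OF clinear_right_mult])
  qed
qed

lemma mul_add: "mul (x + y) z = mul x z + mul y z" "mul z (x + y) = mul z x + mul z y"
  and mul_zero [simp]: "mul 0 z = 0" "mul z 0 = 0"
  using clinear_add[OF cbilinear_left[OF cbilinear_total_mult]]
    clinear_add[OF cbilinear_right[OF cbilinear_total_mult]]
    clinear_0[OF cbilinear_left[OF cbilinear_total_mult]]
    clinear_0[OF cbilinear_right[OF cbilinear_total_mult]] by simp_all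

lemma homog_pmult: "homog k l m n a \<Longrightarrow> homog l p n q b \<Longrightarrow> homog k p m q (pmult X a b)"
  by (auto simp: homog_def intro: mult_closed[of k l m n p q])

lemma homog_zero: "\<lbrakk>k \<in> I; l \<in> I; m \<in> I; n \<in> I\<rbrakk> \<Longrightarrow> homog k l m n 0"
  by (simp add: homog_def complex_vector.subspace_0 A_subspace)

lemma total_mult_assoc: "mul (mul x y) z = mul x (mul y z)"
proof (induction x rule: total_induct)
  case (homog k l m n a)
  note a = homog
  show ?case
  proof (induction y rule: total_induct)
    case (homog l' p n' q b)
    note b = homog
    show ?case
    proof (induction z rule: total_induct)
      case (homog p' u q' v c)
      note c = homog
      have "pmult X (pmult X a b) c = pmult X a (pmult X b c)"
        if "l' = l" "n' = n" "p' = p" "q' = q"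
        using a b c that by (intro mult_assoc[of k l m n p q u v]) (auto simp: homog_def)
      then show ?case
        using total_mult_homog[OF homog_pmult[of k l m n a p q b] c] total_mult_homog[OF a homog_pmult[of l' p n' q b u v c]] a b c
        by (auto simp: total_mult_homog[OF a b] total_mult_homog[OF b c])
    qed (simp_all add: mul_add)
  qed (simp_all add: mul_add)
qed (simp_all add: mul_add)

lemma homog_unit: "k \<in> I \<Longrightarrow> m \<in> I \<Longrightarrow> homog k k m m (punit X k m)"
  by (simp add: homog_def unit_closed)

lemma unit_mul_homog:
  assumes "k \<in> I" "m \<in> I" "homog k' l m' n a"
  shows "mul (punit X k m) a = (if k' = k \<and> m' = m then a else 0)"
  using assms unit_left[of k l m n a] by (auto simp: total_mult_homog[OF homog_unit] homog_def)

lemma mul_unit_homog: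
  assumes "l \<in> I" "n \<in> I" "homog k l' m n' a"
  shows "mul a (punit X l n) = (if l' = l \<and> n' = n then a else 0)"
  using assms unit_right[of k l m n a] by (auto simp: total_mult_homog[OF assms(3) homog_unit] homog_def)

text \<open>On a homogeneous element of \<open>A k l m n\<close> exactly \<open>1\<^sup>k\<^sub>m\<close> acts nontrivially from the left and \<open>1\<^sup>l\<^sub>n\<close>
  from the right.\<close>

sublocale tot: unit_family mul "I \<times> I" "\<lambda>(k, m). punit X k m"
proof
  show sl: "summable_family (I \<times> I) (\<lambda>p. mul (case p of (k, m) \<Rightarrow> punit X k m))"
    by (rule summable_family_homogI[where h = "\<lambda>k l m n. (k, m)"])
      (auto simp: unit_mul_homog cbilinear_right cbilinear_total_mult split: if_splits)
  show sr: "summable_family (I \<times> I) (\<lambda>p x. mul x (case p of (k, m) \<Rightarrow> punit X k m))"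
    by (rule summable_family_homogI[where h = "\<lambda>k l m n. (l, n)"])
      (auto simp: mul_unit_homog cbilinear_left cbilinear_total_mult split: if_splits)
  show "family_sum (I \<times> I) (\<lambda>p. mul (case p of (k, m) \<Rightarrow> punit X k m)) x = x" for x
  proof (rule clinear_eq_on_homog[OF clinear_family_sum[OF sl] clinear_id])
    fix k l m n a assume a: "homog k l m n a"
    show "family_sum (I \<times> I) (\<lambda>p. mul (case p of (k, m) \<Rightarrow> punit X k m)) a = a"
      by (subst family_sum_single[of "(k, m)"]) (use homogD[OF a] in \<open>auto simp: unit_mul_homog[OF _ _ a] split: if_splits\<close>)
  qed
  show "family_sum (I \<times> I) (\<lambda>p x. mul x (case p of (k, m) \<Rightarrow> punit X k m)) x = x" for x
  proof (rule clinear_eq_on_homog[OF clinear_family_sum[OF sr] clinear_id])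
    fix k l m n a assume a: "homog k l m n a"
    show "family_sum (I \<times> I) (\<lambda>p x. mul x (case p of (k, m) \<Rightarrow> punit X k m)) a = a"
      by (subst family_sum_single[of "(l, n)"]) (use homogD[OF a] in \<open>auto simp: mul_unit_homog[OF _ _ a] split: if_splits\<close>)
  qed
qed (simp_all add: cbilinear_total_mult total_mult_assoc)


section \<open>The multipliers \<open>\<lambda>\<close> and \<open>\<rho>\<close>\<close>

lemma multiplier_eq_homogI:
  assumes "m \<in> tot.M" "n \<in> tot.M" "\<And>k l m' n' a. homog k l m' n' a \<Longrightarrow> lact m a = lact n a"
  shows "m = n"
proof (rule tot.multiplier_eqI[OF assms(1,2)])
  show "lact m x = lact n x" for x
    by (rule clinear_eq_on_homog[of "lact m" "lact n"])
      (auto intro: assms linear_pair_lact multiplier_linear_pair)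
qed

text \<open>\<open>\<lambda>\<^sub>k\<close> is the projection onto upper left index \<open>k\<close> when acting from the left, and onto upper right
  index \<open>k\<close> when acting from the right; \<open>\<rho>\<^sub>m\<close> does the same for lower indices.\<close>

lemma lam_family:
  assumes k: "k \<in> I"
  shows "summable_family I (\<lambda>l. lact (tot.\<iota> (punit X k l)))" "summable_family I (\<lambda>l. ract (tot.\<iota> (punit X k l)))"
    and "homog k' l m n a \<Longrightarrow> lact (lam X k) a = (if k' = k then a else 0)"
    and "homog k' l m n a \<Longrightarrow> ract (lam X k) a = (if l = k then a else 0)"
proof -
  have lin: "clinear (lact (tot.\<iota> b))" "clinear (ract (tot.\<iota> b))" for b
    using multiplier_linear_pair[OF tot.to_multiplier_mem] by (auto simp: linear_pair_def)
  have unit: "mul (punit X k j) a = (if k' = k \<and> m = j then a else 0)"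
    "mul a (punit X k j) = (if l = k \<and> n = j then a else 0)"
    if "homog k' l m n a" "j \<in> I" for k' l m n a j
    using unit_mul_homog[OF k that(2,1)] mul_unit_homog[OF k that(2,1)] by simp_all
  show "summable_family I (\<lambda>l. lact (tot.\<iota> (punit X k l)))"
    by (rule summable_family_homogI[where h = "\<lambda>k l m n. m"]) (auto simp: lin unit)
  show "summable_family I (\<lambda>l. ract (tot.\<iota> (punit X k l)))"
    by (rule summable_family_homogI[where h = "\<lambda>k l m n. n"]) (auto simp: lin unit)
  assume a: "homog k' l m n a"
  show "lact (lam X k) a = (if k' = k then a else 0)"
    unfolding lam_def lact_strict_sum I_def[symmetric]
    by (subst family_sum_single[of m]) (use homogD[OF a] in \<open>auto simp: unit[OF a]\<close>)
  show "ract (lam X k) a = (if l = k then a else 0)"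
    unfolding lam_def ract_strict_sum I_def[symmetric]
    by (subst family_sum_single[of n]) (use homogD[OF a] in \<open>auto simp: unit[OF a]\<close>)
qed

lemma rho_family:
  assumes m': "m' \<in> I"
  shows "summable_family I (\<lambda>k. lact (tot.\<iota> (punit X k m')))" "summable_family I (\<lambda>k. ract (tot.\<iota> (punit X k m')))"
    and "homog k l m n a \<Longrightarrow> lact (rho X m') a = (if m = m' then a else 0)"
    and "homog k l m n a \<Longrightarrow> ract (rho X m') a = (if n = m' then a else 0)"
proof -
  have lin: "clinear (lact (tot.\<iota> b))" "clinear (ract (tot.\<iota> b))" for b
    using multiplier_linear_pair[OF tot.to_multiplier_mem] by (auto simp: linear_pair_def)
  have unit: "mul (punit X j m') a = (if k = j \<and> m = m' then a else 0)"
    "mul a (punit X j m') = (if l = j \<and> n = m' then a else 0)"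
    if "homog k l m n a" "j \<in> I" for k l m n a j
    using unit_mul_homog[OF that(2) m' that(1)] mul_unit_homog[OF that(2) m' that(1)] by simp_all
  show "summable_family I (\<lambda>k. lact (tot.\<iota> (punit X k m')))"
    by (rule summable_family_homogI[where h = "\<lambda>k l m n. k"]) (auto simp: lin unit)
  show "summable_family I (\<lambda>k. ract (tot.\<iota> (punit X k m')))"
    by (rule summable_family_homogI[where h = "\<lambda>k l m n. l"]) (auto simp: lin unit)
  assume a: "homog k l m n a"
  show "lact (rho X m') a = (if m = m' then a else 0)"
    unfolding rho_def lact_strict_sum I_def[symmetric]
    by (subst family_sum_single[of k]) (use homogD[OF a] in \<open>auto simp: unit[OF a]\<close>)
  show "ract (rho X m') a = (if n = m' then a else 0)"
    unfolding rho_def ract_strict_sum I_def[symmetric]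
    by (subst family_sum_single[of l]) (use homogD[OF a] in \<open>auto simp: unit[OF a]\<close>)
qed

lemma lam_mem: "k \<in> I \<Longrightarrow> lam X k \<in> tot.M"
  and rho_mem: "k \<in> I \<Longrightarrow> rho X k \<in> tot.M"
  unfolding lam_def rho_def I_def[symmetric]
  by (intro strict_sum_multiplier tot.to_multiplier_mem lam_family rho_family cbilinear_total_mult; assumption)+

lemma lam_linear_pair: "k \<in> I \<Longrightarrow> linear_pair (lam X k)"
  and rho_linear_pair: "k \<in> I \<Longrightarrow> linear_pair (rho X k)"
  by (rule multiplier_linear_pair[OF lam_mem] multiplier_linear_pair[OF rho_mem]; assumption)+

lemma homog_lam: "homog k' l m n a \<Longrightarrow> k \<in> I \<Longrightarrow> homog k' l m n (lact (lam X k) a)"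
  and homog_rho: "homog k' l m n a \<Longrightarrow> k \<in> I \<Longrightarrow> homog k' l m n (lact (rho X k) a)"
  by (auto simp: lam_family rho_family homogD intro!: homog_zero)

lemma lam_times_lam: "r \<in> I \<Longrightarrow> s \<in> I \<Longrightarrow> lam X r * lam X s = (if r = s then lam X r else 0)"
  and rho_times_rho: "r \<in> I \<Longrightarrow> s \<in> I \<Longrightarrow> rho X r * rho X s = (if r = s then rho X r else 0)"
  and lam_times_rho: "r \<in> I \<Longrightarrow> s \<in> I \<Longrightarrow> lam X r * rho X s = tot.\<iota> (punit X r s)"
  and rho_times_lam: "r \<in> I \<Longrightarrow> s \<in> I \<Longrightarrow> rho X s * lam X r = tot.\<iota> (punit X r s)"
  by (rule multiplier_eq_homogI;
      auto intro!: multipliers_times lam_mem rho_mem tot.to_multiplier_mem tot.multiplier_zero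
        simp: lam_family rho_family homog_lam homog_rho unit_mul_homog
          clinear_0[OF linear_pair_lact[OF lam_linear_pair]] clinear_0[OF linear_pair_lact[OF rho_linear_pair]])+

lemma partition_of_one_homogI:
  assumes mem: "\<And>r. r \<in> I \<Longrightarrow> P r \<in> tot.M"
    and h: "\<And>k l m n a. homog k l m n a \<Longrightarrow> h k l m n \<in> I"
    and left: "\<And>k l m n a r. homog k l m n a \<Longrightarrow> r \<in> I \<Longrightarrow> lact (P r) a = (if h k l m n = r then a else 0)"
    and right: "\<And>k l m n a r. homog k l m n a \<Longrightarrow> r \<in> I \<Longrightarrow> ract (P r) a = (if h' k l m n = r then a else 0)"
  shows "partition_of_one mul I P"
proof -
  have lin: "clinear (lact (P r))" "clinear (ract (P r))" if "r \<in> I" for r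
    using multiplier_linear_pair[OF mem[OF that]] by (auto simp: linear_pair_def)
  have sl: "summable_family I (\<lambda>r. lact (P r))"
    by (rule summable_family_homogI[where h = h]) (auto simp: lin left)
  have sr: "summable_family I (\<lambda>r. ract (P r))"
    by (rule summable_family_homogI[where h = h']) (auto simp: lin right)
  have "strict_sum I P = 1"
  proof (rule multiplier_eq_homogI)
    show "strict_sum I P \<in> tot.M"
      by (rule strict_sum_multiplier[OF cbilinear_total_mult mem sl sr])
    fix k l m n a assume a: "homog k l m n a"
    show "lact (strict_sum I P) a = lact 1 a"
      unfolding lact_strict_sum
      by (subst family_sum_single[of "h k l m n"]) (use h[OF a] in \<open>auto simp: left[OF a]\<close>)
  qed (rule multipliers_one)
  then show ?thesis
    using sl sr mem by (simp add: partition_of_one_def)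
qed

lemma lam_partition: "partition_of_one mul I (lam X)"
  by (rule partition_of_one_homogI[where h = "\<lambda>k l m n. k" and h' = "\<lambda>k l m n. l"])
    (auto simp: lam_mem lam_family dest: homogD)

lemma rho_partition: "partition_of_one mul I (rho X)"
  by (rule partition_of_one_homogI[where h = "\<lambda>k l m n. m" and h' = "\<lambda>k l m n. n"])
    (auto simp: rho_mem rho_family dest: homogD)

end


section \<open>The total comultiplication\<close>

context partial_bialgebra
begin

abbreviation "mul2 \<equiv> mult2 X"
abbreviation "un \<equiv> (\<lambda>(k, m). punit X k m)"
text \<open>The two partitions of \<open>1\<close> in \<open>M(A \<otimes> A)\<close> that cut \<open>\<Delta>(a)\<close> into the pieces \<open>\<Delta>\<^sub>r\<^sub>s(a)\<close>.\<close>

abbreviation L :: "'i \<Rightarrow> ('a, 'a) tensor lr_pair" where "L r \<equiv> 1 \<otimes>\<^sub>M lam X r"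
abbreviation R :: "'i \<Rightarrow> ('a, 'a) tensor lr_pair" where "R r \<equiv> rho X r \<otimes>\<^sub>M 1"

sublocale tot2: unit_family mul2 "(I \<times> I) \<times> (I \<times> I)" "\<lambda>(i, j). un i \<otimes> un j"
  by (rule unit_family_tensor) unfold_locales

lemma iota_tensor: "tot2.\<iota> (a \<otimes> b) = tot.\<iota> a \<otimes>\<^sub>M tot.\<iota> b"
  by (rule linear_pair_eq_on_pure)
    (auto simp: lact_tensor_pure ract_tensor_pure multiplier_linear_pair[OF tot.to_multiplier_mem]
      multiplier_linear_pair[OF tot2.to_multiplier_mem] tensor_mult_pure cbilinear_total_mult)

lemma L_partition: "partition_of_one mul2 I L"
  by (rule partition_of_one_tensor_right[OF cbilinear_total_mult cbilinear_total_mult lam_partition])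

lemma R_partition: "partition_of_one mul2 I R"
  by (rule partition_of_one_tensor_left[OF cbilinear_total_mult cbilinear_total_mult rho_partition])

lemmas L_mem = partition_of_oneD(1)[OF L_partition] and R_mem = partition_of_oneD(1)[OF R_partition]

lemma comult_at_linear: "r \<in> I \<Longrightarrow> s \<in> I \<Longrightarrow> clinear (comult_at X r s)"
  unfolding comult_at_def by (rule clinear_total_lift) (rule comult_linear)

lemma comult_at_homog: "r \<in> I \<Longrightarrow> s \<in> I \<Longrightarrow> homog k l m n a \<Longrightarrow> comult_at X r s a = pcomult X r s a"
  unfolding comult_at_def by (subst total_lift_homog) (auto simp: homog_def intro: comult_linear)

lemma comult_at_space:
  "r \<in> I \<Longrightarrow> s \<in> I \<Longrightarrow> homog k l m n a \<Longrightarrow> comult_at X r s a \<in> tensor_space (A k l r s) (A r s m n)"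
  by (simp add: comult_at_homog) (simp add: homog_def comult_closed)

text \<open>\<open>\<Delta>\<^sub>r\<^sub>s(a)\<close> lies in the span of pure tensors whose inner indices are \<open>r\<close> and \<open>s\<close>, so linear identities
  about it are checked on those.\<close>

lemma clinear_eq_on_comult_at:
  assumes "r \<in> I" "s \<in> I" "clinear f" "clinear g"
    and "\<And>k l m n v w. homog k l r s v \<Longrightarrow> homog r s m n w \<Longrightarrow> f (v \<otimes> w) = g (v \<otimes> w)"
  shows "f (comult_at X r s a) = g (comult_at X r s a)"
proof (rule clinear_eq_on_homog[of "\<lambda>a. f (comult_at X r s a)" "\<lambda>a. g (comult_at X r s a)"])
  fix k l m n a assume a: "homog k l m n a"
  show "f (comult_at X r s a) = g (comult_at X r s a)"
    by (rule clinear_eq_on_span[OF assms(3,4) _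
          comult_at_space[OF assms(1,2) a, unfolded tensor_space_def]])
      (use a assms(1,2,5) in \<open>auto simp: homog_def\<close>)
qed (intro clinear_compose[OF assms(3)] clinear_compose[OF assms(4)] comult_at_linear assms)+

text \<open>The indices \<open>r\<close> and \<open>s\<close> are lower indices of the first leg, seen by \<open>\<rho> \<otimes> 1\<close>, and upper indices of the
  second leg, seen by \<open>1 \<otimes> \<lambda>\<close>.\<close>

lemma comult_at_absorb:
  assumes "r \<in> I" "r' \<in> I" "s \<in> I" "s' \<in> I"
  shows "lact (L r) (comult_at X r' s a) = (if r = r' then comult_at X r' s a else 0)"
    and "ract (L s) (comult_at X r s' a) = (if s = s' then comult_at X r s' a else 0)"
    and "lact (R r) (comult_at X r' s a) = (if r = r' then comult_at X r' s a else 0)"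
    and "ract (R s) (comult_at X r s' a) = (if s = s' then comult_at X r s' a else 0)"
proof -
  have lin: "clinear (\<lambda>t. if b then t else (0::('a, 'a) tensor))" for b
    by (rule clinear_if[OF clinear_id clinear_zero])
  have lp: "clinear (lact (L r))" "clinear (ract (L s))" "clinear (lact (R r))" "clinear (ract (R s))"
    using partition_of_oneD(2)[OF L_partition] partition_of_oneD(2)[OF R_partition] assms
    by (auto simp: linear_pair_def)
  show "lact (L r) (comult_at X r' s a) = (if r = r' then comult_at X r' s a else 0)"
    by (rule clinear_eq_on_comult_at[OF _ _ lp(1) lin])
      (use assms in \<open>auto simp: lact_tensor_pure lam_linear_pair lam_family\<close>)
  show "ract (L s) (comult_at X r s' a) = (if s = s' then comult_at X r s' a else 0)"
    by (rule clinear_eq_on_comult_at[OF _ _ lp(2) lin])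
      (use assms in \<open>auto simp: ract_tensor_pure lam_linear_pair lam_family\<close>)
  show "lact (R r) (comult_at X r' s a) = (if r = r' then comult_at X r' s a else 0)"
    by (rule clinear_eq_on_comult_at[OF _ _ lp(3) lin])
      (use assms in \<open>auto simp: lact_tensor_pure rho_linear_pair rho_family\<close>)
  show "ract (R s) (comult_at X r s' a) = (if s = s' then comult_at X r s' a else 0)"
    by (rule clinear_eq_on_comult_at[OF _ _ lp(4) lin])
      (use assms in \<open>auto simp: ract_tensor_pure rho_linear_pair rho_family\<close>)
qed

definition blocks :: "'a \<Rightarrow> 'i \<Rightarrow> 'i \<Rightarrow> ('a, 'a) tensor lr_pair" where
  "blocks a r s = tot2.\<iota> (comult_at X r s a)"

lemma blocks_linear: "r \<in> I \<Longrightarrow> s \<in> I \<Longrightarrow> clinear (\<lambda>a. blocks a r s)"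
  unfolding blocks_def by (rule clinear_compose[OF tot2.clinear_to_multiplier comult_at_linear])

text \<open>The axioms give rcf for homogeneous elements, and supports add up under sums.\<close>

lemma blocks_finite:
  assumes "r \<in> I"
  shows "finite {s \<in> I. blocks a r s \<noteq> 0}" "finite {s \<in> I. blocks a s r \<noteq> 0}"
proof -
  have "finite {s \<in> I. blocks a r s \<noteq> 0} \<and> finite {s \<in> I. blocks a s r \<noteq> 0}"
  proof (induction a rule: total_induct)
    case zero
    have "{s \<in> I. blocks 0 r s \<noteq> 0} = {}" "{s \<in> I. blocks 0 s r \<noteq> 0} = {}"
      using assms by (auto simp: clinear_0[OF blocks_linear])
    then show ?case by (simp only: finite.emptyI simp_thms)
  next
    case (homog k l m n a)
    have "{s \<in> I. blocks a r s \<noteq> 0} \<subseteq> {s \<in> I. pcomult X r s a \<noteq> 0}"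
      "{s \<in> I. blocks a s r \<noteq> 0} \<subseteq> {s \<in> I. pcomult X s r a \<noteq> 0}"
      using assms homog by (auto simp: blocks_def comult_at_homog clinear_0[OF tot2.clinear_to_multiplier])
    then show ?case
      using comult_rcf_row[of k l m n a r] comult_rcf_column[of k l m n a r] homog assms
      by (auto simp: homog_def intro: finite_subset)
  next
    case (add x y)
    then show ?case
      using finite_support_add[of I "\<lambda>s a. blocks a r s" x y]
        finite_support_add[of I "\<lambda>s a. blocks a s r" x y] blocks_linear assms by auto
  qed
  then show "finite {s \<in> I. blocks a r s \<noteq> 0}" "finite {s \<in> I. blocks a s r \<noteq> 0}" by auto
qed

lemma blocks_strict_matrix: "strict_matrix mul2 I L (blocks a)" "strict_matrix mul2 I R (blocks a)"
  unfolding strict_matrix_def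
  by (auto simp: blocks_finite tot2.to_multiplier_mem,
      auto simp: blocks_def tot2.times_to_multiplier tot2.to_multiplier_times L_mem R_mem
        comult_at_absorb clinear_0[OF tot2.clinear_to_multiplier] tot2.to_multiplier_mem)

text \<open>The candidate for the total comultiplication.\<close>

definition comult_sum :: "'a \<Rightarrow> ('a, 'a) tensor lr_pair" where
  "comult_sum a = strict_sum (I \<times> I) (\<lambda>(r, s). blocks a r s)"

lemma comult_sum_mem: "comult_sum a \<in> tot2.M"
  unfolding comult_sum_def by (rule tot2.strict_matrix_sum_mem[OF L_partition blocks_strict_matrix(1)])

lemma comult_sum_entry:
  assumes "r \<in> I" "s \<in> I"
  shows "L r * comult_sum a * L s = blocks a r s" "R r * comult_sum a * R s = blocks a r s"
  unfolding comult_sum_def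
  by (rule tot2.strict_matrix_entry[OF L_partition blocks_strict_matrix(1) L_partition blocks_strict_matrix(1) assms]
      tot2.strict_matrix_entry[OF L_partition blocks_strict_matrix(1) R_partition blocks_strict_matrix(2) assms])+

lemma comult_sum_linear: "clinear comult_sum"
proof (rule clinearI)
  fix a b c
  note simps = times_plus_lr_pair plus_times_lr_pair times_scaleC_lr_pair scaleC_times_lr_pair
    partition_of_oneD(2)[OF L_partition] comult_sum_entry(1) clinear_add[OF blocks_linear]
    clinear_scale[OF blocks_linear]
  show "comult_sum (a + b) = comult_sum a + comult_sum b"
    by (rule tot2.partition_sandwich[OF L_partition])
      (simp_all add: comult_sum_mem multipliers_plus tot2.bilinear simps)
  show "comult_sum (c *\<^sub>C a) = c *\<^sub>C comult_sum a"
    by (rule tot2.partition_sandwich[OF L_partition])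
      (simp_all add: comult_sum_mem multipliers_scaleC tot2.bilinear simps)
qed

text \<open>Both sides have the blocks \<open>\<Sum>\<^sub>t \<Delta>\<^sub>r\<^sub>t(a) \<Delta>\<^sub>t\<^sub>s(b)\<close>: by the axiom if \<open>a\<close> and \<open>b\<close> are composable, and because
  everything vanishes otherwise, as then the first or the second legs are not composable either.\<close>

lemma comult_sum_mult_homog:
  assumes a: "homog k l m n a" and b: "homog l' p n' q b"
  shows "comult_sum (mul a b) = comult_sum a * comult_sum b"
proof (rule tot2.partition_sandwich[OF L_partition])
  fix r s assume r: "r \<in> I" and s: "s \<in> I"
  let ?T = "{t. t \<in> I \<and> mul2 (pcomult X r t a) (pcomult X t s b) \<noteq> 0}"
  have T: "finite ?T"
  proof (rule finite_subset)
    show "?T \<subseteq> {t \<in> I. pcomult X r t a \<noteq> 0}"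
      by (auto simp: clinear_0[OF cbilinear_left[OF tot2.bilinear]])
    show "finite {t \<in> I. pcomult X r t a \<noteq> 0}"
      using comult_rcf_row a r by (auto simp: homog_def)
  qed
  have prod: "blocks a r t * blocks b t s = tot2.\<iota> (mul2 (pcomult X r t a) (pcomult X t s b))" if "t \<in> I" for t
    using that r s by (simp add: blocks_def tot2.to_multiplier_mult comult_at_homog[OF _ _ a] comult_at_homog[OF _ _ b])
  have "L r * (comult_sum a * comult_sum b) * L s = (\<Sum>t\<in>?T. blocks a r t * blocks b t s)"
    unfolding comult_sum_def
    by (rule tot2.strict_matrix_times[OF L_partition blocks_strict_matrix(1) blocks_strict_matrix(1) r s T])
      (auto simp: prod clinear_0[OF tot2.clinear_to_multiplier])
  also have "\<dots> = tot2.\<iota> (\<Sum>t\<in>?T. mul2 (pcomult X r t a) (pcomult X t s b))"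
    unfolding clinear_sum[OF tot2.clinear_to_multiplier] by (rule sum.cong) (auto simp: prod)
  also have "(\<Sum>t\<in>?T. mul2 (pcomult X r t a) (pcomult X t s b)) = comult_at X r s (mul a b)"
  proof (cases "l' = l \<and> n' = n")
    case True
    then have "pcomult X r s (pmult X a b) = (\<Sum>t\<in>?T. mul2 (pcomult X r t a) (pcomult X t s b))"
      using a b r s by (intro comult_mult[of r s k l m n p q]) (auto simp: homog_def)
    moreover have "comult_at X r s (pmult X a b) = pcomult X r s (pmult X a b)"
      using True a b r s by (intro comult_at_homog[of _ _ k p m q] homog_pmult[of k l m n]) auto
    ultimately show ?thesis using True by (simp add: total_mult_homog[OF a b])
  next
    case False
    have "mul2 (pcomult X r t a) (pcomult X t s b) = 0" if t: "t \<in> I" for t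
    proof (rule tensor_space_mult_zero[OF cbilinear_total_mult cbilinear_total_mult])
      show "pcomult X r t a \<in> tensor_space (A k l r t) (A r t m n)"
        "pcomult X t s b \<in> tensor_space (A l' p t s) (A t s n' q)"
        using a b r s t by (auto simp: homog_def comult_closed)
      have "mul v v' = 0" if "homog k l r t v" "homog l' p t s v'" "l' \<noteq> l" for v v'
        using that by (simp add: total_mult_homog)
      moreover have "mul v v' = 0" if "homog r t m n v" "homog t s n' q v'" "n' \<noteq> n" for v v'
        using that by (simp add: total_mult_homog)
      ultimately show "(\<forall>v\<in>A k l r t. \<forall>v'\<in>A l' p t s. mul v v' = 0)
          \<or> (\<forall>w\<in>A r t m n. \<forall>w'\<in>A t s n' q. mul w w' = 0)"
        using False a b r s t by (auto simp: homog_def)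
    qed
    then show ?thesis
      using False comult_at_linear[OF r s] by (auto simp: total_mult_homog[OF a b] clinear_0)
  qed
  finally show "L r * comult_sum (mul a b) * L s = L r * (comult_sum a * comult_sum b) * L s"
    by (simp add: comult_sum_entry(1)[OF r s] blocks_def)
qed (intro multipliers_times comult_sum_mem)+

lemma comult_sum_mult: "comult_sum (mul a b) = comult_sum a * comult_sum b"
proof -
  note lp = multiplier_linear_pair[OF comult_sum_mem]
  note add = clinear_add[OF comult_sum_linear] clinear_0[OF comult_sum_linear]
  show ?thesis
  proof (induction a rule: total_induct)
    case (homog k l m n a)
    note a = homog
    show ?case
    proof (induction b rule: total_induct)
      case (homog l' p n' q b)
      show ?case by (rule comult_sum_mult_homog[OF a homog])
    qed (simp_all add: add mul_add times_plus_lr_pair times_zero_lr_pair lp)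
  qed (simp_all add: add mul_add plus_times_lr_pair zero_times_lr_pair lp)
qed

text \<open>A map with the defining properties has the same blocks, and blocks determine a multiplier.\<close>

lemma total_comult_eq: "total_comult X = comult_sum"
  unfolding total_comult_def I_def[symmetric] A_def[symmetric]
proof (rule the_equality)
  have hom: "homog k l m n a \<Longrightarrow> r \<in> I \<Longrightarrow> s \<in> I \<Longrightarrow> blocks a r s = tot2.\<iota> (pcomult X r s a)" for k l m n a r s
    by (simp add: blocks_def comult_at_homog)
  show "(\<forall>a. comult_sum a \<in> tot2.M) \<and> clinear comult_sum \<and>
     (\<forall>a b. comult_sum (mul a b) = comult_sum a * comult_sum b) \<and>
     (\<forall>r\<in>I. \<forall>s\<in>I. \<forall>k\<in>I. \<forall>l\<in>I. \<forall>m\<in>I. \<forall>n\<in>I. \<forall>a\<in>A k l m n.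
        tot2.\<iota> (pcomult X r s a) = L r * comult_sum a * L s \<and>
        tot2.\<iota> (pcomult X r s a) = R r * comult_sum a * R s)"
    using hom by (auto simp: comult_sum_mem comult_sum_linear comult_sum_mult comult_sum_entry homog_def)
  fix D
  assume D: "(\<forall>a. D a \<in> tot2.M) \<and> clinear D \<and>
     (\<forall>a b. D (mul a b) = D a * D b) \<and>
     (\<forall>r\<in>I. \<forall>s\<in>I. \<forall>k\<in>I. \<forall>l\<in>I. \<forall>m\<in>I. \<forall>n\<in>I. \<forall>a\<in>A k l m n.
        tot2.\<iota> (pcomult X r s a) = L r * D a * L s \<and>
        tot2.\<iota> (pcomult X r s a) = R r * D a * R s)"
  show "D = comult_sum"
  proof
    show "D a = comult_sum a" for a
    proof (rule clinear_eq_on_homog[of D comult_sum])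
      fix k l m n a assume a: "homog k l m n a"
      show "D a = comult_sum a"
      proof (rule tot2.partition_sandwich[OF L_partition])
        fix r s assume rs: "r \<in> I" "s \<in> I"
        then have "tot2.\<iota> (pcomult X r s a) = L r * D a * L s"
          using D a unfolding homog_def by blast
        then show "L r * D a * L s = L r * comult_sum a * L s"
          using hom[OF a rs] comult_sum_entry(1)[OF rs] by simp
      qed (use D in \<open>auto simp: comult_sum_mem\<close>)
    qed (use D in \<open>auto simp: comult_sum_linear\<close>)
  qed
qed

abbreviation "\<Delta> \<equiv> total_comult X"
abbreviation "E \<equiv> canonical_idempotent X"

lemma total_comult_mem: "\<Delta> a \<in> tot2.M"
  and total_comult_linear: "clinear \<Delta>"
  and total_comult_mult: "\<Delta> (mul a b) = \<Delta> a * \<Delta> b"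
  by (simp_all only: total_comult_eq comult_sum_mem comult_sum_linear comult_sum_mult)

lemma total_comult_entry:
  assumes "r \<in> I" "s \<in> I"
  shows "L r * \<Delta> a * L s = tot2.\<iota> (comult_at X r s a)" "R r * \<Delta> a * R s = tot2.\<iota> (comult_at X r s a)"
  unfolding total_comult_eq using comult_sum_entry[OF assms] by (simp_all add: blocks_def)

lemma E_summand_mem: "l \<in> I \<Longrightarrow> rho X l \<otimes>\<^sub>M lam X l \<in> tot2.M"
  by (simp add: multipliers_tensor cbilinear_total_mult lam_mem rho_mem)

lemma E_summands:
  assumes r: "r \<in> I" and l: "l \<in> I"
  shows "L r * (rho X l \<otimes>\<^sub>M lam X l) = (if r = l then rho X l \<otimes>\<^sub>M lam X l else 0)"
    "(rho X l \<otimes>\<^sub>M lam X l) * L r = (if r = l then rho X l \<otimes>\<^sub>M lam X l else 0)"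
    "R r * (rho X l \<otimes>\<^sub>M lam X l) = (if r = l then rho X l \<otimes>\<^sub>M lam X l else 0)"
    "(rho X l \<otimes>\<^sub>M lam X l) * R r = (if r = l then rho X l \<otimes>\<^sub>M lam X l else 0)"
  using assms
  by (auto simp: tensor_times_tensor lam_linear_pair rho_linear_pair lam_times_lam rho_times_rho
      tensor_zero_lr_pair zero_tensor_lr_pair)

lemma E_mem: "E \<in> tot2.M"
  unfolding canonical_idempotent_def I_def[symmetric]
  by (rule tot2.strict_sum_diagonal(1)[OF L_partition]) (simp_all add: E_summand_mem E_summands)

lemma E_block:
  assumes "r \<in> I"
  shows "L r * E = rho X r \<otimes>\<^sub>M lam X r" "E * L r = rho X r \<otimes>\<^sub>M lam X r"
    "R r * E = rho X r \<otimes>\<^sub>M lam X r" "E * R r = rho X r \<otimes>\<^sub>M lam X r"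
  unfolding canonical_idempotent_def I_def[symmetric]
  by (rule tot2.strict_sum_diagonal(2)[OF L_partition], simp_all add: E_summand_mem E_summands assms)
    (rule tot2.strict_sum_diagonal(3)[OF L_partition], simp_all add: E_summand_mem E_summands assms,
     rule tot2.strict_sum_diagonal(2)[OF R_partition], simp_all add: E_summand_mem E_summands assms,
     rule tot2.strict_sum_diagonal(3)[OF R_partition], simp_all add: E_summand_mem E_summands assms)

text \<open>The axiom \<open>\<Delta>\<^sub>r\<^sub>s(1\<^sup>k\<^sub>m) = \<delta>\<^sub>r\<^sub>s 1\<^sup>k\<^sub>r \<otimes> 1\<^sup>r\<^sub>m\<close> and \<open>\<lambda>\<^sub>k \<rho>\<^sub>r = 1\<^sup>k\<^sub>r\<close> show that both sides have the same blocks.\<close>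

lemma total_comult_unit:
  assumes k: "k \<in> I" and m: "m \<in> I"
  shows "\<Delta> (punit X k m) = (lam X k \<otimes>\<^sub>M rho X m) * E"
proof (rule tot2.partition_sandwich[OF L_partition total_comult_mem])
  have T: "lam X k \<otimes>\<^sub>M rho X m \<in> tot2.M"
    by (intro multipliers_tensor cbilinear_total_mult lam_mem rho_mem k m)
  then show "(lam X k \<otimes>\<^sub>M rho X m) * E \<in> tot2.M"
    by (intro multipliers_times E_mem)
  fix r s assume r: "r \<in> I" and s: "s \<in> I"
  note lp = lam_linear_pair rho_linear_pair k m r s
  have "L r * \<Delta> (punit X k m) * L s = tot2.\<iota> (if r = s then punit X k r \<otimes> punit X r m else 0)"
    using r s k m by (simp add: total_comult_entry comult_at_homog[OF _ _ homog_unit] comult_unit)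
  also have "\<dots> = (if r = s then (lam X k * rho X r) \<otimes>\<^sub>M (lam X r * rho X m) else 0)"
    using r s k m by (simp add: iota_tensor lam_times_rho clinear_0[OF tot2.clinear_to_multiplier])
  also have "\<dots> = L r * (lam X k \<otimes>\<^sub>M rho X m) * (rho X s \<otimes>\<^sub>M lam X s)"
    by (auto simp: tensor_times_tensor lp linear_pair_times mult.assoc rho_times_lam lam_times_rho[symmetric])
      (auto simp: mult.assoc[symmetric] lam_times_lam lp zero_times_lr_pair tensor_zero_lr_pair linear_pair_times)
  also have "\<dots> = L r * ((lam X k \<otimes>\<^sub>M rho X m) * E) * L s"
    using s by (simp add: E_block(2)[symmetric] mult.assoc)
  finally show "L r * \<Delta> (punit X k m) * L s = L r * ((lam X k \<otimes>\<^sub>M rho X m) * E) * L s" .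
qed

text \<open>By \<open>total_comult_unit\<close> the sum of \<open>\<Delta>(1\<^sup>k\<^sub>m)\<close> over \<open>k\<close> and \<open>m\<close> is
  \<open>(\<Sum>\<^sub>k \<lambda>\<^sub>k \<otimes> \<Sum>\<^sub>m \<rho>\<^sub>m) E = E\<close>.\<close>

sublocale co: nondegenerate_hom mul "I \<times> I" un mul2 "(I \<times> I) \<times> (I \<times> I)" "\<lambda>(i, j). un i \<otimes> un j" \<Delta> E
proof
  have l: "summable_family (I \<times> I) (\<lambda>p x. (case p of (k, m) \<Rightarrow> tensor_map (lact (lam X k)) (lact (rho X m))) (lact E x))"
    by (intro summable_family_before[OF summable_family_tensor_map(1)] partition_of_oneD(3)[OF lam_partition]
        partition_of_oneD(3)[OF rho_partition] linear_pair_lact multiplier_linear_pair[OF E_mem])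
  have r: "summable_family (I \<times> I) (\<lambda>p x. ract E ((case p of (k, m) \<Rightarrow> tensor_map (ract (lam X k)) (ract (rho X m))) x))"
    by (intro summable_family_after(1)[OF summable_family_tensor_map(1)] partition_of_oneD(4)[OF lam_partition]
        partition_of_oneD(4)[OF rho_partition] linear_pair_ract multiplier_linear_pair[OF E_mem])
  note rs = summable_family_tensor_map[OF partition_of_oneD(4)[OF lam_partition] partition_of_oneD(4)[OF rho_partition]]
  have ul: "lact (\<Delta> (un p)) = (\<lambda>x. (case p of (k, m) \<Rightarrow> tensor_map (lact (lam X k)) (lact (rho X m))) (lact E x))"
    and ur: "ract (\<Delta> (un p)) = (\<lambda>x. ract E ((case p of (k, m) \<Rightarrow> tensor_map (ract (lam X k)) (ract (rho X m))) x))"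
    if "p \<in> I \<times> I" for p
    using that by (auto simp: total_comult_unit lact_tensor ract_tensor)
  show "summable_family (I \<times> I) (\<lambda>p. lact (\<Delta> (un p)))"
    by (rule summable_family_cong[OF ul l])
  show "summable_family (I \<times> I) (\<lambda>p. ract (\<Delta> (un p)))"
    by (rule summable_family_cong[OF ur r])
  have id: "family_sum I (\<lambda>r. lact (lam X r)) = (\<lambda>x. x)" "family_sum I (\<lambda>r. lact (rho X r)) = (\<lambda>x. x)"
    "family_sum I (\<lambda>r. ract (lam X r)) = (\<lambda>x. x)" "family_sum I (\<lambda>r. ract (rho X r)) = (\<lambda>x. x)"
    using lam_partition rho_partition
    by (auto simp: partition_of_one_def simp flip: lact_strict_sum ract_strict_sum)
  show "E = strict_sum (I \<times> I) (\<lambda>p. \<Delta> (un p))"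
  proof (rule lr_pair_eqI)
    fix x
    have "lact (strict_sum (I \<times> I) (\<lambda>p. \<Delta> (un p))) x
      = family_sum (I \<times> I) (\<lambda>(k, m). tensor_map (lact (lam X k)) (lact (rho X m))) (lact E x)"
      unfolding lact_strict_sum by (rule family_sum_cong) (simp only: ul)
    also have "\<dots> = lact E x"
      by (simp add: summable_family_tensor_map(2) partition_of_oneD(3)[OF lam_partition]
          partition_of_oneD(3)[OF rho_partition] id tensor_map_id)
    finally show "lact E x = lact (strict_sum (I \<times> I) (\<lambda>p. \<Delta> (un p))) x" ..
    have "ract (strict_sum (I \<times> I) (\<lambda>p. \<Delta> (un p))) x
      = family_sum (I \<times> I) (\<lambda>p x. ract E ((case p of (k, m) \<Rightarrow> tensor_map (ract (lam X k)) (ract (rho X m))) x)) x"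
      unfolding ract_strict_sum by (rule family_sum_cong) (simp only: ur)
    also have "\<dots> = ract E x"
      by (subst summable_family_after(2)[OF rs(1) linear_pair_ract[OF multiplier_linear_pair[OF E_mem]]])
        (simp add: rs(2) id tensor_map_id)
    finally show "ract E x = ract (strict_sum (I \<times> I) (\<lambda>p. \<Delta> (un p))) x" ..
  qed
qed (simp_all only: total_comult_mem total_comult_linear total_comult_mult)

lemma comult_eq: "m \<in> tot.M \<Longrightarrow> comult X m = co.extension m"
  by (simp add: comult_def co.extend_hom)

end


section \<open>Coassociativity and the comultiplication of the unit\<close>

context partial_bialgebra
begin

abbreviation "mul3 \<equiv> mult3 X"

text \<open>Both follow blockwise from \<open>\<lambda>\<^sub>k \<rho>\<^sub>r = \<rho>\<^sub>r \<lambda>\<^sub>k\<close>.\<close>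

lemma E_commutes:
  assumes "k \<in> I"
  shows "(lam X k \<otimes>\<^sub>M 1) * E = E * (lam X k \<otimes>\<^sub>M 1)" "(1 \<otimes>\<^sub>M rho X k) * E = E * (1 \<otimes>\<^sub>M rho X k)"
proof -
  note lp = lam_linear_pair rho_linear_pair assms
  have l: "lam X k \<otimes>\<^sub>M 1 \<in> tot2.M" and r: "1 \<otimes>\<^sub>M rho X k \<in> tot2.M"
    by (intro multipliers_tensor cbilinear_total_mult lam_mem rho_mem multipliers_one assms)+
  show "(lam X k \<otimes>\<^sub>M 1) * E = E * (lam X k \<otimes>\<^sub>M 1)"
  proof (rule tot2.partition_cancel_left[OF L_partition])
    fix r assume r: "r \<in> I"
    have "L r * ((lam X k \<otimes>\<^sub>M 1) * E) = (lam X k \<otimes>\<^sub>M 1) * (L r * E)"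
      using r by (simp add: mult.assoc[symmetric] tensor_times_tensor lp)
    also have "\<dots> = (L r * E) * (lam X k \<otimes>\<^sub>M 1)"
      using r by (simp add: E_block tensor_times_tensor lp lam_times_rho rho_times_lam)
    finally show "L r * ((lam X k \<otimes>\<^sub>M 1) * E) = L r * (E * (lam X k \<otimes>\<^sub>M 1))"
      by (simp add: mult.assoc)
  qed (intro multipliers_times l E_mem)+
  show "(1 \<otimes>\<^sub>M rho X k) * E = E * (1 \<otimes>\<^sub>M rho X k)"
  proof (rule tot2.partition_cancel_left[OF R_partition])
    fix r' assume r': "r' \<in> I"
    have "R r' * ((1 \<otimes>\<^sub>M rho X k) * E) = (1 \<otimes>\<^sub>M rho X k) * (R r' * E)"
      using r' by (simp add: mult.assoc[symmetric] tensor_times_tensor lp)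
    also have "\<dots> = (R r' * E) * (1 \<otimes>\<^sub>M rho X k)"
      using r' by (simp add: E_block tensor_times_tensor lp lam_times_rho rho_times_lam)
    finally show "R r' * ((1 \<otimes>\<^sub>M rho X k) * E) = R r' * (E * (1 \<otimes>\<^sub>M rho X k))"
      by (simp add: mult.assoc)
  qed (intro multipliers_times r E_mem)+
qed

lemma comult_eqI:
  assumes m: "m \<in> tot.M" and T: "T \<in> tot2.M"
    and units: "\<And>k n. k \<in> I \<Longrightarrow> n \<in> I \<Longrightarrow> T * \<Delta> (punit X k n) = \<Delta> (lact m (punit X k n))"
  shows "comult X m = T * E"
  unfolding comult_eq[OF m]
  by (rule co.extension_eqI[OF m multipliers_times[OF T E_mem]])
    (auto simp: mult.assoc co.E_idem co.E_times units)

lemma comult_lam: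
  assumes k: "k \<in> I"
  shows "comult X (lam X k) = (lam X k \<otimes>\<^sub>M 1) * E"
proof (rule comult_eqI[OF lam_mem[OF k]])
  note lp = lam_linear_pair rho_linear_pair k
  show "lam X k \<otimes>\<^sub>M 1 \<in> tot2.M"
    by (intro multipliers_tensor cbilinear_total_mult lam_mem multipliers_one k)
  fix k' m assume k': "k' \<in> I" and m: "m \<in> I"
  have "(lam X k \<otimes>\<^sub>M 1) * \<Delta> (punit X k' m) = ((lam X k * lam X k') \<otimes>\<^sub>M rho X m) * E"
    using k' m by (simp add: total_comult_unit mult.assoc[symmetric] tensor_times_tensor lp)
  also have "\<dots> = \<Delta> (lact (lam X k) (punit X k' m))"
    using k' m k by (auto simp: lam_times_lam lam_family(3)[OF k homog_unit] total_comult_unit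
        zero_tensor_lr_pair zero_times_lr_pair lp multiplier_linear_pair[OF E_mem] clinear_0[OF total_comult_linear])
  finally show "(lam X k \<otimes>\<^sub>M 1) * \<Delta> (punit X k' m) = \<Delta> (lact (lam X k) (punit X k' m))" .
qed

lemma comult_rho:
  assumes m: "m \<in> I"
  shows "comult X (rho X m) = (1 \<otimes>\<^sub>M rho X m) * E"
proof (rule comult_eqI[OF rho_mem[OF m]])
  note lp = lam_linear_pair rho_linear_pair m
  show "1 \<otimes>\<^sub>M rho X m \<in> tot2.M"
    by (intro multipliers_tensor cbilinear_total_mult rho_mem multipliers_one m)
  fix k m' assume k: "k \<in> I" and m': "m' \<in> I"
  have "(1 \<otimes>\<^sub>M rho X m) * \<Delta> (punit X k m') = (lam X k \<otimes>\<^sub>M (rho X m * rho X m')) * E"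
    using k m' by (simp add: total_comult_unit mult.assoc[symmetric] tensor_times_tensor lp)
  also have "\<dots> = \<Delta> (lact (rho X m) (punit X k m'))"
    using k m' m by (auto simp: rho_times_rho rho_family(3)[OF m homog_unit] total_comult_unit
        tensor_zero_lr_pair zero_times_lr_pair lp multiplier_linear_pair[OF E_mem] clinear_0[OF total_comult_linear])
  finally show "(1 \<otimes>\<^sub>M rho X m) * \<Delta> (punit X k m') = \<Delta> (lact (rho X m) (punit X k m'))" .
qed

lemma comult_mem: "m \<in> tot.M \<Longrightarrow> comult X m \<in> tot2.M"
  by (simp add: comult_eq co.extension_mem)

lemma comult_one: "comult X 1 = E"
  by (simp add: comult_eq multipliers_one co.extension_one)

sublocale tot3: unit_family mul3 "((I \<times> I) \<times> (I \<times> I)) \<times> (I \<times> I)"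
  "\<lambda>(i, j). (\<lambda>(i, j). un i \<otimes> un j) i \<otimes> un j"
  by (rule unit_family_tensor) unfold_locales

text \<open>The maps \<open>\<Delta> \<otimes> id\<close> and \<open>id \<otimes> \<Delta>\<close> on \<open>A \<otimes> A\<close>.\<close>

abbreviation "comult_iota \<equiv> tensor_lift (\<lambda>a b. \<Delta> a \<otimes>\<^sub>M tot.\<iota> b)"
abbreviation "iota_comult \<equiv> tensor_lift (\<lambda>a b. multiplier_assoc (tot.\<iota> a \<otimes>\<^sub>M \<Delta> b))"

lemma co_hom: "nondegenerate_hom mul (I \<times> I) un mul2 ((I \<times> I) \<times> (I \<times> I)) (\<lambda>(i, j). un i \<otimes> un j) \<Delta> E"
  and id_hom: "nondegenerate_hom mul (I \<times> I) un mul (I \<times> I) un tot.\<iota> 1"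
  by (rule co.nondegenerate_hom_axioms, rule nondegenerate_hom_id[OF tot.unit_family_axioms])

sublocale cid: nondegenerate_hom mul2 "(I \<times> I) \<times> (I \<times> I)" "\<lambda>(i, j). un i \<otimes> un j"
  mul3 "((I \<times> I) \<times> (I \<times> I)) \<times> (I \<times> I)" "\<lambda>(i, j). (\<lambda>(i, j). un i \<otimes> un j) i \<otimes> un j"
  comult_iota "E \<otimes>\<^sub>M 1"
  by (rule nondegenerate_hom_tensor(1)[OF co_hom id_hom])

lemma idc_hom0: "nondegenerate_hom mul2 ((I \<times> I) \<times> (I \<times> I)) (\<lambda>(i, j). un i \<otimes> un j)
  (tensor_mult mul mul2) ((I \<times> I) \<times> ((I \<times> I) \<times> (I \<times> I))) (\<lambda>(i, j). un i \<otimes> (\<lambda>(i, j). un i \<otimes> un j) j)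
  (tensor_lift (\<lambda>a b. tot.\<iota> a \<otimes>\<^sub>M \<Delta> b)) (1 \<otimes>\<^sub>M E)"
  by (rule nondegenerate_hom_tensor(1)[OF id_hom co_hom])

lemma iota_comult_eq: "iota_comult = (\<lambda>t. multiplier_assoc (tensor_lift (\<lambda>a b. tot.\<iota> a \<otimes>\<^sub>M \<Delta> b) t))"
proof
  fix t
  have bl: "cbilinear (\<lambda>a b. tot.\<iota> a \<otimes>\<^sub>M \<Delta> b)"
    by (intro cbilinear_multiplier_tensor tot.clinear_to_multiplier total_comult_linear
        multiplier_linear_pair[OF tot.to_multiplier_mem] multiplier_linear_pair[OF total_comult_mem])
  note bl' = cbilinear_after[OF clinear_multiplier_assoc bl]
  show "iota_comult t = multiplier_assoc (tensor_lift (\<lambda>a b. tot.\<iota> a \<otimes>\<^sub>M \<Delta> b) t)"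
    by (rule clinear_eq_on_pure[of iota_comult "\<lambda>t. multiplier_assoc (tensor_lift (\<lambda>a b. tot.\<iota> a \<otimes>\<^sub>M \<Delta> b) t)"])
      (rule clinear_tensor_lift[OF bl'],
        rule clinear_compose[OF clinear_multiplier_assoc clinear_tensor_lift[OF bl]],
        simp only: tensor_lift_pure[OF bl] tensor_lift_pure[OF bl'])
qed

sublocale idc: nondegenerate_hom mul2 "(I \<times> I) \<times> (I \<times> I)" "\<lambda>(i, j). un i \<otimes> un j"
  mul3 "((I \<times> I) \<times> (I \<times> I)) \<times> (I \<times> I)" "\<lambda>(i, j). (\<lambda>(i, j). un i \<otimes> un j) i \<otimes> un j"
  iota_comult "multiplier_assoc (1 \<otimes>\<^sub>M E)"
  unfolding iota_comult_eq
  by (rule nondegenerate_hom_assoc[OF idc_hom0 cbilinear_total_mult cbilinear_total_mult cbilinear_total_mult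
        tot3.unit_family_axioms])

lemma comult_iota_pure: "comult_iota (a \<otimes> b) = \<Delta> a \<otimes>\<^sub>M tot.\<iota> b"
  by (rule nondegenerate_hom_tensor(2)[OF co_hom id_hom])

lemma iota_comult_pure: "iota_comult (a \<otimes> b) = multiplier_assoc (tot.\<iota> a \<otimes>\<^sub>M \<Delta> b)"
  unfolding iota_comult_eq using nondegenerate_hom_tensor(2)[OF id_hom co_hom] by simp

lemma comult_id_eq: "m \<in> tot2.M \<Longrightarrow> comult_id X m = cid.extension m"
  by (simp add: comult_id_def cid.extend_hom)

lemma id_comult_eq: "m \<in> tot2.M \<Longrightarrow> id_comult X m = idc.extension m"
  by (simp add: id_comult_def idc.extend_hom)

lemma comult_id_tensor:
  assumes "m \<in> tot.M" "n \<in> tot.M"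
  shows "comult_id X (m \<otimes>\<^sub>M n) = comult X m \<otimes>\<^sub>M n"
  unfolding comult_id_def comult_def extend_hom_tensor[OF co_hom id_hom assms]
    extend_hom_id[OF tot.unit_family_axioms assms(2)] ..

lemma id_comult_tensor:
  assumes "m \<in> tot.M" "n \<in> tot.M"
  shows "id_comult X (m \<otimes>\<^sub>M n) = multiplier_assoc (m \<otimes>\<^sub>M comult X n)"
proof -
  have "m \<otimes>\<^sub>M n \<in> tot2.M" by (intro multipliers_tensor cbilinear_total_mult assms)
  then show ?thesis
    unfolding id_comult_def comult_def iota_comult_eq
    by (simp add: extend_hom_assoc[OF idc_hom0 cbilinear_total_mult cbilinear_total_mult cbilinear_total_mult
        tot3.unit_family_axioms] extend_hom_tensor[OF id_hom co_hom assms]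
        extend_hom_id[OF tot.unit_family_axioms assms(1)])
qed

abbreviation L3 :: "'i \<Rightarrow> (('a, 'a) tensor, 'a) tensor lr_pair" where "L3 r \<equiv> 1 \<otimes>\<^sub>M lam X r"
abbreviation M3 :: "'i \<Rightarrow> (('a, 'a) tensor, 'a) tensor lr_pair" where "M3 r \<equiv> L r \<otimes>\<^sub>M 1"

lemma L3_partition: "partition_of_one mul3 I L3"
  and M3_partition: "partition_of_one mul3 I M3"
  and R3_partition: "partition_of_one mul3 I (\<lambda>r. R r \<otimes>\<^sub>M 1)"
  by (rule partition_of_one_tensor_right partition_of_one_tensor_left;
      rule tot2.bilinear cbilinear_total_mult lam_partition L_partition R_partition)+

lemma E_linear_pair: "linear_pair E"
  by (rule multiplier_linear_pair[OF E_mem])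

lemma assoc_one_E_mem: "multiplier_assoc (1 \<otimes>\<^sub>M E) \<in> tot3.M"
  by (rule idc.E_mem)

lemma L3_assoc: "r \<in> I \<Longrightarrow> L3 r = multiplier_assoc (1 \<otimes>\<^sub>M L r)"
  by (simp add: multiplier_assoc_pure lam_linear_pair)

lemma M3_assoc: "r \<in> I \<Longrightarrow> M3 r = multiplier_assoc (1 \<otimes>\<^sub>M (lam X r \<otimes>\<^sub>M 1))"
  by (simp add: multiplier_assoc_pure lam_linear_pair)

lemma L3_times_assoc_E:
  assumes "r \<in> I"
  shows "L3 r * multiplier_assoc (1 \<otimes>\<^sub>M E) = (1 \<otimes>\<^sub>M rho X r) \<otimes>\<^sub>M lam X r"
proof -
  note lp = lam_linear_pair[OF assms] rho_linear_pair[OF assms] E_linear_pair linear_pair_tensor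
  have "L3 r * multiplier_assoc (1 \<otimes>\<^sub>M E) = multiplier_assoc ((1 \<otimes>\<^sub>M L r) * (1 \<otimes>\<^sub>M E))"
    unfolding L3_assoc[OF assms] multiplier_assoc_times ..
  also have "(1 \<otimes>\<^sub>M L r) * (1 \<otimes>\<^sub>M E) = 1 \<otimes>\<^sub>M (rho X r \<otimes>\<^sub>M lam X r)"
    by (simp add: tensor_times_tensor lp E_block assms)
  finally show ?thesis
    by (simp add: multiplier_assoc_pure lp)
qed

text \<open>Cut with \<open>1 \<otimes> 1 \<otimes> \<lambda>\<^sub>r\<close>. As \<open>(\<Delta> \<otimes> id)(1 \<otimes> \<lambda>\<^sub>r) = E \<otimes> \<lambda>\<^sub>r\<close>, the left side becomes
  \<open>(\<Delta> \<otimes> id)(\<rho>\<^sub>r \<otimes> \<lambda>\<^sub>r) = E(1 \<otimes> \<rho>\<^sub>r) \<otimes> \<lambda>\<^sub>r\<close>, and this is also what the right side becomes by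
  \<open>(1 \<otimes> \<lambda>\<^sub>r)E = \<rho>\<^sub>r \<otimes> \<lambda>\<^sub>r\<close>.\<close>

lemma comult_id_E: "comult_id X E = (E \<otimes>\<^sub>M 1) * multiplier_assoc (1 \<otimes>\<^sub>M E)"
proof (rule tot3.partition_cancel_left[OF L3_partition])
  show "comult_id X E \<in> tot3.M"
    by (simp add: comult_id_eq E_mem cid.extension_mem)
  show "(E \<otimes>\<^sub>M 1) * multiplier_assoc (1 \<otimes>\<^sub>M E) \<in> tot3.M"
    by (intro multipliers_times assoc_one_E_mem multipliers_tensor tot2.bilinear cbilinear_total_mult
        E_mem multipliers_one)
  fix r assume r: "r \<in> I"
  note lp = lam_linear_pair[OF r] rho_linear_pair[OF r] E_linear_pair linear_pair_tensor linear_pair_times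
  have Lr: "L r \<in> tot2.M" by (rule L_mem[OF r])
  have "L3 r * comult_id X E = L3 r * (comult_id X 1 * comult_id X E)"
    by (simp add: comult_id_eq E_mem multipliers_one cid.extension_times[symmetric])
  also have "\<dots> = comult_id X (L r) * comult_id X E"
    by (simp add: comult_id_tensor multipliers_one lam_mem r comult_one comult_id_eq[OF multipliers_one]
        cid.extension_one mult.assoc[symmetric] tensor_times_tensor lp)
  also have "\<dots> = comult_id X (rho X r \<otimes>\<^sub>M lam X r)"
    by (simp add: comult_id_eq E_mem Lr cid.extension_times[symmetric] E_block(1)[OF r] E_summand_mem[OF r])
  also have "\<dots> = (E * (1 \<otimes>\<^sub>M rho X r)) \<otimes>\<^sub>M lam X r"
    by (simp add: comult_id_tensor rho_mem lam_mem r comult_rho E_commutes)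
  also have "\<dots> = (E \<otimes>\<^sub>M 1) * (L3 r * multiplier_assoc (1 \<otimes>\<^sub>M E))"
    by (simp add: L3_times_assoc_E[OF r] tensor_times_tensor lp)
  also have "\<dots> = L3 r * ((E \<otimes>\<^sub>M 1) * multiplier_assoc (1 \<otimes>\<^sub>M E))"
    by (simp add: mult.assoc[symmetric] tensor_times_tensor lp)
  finally show "L3 r * comult_id X E = L3 r * ((E \<otimes>\<^sub>M 1) * multiplier_assoc (1 \<otimes>\<^sub>M E))" .
qed

lemma E_legs_commute: "(E \<otimes>\<^sub>M 1) * multiplier_assoc (1 \<otimes>\<^sub>M E) = multiplier_assoc (1 \<otimes>\<^sub>M E) * (E \<otimes>\<^sub>M 1)"
proof (rule tot3.partition_cancel_left[OF L3_partition])
  have E1: "E \<otimes>\<^sub>M 1 \<in> tot3.M"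
    by (intro multipliers_tensor tot2.bilinear cbilinear_total_mult E_mem multipliers_one)
  then show "(E \<otimes>\<^sub>M 1) * multiplier_assoc (1 \<otimes>\<^sub>M E) \<in> tot3.M"
    "multiplier_assoc (1 \<otimes>\<^sub>M E) * (E \<otimes>\<^sub>M 1) \<in> tot3.M"
    by (intro multipliers_times assoc_one_E_mem; assumption)+
  fix r assume r: "r \<in> I"
  note lp = lam_linear_pair[OF r] rho_linear_pair[OF r] E_linear_pair linear_pair_tensor linear_pair_times
  have "L3 r * ((E \<otimes>\<^sub>M 1) * multiplier_assoc (1 \<otimes>\<^sub>M E)) = (E \<otimes>\<^sub>M 1) * (L3 r * multiplier_assoc (1 \<otimes>\<^sub>M E))"
    by (simp add: mult.assoc[symmetric] tensor_times_tensor lp)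
  also have "\<dots> = (L3 r * multiplier_assoc (1 \<otimes>\<^sub>M E)) * (E \<otimes>\<^sub>M 1)"
    by (simp add: L3_times_assoc_E[OF r] tensor_times_tensor lp E_commutes[OF r])
  finally show "L3 r * ((E \<otimes>\<^sub>M 1) * multiplier_assoc (1 \<otimes>\<^sub>M E))
      = L3 r * (multiplier_assoc (1 \<otimes>\<^sub>M E) * (E \<otimes>\<^sub>M 1))"
    by (simp add: mult.assoc)
qed

text \<open>The mirror image of \<open>comult_id_E\<close>: cut on the right with \<open>\<rho>\<^sub>r \<otimes> 1 \<otimes> 1\<close>, and use \<open>E(\<rho>\<^sub>r \<otimes> 1) = \<rho>\<^sub>r \<otimes> \<lambda>\<^sub>r\<close>
  and \<open>\<Delta>(\<lambda>\<^sub>r) = E(\<lambda>\<^sub>r \<otimes> 1)\<close>.\<close>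

lemma id_comult_E: "id_comult X E = multiplier_assoc (1 \<otimes>\<^sub>M E) * (E \<otimes>\<^sub>M 1)"
proof (rule tot3.partition_cancel_right[OF R3_partition])
  show "id_comult X E \<in> tot3.M"
    by (simp add: id_comult_eq E_mem idc.extension_mem)
  show "multiplier_assoc (1 \<otimes>\<^sub>M E) * (E \<otimes>\<^sub>M 1) \<in> tot3.M"
    by (intro multipliers_times assoc_one_E_mem multipliers_tensor tot2.bilinear cbilinear_total_mult
        E_mem multipliers_one)
  fix r assume r: "r \<in> I"
  note lp = lam_linear_pair[OF r] rho_linear_pair[OF r] E_linear_pair linear_pair_tensor linear_pair_times
  have R3: "R r \<otimes>\<^sub>M (1 :: 'a lr_pair) = multiplier_assoc (rho X r \<otimes>\<^sub>M (1 :: ('a, 'a) tensor lr_pair))"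
    using multiplier_assoc_pure[of "rho X r" "1 :: 'a lr_pair" "1 :: 'a lr_pair"] by (simp add: lp)
  have "id_comult X E * (R r \<otimes>\<^sub>M 1) = (id_comult X E * id_comult X 1) * (R r \<otimes>\<^sub>M 1)"
    by (simp add: id_comult_eq E_mem multipliers_one idc.extension_times[symmetric])
  also have "\<dots> = id_comult X E * id_comult X (R r)"
    by (simp add: id_comult_tensor multipliers_one rho_mem r comult_one id_comult_eq[OF multipliers_one]
        idc.extension_one R3 mult.assoc multiplier_assoc_times[symmetric] tensor_times_tensor lp)
  also have "\<dots> = id_comult X (rho X r \<otimes>\<^sub>M lam X r)"
    by (simp add: id_comult_eq E_mem R_mem[OF r] idc.extension_times[symmetric] E_block(4)[OF r] E_summand_mem[OF r])
  also have "\<dots> = multiplier_assoc (rho X r \<otimes>\<^sub>M (E * (lam X r \<otimes>\<^sub>M 1)))"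
    by (simp add: id_comult_tensor rho_mem lam_mem r comult_lam E_commutes)
  also have "\<dots> = multiplier_assoc (1 \<otimes>\<^sub>M E) * multiplier_assoc (rho X r \<otimes>\<^sub>M (lam X r \<otimes>\<^sub>M 1))"
    by (simp add: multiplier_assoc_times[symmetric] tensor_times_tensor lp)
  also have "\<dots> = multiplier_assoc (1 \<otimes>\<^sub>M E) * ((E * R r) \<otimes>\<^sub>M 1)"
    by (simp add: multiplier_assoc_pure E_block(4)[OF r] lp)
  also have "\<dots> = multiplier_assoc (1 \<otimes>\<^sub>M E) * (E \<otimes>\<^sub>M 1) * (R r \<otimes>\<^sub>M 1)"
    by (simp add: mult.assoc tensor_times_tensor lp)
  finally show "id_comult X E * (R r \<otimes>\<^sub>M 1) = multiplier_assoc (1 \<otimes>\<^sub>M E) * (E \<otimes>\<^sub>M 1) * (R r \<otimes>\<^sub>M 1)" .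
qed

text \<open>\<open>(\<Delta> \<otimes> id)(1 \<otimes> \<lambda>\<^sub>r)\<close> is \<open>1 \<otimes> 1 \<otimes> \<lambda>\<^sub>r\<close> up to the factor \<open>E \<otimes> 1 = (\<Delta> \<otimes> id)(1)\<close>, which every value of
  \<open>\<Delta> \<otimes> id\<close> absorbs. So \<open>\<Delta> \<otimes> id\<close> commutes with cutting the last leg, and \<open>id \<otimes> \<Delta>\<close> likewise with
  cutting the middle leg, by \<open>\<Delta>(\<lambda>\<^sub>p) = (\<lambda>\<^sub>p \<otimes> 1)E\<close>.\<close>

lemma comult_id_sandwich:
  assumes m: "m \<in> tot2.M" and r: "r \<in> I" and s: "s \<in> I"
  shows "L3 r * comult_id X m * L3 s = comult_id X (L r * m * L s)"
proof -
  have L: "comult_id X (L r) = L3 r * (E \<otimes>\<^sub>M 1)" "comult_id X (L r) = (E \<otimes>\<^sub>M 1) * L3 r" if "r \<in> I" for r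
    using that by (simp_all add: comult_id_tensor multipliers_one lam_mem comult_one tensor_times_tensor
        lam_linear_pair E_linear_pair)
  have "comult_id X (L r * m * L s) = comult_id X (L r) * comult_id X m * comult_id X (L s)"
    by (simp add: comult_id_eq multipliers_times L_mem m r s cid.extension_times)
  also have "\<dots> = L3 r * ((E \<otimes>\<^sub>M 1) * comult_id X m * (E \<otimes>\<^sub>M 1)) * L3 s"
    by (simp only: L(1)[OF r] L(2)[OF s] mult.assoc)
  also have "(E \<otimes>\<^sub>M 1) * comult_id X m * (E \<otimes>\<^sub>M 1) = comult_id X m"
    using cid.extension_times[OF multipliers_one m, symmetric]
    by (simp add: comult_id_eq m cid.extension_one mult.assoc cid.extension_times_E)
  finally show ?thesis ..
qed

lemma id_comult_sandwich:
  assumes m: "m \<in> tot2.M" and p: "p \<in> I" and q: "q \<in> I"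
  shows "M3 p * id_comult X m * M3 q = id_comult X (L p * m * L q)"
proof -
  let ?E = "multiplier_assoc (1 \<otimes>\<^sub>M E)"
  have L: "id_comult X (L p) = M3 p * ?E" "id_comult X (L p) = ?E * M3 p" if "p \<in> I" for p
  proof -
    have "id_comult X (L p) = multiplier_assoc (1 \<otimes>\<^sub>M ((lam X p \<otimes>\<^sub>M 1) * E))"
      using that by (simp add: id_comult_tensor multipliers_one lam_mem comult_lam)
    then show "id_comult X (L p) = M3 p * ?E" "id_comult X (L p) = ?E * M3 p"
      using that by (simp_all add: M3_assoc multiplier_assoc_times[symmetric] tensor_times_tensor
          lam_linear_pair E_linear_pair linear_pair_tensor E_commutes)
  qed
  have "id_comult X (L p * m * L q) = id_comult X (L p) * id_comult X m * id_comult X (L q)"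
    by (simp add: id_comult_eq multipliers_times L_mem m p q idc.extension_times)
  also have "\<dots> = M3 p * (?E * id_comult X m * ?E) * M3 q"
    by (simp only: L(1)[OF p] L(2)[OF q] mult.assoc)
  also have "?E * id_comult X m * ?E = id_comult X m"
    using idc.extension_times[OF multipliers_one m, symmetric]
    by (simp add: id_comult_eq m idc.extension_one mult.assoc idc.extension_times_E)
  finally show ?thesis ..
qed

lemma iota_tensor3: "tot3.\<iota> (t \<otimes> c) = tot2.\<iota> t \<otimes>\<^sub>M tot.\<iota> c"
  by (rule linear_pair_eq_on_pure)
    (auto simp: lact_tensor_pure ract_tensor_pure multiplier_linear_pair[OF tot.to_multiplier_mem]
      multiplier_linear_pair[OF tot2.to_multiplier_mem] multiplier_linear_pair[OF tot3.to_multiplier_mem]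
      tensor_mult_pure cbilinear_total_mult tot2.bilinear)

lemma multiplier_assoc_iota: "multiplier_assoc (tot.\<iota> a \<otimes>\<^sub>M tot2.\<iota> t) = tot3.\<iota> (tensor_assoc (a \<otimes> t))"
proof (induction t rule: tensor_induct)
  case (pure b c)
  then show ?case
    by (simp add: iota_tensor multiplier_assoc_pure multiplier_linear_pair[OF tot.to_multiplier_mem]
        tensor_assoc_pure iota_tensor3)
next
  case (add s t)
  then show ?case
    by (simp add: clinear_add[OF tot2.clinear_to_multiplier] pure_add_right clinear_add[OF clinear_tensor_assoc]
        clinear_add[OF tot3.clinear_to_multiplier] tensor_plus_lr_pair clinear_add[OF clinear_multiplier_assoc]
        multiplier_linear_pair[OF tot.to_multiplier_mem] multiplier_linear_pair[OF tot2.to_multiplier_mem])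
qed

text \<open>Cutting the middle leg replaces \<open>\<Delta>\<close> by \<open>\<Delta>\<^sub>p\<^sub>q\<close> in \<open>\<Delta> \<otimes> id\<close>; in the next lemma cutting the last leg
  replaces \<open>\<Delta>\<close> by \<open>\<Delta>\<^sub>r\<^sub>s\<close> in \<open>id \<otimes> \<Delta>\<close>.\<close>

lemma comult_iota_sandwich:
  assumes p: "p \<in> I" and q: "q \<in> I"
  shows "M3 p * comult_iota t * M3 q = tot3.\<iota> (tensor_map (comult_at X p q) (\<lambda>x. x) t)"
proof -
  have lin: "clinear (\<lambda>t. M3 p * comult_iota t * M3 q)"
    by (intro clinear_compose[OF clinear_times_left] clinear_compose[OF clinear_times_right]
        cid.f_linear partition_of_oneD(2)[OF M3_partition] p q)
  show ?thesis
  proof (rule clinear_eq_on_pure[OF lin])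
    show "clinear (\<lambda>t. tot3.\<iota> (tensor_map (comult_at X p q) (\<lambda>x. x) t))"
      by (intro clinear_compose[OF tot3.clinear_to_multiplier] clinear_tensor_map clinear_id comult_at_linear p q)
    show "M3 p * comult_iota (a \<otimes> b) * M3 q = tot3.\<iota> (tensor_map (comult_at X p q) (\<lambda>x. x) (a \<otimes> b))" for a b
      using total_comult_entry(1)[OF p q, of a]
      by (simp add: comult_iota_pure tensor_map_pure comult_at_linear p q clinear_id iota_tensor3
          tensor_times_tensor multiplier_linear_pair[OF total_comult_mem] linear_pair_tensor linear_pair_times
          lam_linear_pair multiplier_linear_pair[OF tot.to_multiplier_mem])
  qed
qed

lemma iota_comult_sandwich:
  assumes r: "r \<in> I" and s: "s \<in> I"
  shows "L3 r * iota_comult t * L3 s = tot3.\<iota> (tensor_assoc (tensor_map (\<lambda>x. x) (comult_at X r s) t))"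
proof -
  have lin: "clinear (\<lambda>t. L3 r * iota_comult t * L3 s)"
    by (intro clinear_compose[OF clinear_times_left] clinear_compose[OF clinear_times_right]
        idc.f_linear partition_of_oneD(2)[OF L3_partition] r s)
  show ?thesis
  proof (rule clinear_eq_on_pure[OF lin])
    show "clinear (\<lambda>t. tot3.\<iota> (tensor_assoc (tensor_map (\<lambda>x. x) (comult_at X r s) t)))"
      by (intro clinear_compose[OF tot3.clinear_to_multiplier] clinear_compose[OF clinear_tensor_assoc]
          clinear_tensor_map clinear_id comult_at_linear r s)
    show "L3 r * iota_comult (a \<otimes> b) * L3 s
        = tot3.\<iota> (tensor_assoc (tensor_map (\<lambda>x. x) (comult_at X r s) (a \<otimes> b)))" for a b
      using total_comult_entry(1)[OF r s, of b]
      by (simp add: iota_comult_pure L3_assoc r s multiplier_assoc_times[symmetric] tensor_map_pure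
          comult_at_linear clinear_id multiplier_assoc_iota[symmetric]
          tensor_times_tensor multiplier_linear_pair[OF total_comult_mem] linear_pair_tensor linear_pair_times
          lam_linear_pair multiplier_linear_pair[OF tot.to_multiplier_mem])
  qed
qed

lemma comult_at_coassoc:
  assumes "p \<in> I" "q \<in> I" "r \<in> I" "s \<in> I"
  shows "tensor_map (comult_at X p q) (\<lambda>x. x) (comult_at X r s a)
    = tensor_assoc (tensor_map (\<lambda>x. x) (comult_at X r s) (comult_at X p q a))"
proof (rule clinear_eq_on_homog[of "\<lambda>a. tensor_map (comult_at X p q) (\<lambda>x. x) (comult_at X r s a)"
      "\<lambda>a. tensor_assoc (tensor_map (\<lambda>x. x) (comult_at X r s) (comult_at X p q a))"])
  fix k l m n a assume a: "homog k l m n a"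
  then show "tensor_map (comult_at X p q) (\<lambda>x. x) (comult_at X r s a)
    = tensor_assoc (tensor_map (\<lambda>x. x) (comult_at X r s) (comult_at X p q a))"
    using coassoc[of p q r s k l m n a] assms
    by (simp add: comult_at_homog[OF _ _ a]) (simp add: homog_def)
qed (intro clinear_compose[OF clinear_tensor_assoc] clinear_compose[OF clinear_tensor_map]
    clinear_id comult_at_linear assms)+

text \<open>The blocks with respect to \<open>1 \<otimes> \<lambda>\<^sub>p \<otimes> \<lambda>\<^sub>r\<close> are \<open>(\<Delta>\<^sub>p\<^sub>q \<otimes> id)\<Delta>\<^sub>r\<^sub>s(a)\<close> on the left and \<open>(id \<otimes> \<Delta>\<^sub>r\<^sub>s)\<Delta>\<^sub>p\<^sub>q(a)\<close> on
  the right, provided the last leg is cut first on the left and the middle leg first on the right.\<close>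

lemma total_comult_coassoc: "comult_id X (\<Delta> a) = id_comult X (\<Delta> a)"
proof (rule tot3.partition_sandwich[OF M3_partition])
  have F: "comult_id X (\<Delta> a) \<in> tot3.M"
    by (simp add: comult_id_eq total_comult_mem cid.extension_mem)
  have G: "id_comult X (\<Delta> a) \<in> tot3.M"
    by (simp add: id_comult_eq total_comult_mem idc.extension_mem)
  show "comult_id X (\<Delta> a) \<in> tot3.M" "id_comult X (\<Delta> a) \<in> tot3.M" by fact+
  fix p q assume p: "p \<in> I" and q: "q \<in> I"
  show "M3 p * comult_id X (\<Delta> a) * M3 q = M3 p * id_comult X (\<Delta> a) * M3 q"
  proof (rule tot3.partition_sandwich[OF L3_partition])
    fix r s assume r: "r \<in> I" and s: "s \<in> I"
    have LM: "L3 r * M3 p = M3 p * L3 r" if "r \<in> I" "p \<in> I" for r p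
      using that by (simp add: tensor_times_tensor lam_linear_pair linear_pair_tensor)
    have "L3 r * (M3 p * comult_id X (\<Delta> a) * M3 q) * L3 s
        = (L3 r * M3 p) * comult_id X (\<Delta> a) * (M3 q * L3 s)"
      by (simp only: mult.assoc)
    also have "\<dots> = (M3 p * L3 r) * comult_id X (\<Delta> a) * (L3 s * M3 q)"
      unfolding LM[OF r p] LM[OF s q] ..
    also have "\<dots> = M3 p * (L3 r * comult_id X (\<Delta> a) * L3 s) * M3 q"
      by (simp only: mult.assoc)
    also have "L3 r * comult_id X (\<Delta> a) * L3 s = comult_iota (comult_at X r s a)"
      by (simp only: comult_id_sandwich[OF total_comult_mem r s] total_comult_entry(1)[OF r s]
          comult_id_eq[OF tot2.to_multiplier_mem] cid.extension_to_multiplier)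
    also have "M3 p * comult_iota (comult_at X r s a) * M3 q = L3 r * iota_comult (comult_at X p q a) * L3 s"
      by (simp only: comult_iota_sandwich p q iota_comult_sandwich r s comult_at_coassoc)
    also have "iota_comult (comult_at X p q a) = M3 p * id_comult X (\<Delta> a) * M3 q"
      by (simp only: id_comult_sandwich[OF total_comult_mem p q] total_comult_entry(1)[OF p q]
          id_comult_eq[OF tot2.to_multiplier_mem] idc.extension_to_multiplier)
    finally show "L3 r * (M3 p * comult_id X (\<Delta> a) * M3 q) * L3 s = L3 r * (M3 p * id_comult X (\<Delta> a) * M3 q) * L3 s" .
  qed (intro multipliers_times F G partition_of_oneD(1)[OF M3_partition] p q)+
qed

text \<open>Write \<open>\<Phi>\<close> and \<open>\<Psi>\<close> for the two composites. On \<open>A\<close> they agree, so \<open>\<Phi>(m)\<Phi>(a) = \<Phi>(ma) = \<Psi>(ma) = \<Psi>(m)\<Phi>(a)\<close>.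
  Since \<open>\<Phi>(m) = \<Phi>(m)\<Phi>(1)\<close>, \<open>\<Psi>(m) = \<Psi>(m)\<Psi>(1)\<close> and \<open>\<Phi>(1) = \<Psi>(1)\<close>, it suffices that the range of \<open>\<Phi>(1)\<close>
  is spanned by the ranges of the \<open>\<Phi>(a)\<close>.\<close>

lemma comult_coassoc:
  assumes m: "m \<in> tot.M"
  shows "comult_id X (comult X m) = id_comult X (comult X m)"
proof -
  let ?n = "comult_id X (comult X m)" and ?n' = "id_comult X (comult X m)"
  note cm = comult_mem[OF m]
  have mem: "?n \<in> tot3.M" "?n' \<in> tot3.M" "comult_id X E \<in> tot3.M"
    by (simp_all add: comult_id_eq id_comult_eq cm E_mem cid.extension_mem idc.extension_mem)
  have E: "comult_id X E = id_comult X E"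
    by (simp add: comult_id_E id_comult_E E_legs_commute)
  have on_A: "?n * comult_id X (\<Delta> a) = ?n' * comult_id X (\<Delta> a)" for a
  proof -
    have "comult X m * \<Delta> a = \<Delta> (lact m a)"
      by (simp add: comult_eq m co.extension_times_f)
    then have "?n * comult_id X (\<Delta> a) = comult_id X (\<Delta> (lact m a))" "?n' * id_comult X (\<Delta> a) = id_comult X (\<Delta> (lact m a))"
      by (simp_all add: comult_id_eq id_comult_eq cm total_comult_mem
          cid.extension_times[symmetric] idc.extension_times[symmetric])
    then show ?thesis by (simp add: total_comult_coassoc)
  qed
  have absorb: "?n * comult_id X E = ?n" "?n' * comult_id X E = ?n'"
    unfolding E[symmetric] by (simp add: comult_id_eq cm E_mem cid.extension_times[symmetric])
      (simp add: comult_eq m co.extension_times_E, simp add: E id_comult_eq cm E_mem idc.extension_times[symmetric],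
       simp add: comult_eq m co.extension_times_E)
  have "?n * comult_id X E * (E \<otimes>\<^sub>M 1) = ?n' * comult_id X E * (E \<otimes>\<^sub>M 1)"
  proof (rule cid.eq_on_units)
    fix j
    define t where "t = (case j of (i, j) \<Rightarrow> un i \<otimes> un j)"
    (* E t is a finite sum of vectors \<Delta>(b) t, on which both sides are known to agree *)
    have "?n * comult_iota (lact E t) = ?n' * comult_iota (lact E t)"
    proof (rule clinear_eq_on_span[OF _ _ _ co.E_in_span[of t]])
      show "clinear (\<lambda>s. ?n * comult_iota s)" "clinear (\<lambda>s. ?n' * comult_iota s)"
        by (intro clinear_compose[OF clinear_times_right cid.f_linear] multiplier_linear_pair[OF mem(1)]
            multiplier_linear_pair[OF mem(2)])+
      fix s assume "s \<in> {lact (\<Delta> b) t |b. True}"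
      then obtain b where s: "s = lact (\<Delta> b) t" by blast
      have "comult_iota s = comult_id X (\<Delta> b) * comult_iota t"
        by (simp add: s comult_id_eq total_comult_mem cid.extension_times_f)
      then show "?n * comult_iota s = ?n' * comult_iota s"
        using on_A[of b] by (simp add: mult.assoc[symmetric])
    qed
    then show "?n * comult_id X E * comult_iota (case j of (i, j) \<Rightarrow> un i \<otimes> un j)
      = ?n' * comult_id X E * comult_iota (case j of (i, j) \<Rightarrow> un i \<otimes> un j)"
      by (simp add: t_def[symmetric] mult.assoc comult_id_eq[OF E_mem] cid.extension_times_f E_mem)
  qed (intro multipliers_times mem)+
  moreover have "comult_id X E * (E \<otimes>\<^sub>M 1) = comult_id X E"
    by (simp add: comult_id_eq E_mem cid.extension_times_E)
  ultimately have "?n * comult_id X E = ?n' * comult_id X E" by (simp only: mult.assoc)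
  then show ?thesis by (simp only: absorb)
qed

end


section \<open>The counit\<close>

context partial_bialgebra
begin

abbreviation "\<epsilon> \<equiv> total_counit X"

lemma counit_summand_linear:
  "\<lbrakk>k \<in> I; l \<in> I; m \<in> I; n \<in> I\<rbrakk> \<Longrightarrow> clinear_on (A k l m n) (\<lambda>a. if (k, l) = (m, n) then pcounit X a else 0)"
  using counit_linear[of k l] by (auto simp: clinear_on_def)

lemma total_counit_linear: "clinear \<epsilon>"
  unfolding total_counit_def by (rule clinear_total_lift) (use counit_summand_linear in simp)

lemma total_counit_homog_zero: "homog k l m n a \<Longrightarrow> (k, l) \<noteq> (m, n) \<Longrightarrow> \<epsilon> a = 0"
  unfolding total_counit_def
  by (subst total_lift_homog) (use counit_summand_linear in \<open>auto simp: homog_def\<close>)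

lemma total_counit_mult:
  assumes "homog k l m n a" "homog l' p n' q b"
  shows "\<epsilon> (mul a b) = (if l' = l \<and> n' = n then \<epsilon> a * \<epsilon> b else 0)"
  using assms counit_mult[of k l m n p q a b]
  by (auto simp: total_mult_homog[OF assms] homog_def clinear_0[OF total_counit_linear])

lemma clinear_slice: "clinear (slice_left \<epsilon>)" "clinear (slice_right \<epsilon>)"
  by (intro clinear_slice_left clinear_slice_right total_counit_linear)+

text \<open>For \<open>(r, s) = (k, l)\<close> this is the counit axiom; otherwise \<open>\<epsilon>\<close> vanishes on the first legs, which have
  upper indices \<open>k l\<close> and lower indices \<open>r s\<close>. The second leg is treated in the same way.\<close>

lemma slice_comult_at:
  assumes a: "homog k l m n a" and r: "r \<in> I" and s: "s \<in> I"
  shows "slice_left \<epsilon> (comult_at X r s a) = (if r = k \<and> s = l then a else 0)"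
    and "slice_right \<epsilon> (comult_at X r s a) = (if r = m \<and> s = n then a else 0)"
proof -
  note space = comult_at_space[OF r s a, unfolded tensor_space_def]
  show "slice_left \<epsilon> (comult_at X r s a) = (if r = k \<and> s = l then a else 0)"
  proof (cases "r = k \<and> s = l")
    case True
    then show ?thesis
      using a counit_left[of k l m n a] comult_at_homog[OF r s a] by (auto simp: homog_def)
  next
    case False
    have "slice_left \<epsilon> (comult_at X r s a) = 0"
      by (rule clinear_eq_on_span[OF clinear_slice(1) clinear_zero _ space])
        (use False a r s total_counit_homog_zero[of k l r s] in
          \<open>auto simp: slice_left_pure[OF total_counit_linear] homog_def\<close>)
    then show ?thesis using False by auto
  qed
  show "slice_right \<epsilon> (comult_at X r s a) = (if r = m \<and> s = n then a else 0)"
  proof (cases "r = m \<and> s = n")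
    case True
    then show ?thesis
      using a counit_right[of k l m n a] comult_at_homog[OF r s a] by (auto simp: homog_def)
  next
    case False
    have "slice_right \<epsilon> (comult_at X r s a) = 0"
      by (rule clinear_eq_on_span[OF clinear_slice(2) clinear_zero _ space])
        (use False a r s total_counit_homog_zero[of r s m n] in
          \<open>auto simp: slice_right_pure[OF total_counit_linear] homog_def\<close>)
    then show ?thesis using False by auto
  qed
qed

lemma comult_at_finite:
  assumes "r \<in> I"
  shows "finite {s \<in> I. comult_at X r s a \<noteq> 0}" "finite {s \<in> I. comult_at X s r a \<noteq> 0}"
proof -
  have "comult_at X r s a = 0" if "blocks a r s = 0" for r s
    using that tot2.to_multiplier_inject[of "comult_at X r s a" 0]
    by (simp add: blocks_def clinear_0[OF tot2.clinear_to_multiplier])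
  then have "{s \<in> I. comult_at X r s a \<noteq> 0} \<subseteq> {s \<in> I. blocks a r s \<noteq> 0}"
    "{s \<in> I. comult_at X s r a \<noteq> 0} \<subseteq> {s \<in> I. blocks a s r \<noteq> 0}" by blast+
  then show "finite {s \<in> I. comult_at X r s a \<noteq> 0}" "finite {s \<in> I. comult_at X s r a \<noteq> 0}"
    using blocks_finite[OF assms] by (auto intro: finite_subset)
qed

text \<open>Finite sums by rcf, so that a column or a row of the matrix of \<open>\<Delta>(a)\<close> is an element of \<open>A \<otimes> A\<close>.\<close>

definition column :: "'i \<Rightarrow> 'a \<Rightarrow> ('a, 'a) tensor" where
  "column s a = (\<Sum>r | r \<in> I \<and> comult_at X r s a \<noteq> 0. comult_at X r s a)"

definition row :: "'i \<Rightarrow> 'a \<Rightarrow> ('a, 'a) tensor" where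
  "row r a = (\<Sum>s | s \<in> I \<and> comult_at X r s a \<noteq> 0. comult_at X r s a)"

lemma total_comult_column:
  assumes s: "s \<in> I"
  shows "\<Delta> a * L s = tot2.\<iota> (column s a)"
proof (rule tot2.partition_cancel_left[OF L_partition])
  show "\<Delta> a * L s \<in> tot2.M" by (intro multipliers_times total_comult_mem L_mem s)
  show "tot2.\<iota> (column s a) \<in> tot2.M" by (rule tot2.to_multiplier_mem)
  fix r assume r: "r \<in> I"
  have "lact (L r) (column s a) = (\<Sum>r' | r' \<in> I \<and> comult_at X r' s a \<noteq> 0. if r = r' then comult_at X r' s a else 0)"
    unfolding column_def clinear_sum[OF linear_pair_lact[OF partition_of_oneD(2)[OF L_partition r]]]
    by (rule sum.cong) (auto simp: comult_at_absorb(1)[OF r _ s s])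
  also have "\<dots> = comult_at X r s a"
    using comult_at_finite(2)[OF s] r by (simp add: sum.delta')
  finally show "L r * (\<Delta> a * L s) = L r * tot2.\<iota> (column s a)"
    using total_comult_entry(1)[OF r s] by (simp add: tot2.times_to_multiplier L_mem r mult.assoc[symmetric])
qed

lemma total_comult_row:
  assumes r: "r \<in> I"
  shows "L r * \<Delta> a = tot2.\<iota> (row r a)" "R r * \<Delta> a = tot2.\<iota> (row r a)"
proof -
  have sum: "(\<Sum>s' | s' \<in> I \<and> comult_at X r s' a \<noteq> 0. if s = s' then comult_at X r s' a else 0) = comult_at X r s a"
    if "s \<in> I" for s
    using comult_at_finite(1)[OF r] that by (simp add: sum.delta')
  show "L r * \<Delta> a = tot2.\<iota> (row r a)"
  proof (rule tot2.partition_cancel_right[OF L_partition])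
    show "L r * \<Delta> a \<in> tot2.M" by (intro multipliers_times total_comult_mem L_mem r)
    show "tot2.\<iota> (row r a) \<in> tot2.M" by (rule tot2.to_multiplier_mem)
    fix s assume s: "s \<in> I"
    have "ract (L s) (row r a) = (\<Sum>s' | s' \<in> I \<and> comult_at X r s' a \<noteq> 0. if s = s' then comult_at X r s' a else 0)"
      unfolding row_def clinear_sum[OF linear_pair_ract[OF partition_of_oneD(2)[OF L_partition s]]]
      by (rule sum.cong) (auto simp: comult_at_absorb(2,4)[OF r r s])
    then show "L r * \<Delta> a * L s = tot2.\<iota> (row r a) * L s"
      using total_comult_entry(1)[OF r s] by (simp add: tot2.to_multiplier_times L_mem s sum)
  qed
  show "R r * \<Delta> a = tot2.\<iota> (row r a)"
  proof (rule tot2.partition_cancel_right[OF R_partition])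
    show "R r * \<Delta> a \<in> tot2.M" by (intro multipliers_times total_comult_mem R_mem r)
    show "tot2.\<iota> (row r a) \<in> tot2.M" by (rule tot2.to_multiplier_mem)
    fix s assume s: "s \<in> I"
    have "ract (R s) (row r a) = (\<Sum>s' | s' \<in> I \<and> comult_at X r s' a \<noteq> 0. if s = s' then comult_at X r s' a else 0)"
      unfolding row_def clinear_sum[OF linear_pair_ract[OF partition_of_oneD(2)[OF R_partition s]]]
      by (rule sum.cong) (auto simp: comult_at_absorb(2,4)[OF r r s])
    then show "R r * \<Delta> a * R s = tot2.\<iota> (row r a) * R s"
      using total_comult_entry(2)[OF r s] by (simp add: tot2.to_multiplier_times R_mem s sum)
  qed
qed

text \<open>The range of summation depends on \<open>a\<close>, but \<open>\<Delta>(a)(1 \<otimes> \<lambda>\<^sub>s)\<close> is visibly linear in \<open>a\<close>, and \<open>A \<otimes> A\<close>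
  embeds into its multipliers.\<close>

lemma column_linear: "s \<in> I \<Longrightarrow> clinear (column s)"
  by (rule clinearI; rule tot2.to_multiplier_inject)
    (simp_all add: clinear_add[OF tot2.clinear_to_multiplier] clinear_scale[OF tot2.clinear_to_multiplier]
      total_comult_column[symmetric] clinear_add[OF total_comult_linear] clinear_scale[OF total_comult_linear]
      plus_times_lr_pair scaleC_times_lr_pair partition_of_oneD(2)[OF L_partition])

lemma row_linear: "r \<in> I \<Longrightarrow> clinear (row r)"
  by (rule clinearI; rule tot2.to_multiplier_inject)
    (simp_all add: clinear_add[OF tot2.clinear_to_multiplier] clinear_scale[OF tot2.clinear_to_multiplier]
      total_comult_row(1)[symmetric] clinear_add[OF total_comult_linear] clinear_scale[OF total_comult_linear]
      times_plus_lr_pair times_scaleC_lr_pair partition_of_oneD(2)[OF L_partition])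

text \<open>For homogeneous \<open>a\<close> only the entry at \<open>(k, l)\<close> survives, and it occurs in this column iff \<open>s = l\<close>.\<close>

lemma slice_left_column:
  assumes s: "s \<in> I"
  shows "slice_left \<epsilon> (column s a) = ract (lam X s) a"
proof (rule clinear_eq_on_homog[of "\<lambda>a. slice_left \<epsilon> (column s a)" "ract (lam X s)"])
  fix k l m n a assume a: "homog k l m n a"
  (* the sum may lack the index of the surviving entry, but only if a = 0 *)
  have nz: "a = 0" if "comult_at X k l a = 0"
    using that slice_comult_at(1)[OF a homogD(1,2)[OF a]] clinear_0[OF clinear_slice(1)] by metis
  have "slice_left \<epsilon> (column s a) = (\<Sum>r | r \<in> I \<and> comult_at X r s a \<noteq> 0. if k = r then (if l = s then a else 0) else 0)"
    unfolding column_def clinear_sum[OF clinear_slice(1)]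
    by (rule sum.cong) (auto simp: slice_comult_at[OF a _ s])
  also have "\<dots> = ract (lam X s) a"
    using comult_at_finite(2)[OF s, of a] homogD(1)[OF a] nz by (auto simp: sum.delta' lam_family(4)[OF s a])
  finally show "slice_left \<epsilon> (column s a) = ract (lam X s) a" .
qed (intro clinear_compose[OF clinear_slice(1) column_linear] linear_pair_ract lam_linear_pair s)+

lemma slice_left_row:
  assumes r: "r \<in> I"
  shows "slice_left \<epsilon> (row r a) = lact (lam X r) a"
proof (rule clinear_eq_on_homog[of "\<lambda>a. slice_left \<epsilon> (row r a)" "lact (lam X r)"])
  fix k l m n a assume a: "homog k l m n a"
  (* the sum may lack the index of the surviving entry, but only if a = 0 *)
  have nz: "a = 0" if "comult_at X k l a = 0"
    using that slice_comult_at(1)[OF a homogD(1,2)[OF a]] clinear_0[OF clinear_slice(1)] by metis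
  have "slice_left \<epsilon> (row r a) = (\<Sum>s | s \<in> I \<and> comult_at X r s a \<noteq> 0. if l = s then (if k = r then a else 0) else 0)"
    unfolding row_def clinear_sum[OF clinear_slice(1)]
    by (rule sum.cong) (auto simp: slice_comult_at[OF a r])
  also have "\<dots> = lact (lam X r) a"
    using comult_at_finite(1)[OF r, of a] homogD(2)[OF a] nz by (auto simp: sum.delta' lam_family(3)[OF r a])
  finally show "slice_left \<epsilon> (row r a) = lact (lam X r) a" .
qed (intro clinear_compose[OF clinear_slice(1) row_linear] linear_pair_lact lam_linear_pair r)+

lemma slice_right_row:
  assumes r: "r \<in> I"
  shows "slice_right \<epsilon> (row r a) = lact (rho X r) a"
proof (rule clinear_eq_on_homog[of "\<lambda>a. slice_right \<epsilon> (row r a)" "lact (rho X r)"])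
  fix k l m n a assume a: "homog k l m n a"
  (* the sum may lack the index of the surviving entry, but only if a = 0 *)
  have nz: "a = 0" if "comult_at X m n a = 0"
    using that slice_comult_at(2)[OF a homogD(3,4)[OF a]] clinear_0[OF clinear_slice(2)] by metis
  have "slice_right \<epsilon> (row r a) = (\<Sum>s | s \<in> I \<and> comult_at X r s a \<noteq> 0. if n = s then (if m = r then a else 0) else 0)"
    unfolding row_def clinear_sum[OF clinear_slice(2)]
    by (rule sum.cong) (auto simp: slice_comult_at[OF a r])
  also have "\<dots> = lact (rho X r) a"
    using comult_at_finite(1)[OF r, of a] homogD(4)[OF a] nz by (auto simp: sum.delta' rho_family(3)[OF r a])
  finally show "slice_right \<epsilon> (row r a) = lact (rho X r) a" .
qed (intro clinear_compose[OF clinear_slice(2) row_linear] linear_pair_lact rho_linear_pair r)+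

lemma iota_linear_pair: "linear_pair (tot.\<iota> b)"
  by (rule multiplier_linear_pair[OF tot.to_multiplier_mem])

lemma iota_leg_mem: "1 \<otimes>\<^sub>M tot.\<iota> b \<in> tot2.M" "tot.\<iota> b \<otimes>\<^sub>M 1 \<in> tot2.M"
  by (intro multipliers_tensor cbilinear_total_mult multipliers_one tot.to_multiplier_mem)+

lemma slice_left_times: "slice_left \<epsilon> (ract (1 \<otimes>\<^sub>M tot.\<iota> b) t) = mul (slice_left \<epsilon> t) b"
proof (rule clinear_eq_on_pure[of "\<lambda>t. slice_left \<epsilon> (ract (1 \<otimes>\<^sub>M tot.\<iota> b) t)" "\<lambda>t. mul (slice_left \<epsilon> t) b"])
  show "clinear (\<lambda>t. slice_left \<epsilon> (ract (1 \<otimes>\<^sub>M tot.\<iota> b) t))"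
    by (rule clinear_compose[OF clinear_slice(1) linear_pair_ract[OF multiplier_linear_pair[OF iota_leg_mem(1)]]])
  show "clinear (\<lambda>t. mul (slice_left \<epsilon> t) b)"
    by (rule clinear_compose[OF cbilinear_left[OF cbilinear_total_mult] clinear_slice(1)])
qed (simp add: ract_tensor_pure iota_linear_pair slice_left_pure[OF total_counit_linear]
    clinear_scale[OF cbilinear_left[OF cbilinear_total_mult]])

lemma slice_right_times: "slice_right \<epsilon> (lact (tot.\<iota> a \<otimes>\<^sub>M 1) t) = mul a (slice_right \<epsilon> t)"
proof (rule clinear_eq_on_pure[of "\<lambda>t. slice_right \<epsilon> (lact (tot.\<iota> a \<otimes>\<^sub>M 1) t)" "\<lambda>t. mul a (slice_right \<epsilon> t)"])
  show "clinear (\<lambda>t. slice_right \<epsilon> (lact (tot.\<iota> a \<otimes>\<^sub>M 1) t))"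
    by (rule clinear_compose[OF clinear_slice(2) linear_pair_lact[OF multiplier_linear_pair[OF iota_leg_mem(2)]]])
  show "clinear (\<lambda>t. mul a (slice_right \<epsilon> t))"
    by (rule clinear_compose[OF cbilinear_right[OF cbilinear_total_mult] clinear_slice(2)])
qed (simp add: lact_tensor_pure iota_linear_pair slice_right_pure[OF total_counit_linear]
    clinear_scale[OF cbilinear_right[OF cbilinear_total_mult]])

text \<open>For \<open>b\<close> homogeneous with upper left index \<open>s\<close> we have \<open>b = \<lambda>\<^sub>s b\<close>, hence
  \<open>\<Delta>(a)(1 \<otimes> b) = \<Delta>(a)(1 \<otimes> \<lambda>\<^sub>s)(1 \<otimes> b)\<close> is the column at \<open>s\<close> times \<open>1 \<otimes> b\<close>. Applying \<open>\<epsilon> \<otimes> id\<close> gives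
  \<open>(a \<lambda>\<^sub>s) b = a b\<close>. The other side, below, uses rows and \<open>a = a \<rho>\<^sub>r\<close>.\<close>

lemma comult_times_right:
  "\<exists>c. \<Delta> a * (1 \<otimes>\<^sub>M tot.\<iota> b) = tot2.\<iota> c \<and> slice_left \<epsilon> c = mul a b"
proof (induction b rule: total_induct)
  case zero
  have "\<Delta> a * (1 \<otimes>\<^sub>M tot.\<iota> 0) = tot2.\<iota> 0"
    by (simp add: clinear_0[OF tot.clinear_to_multiplier] clinear_0[OF tot2.clinear_to_multiplier]
        tensor_zero_lr_pair times_zero_lr_pair multiplier_linear_pair[OF total_comult_mem])
  then show ?case using clinear_0[OF clinear_slice(1)] by auto
next
  case (homog s p n' q b)
  note b = homog
  have s: "s \<in> I" by (rule homogD[OF b])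
  have "1 \<otimes>\<^sub>M tot.\<iota> b = L s * (1 \<otimes>\<^sub>M tot.\<iota> b)"
    by (simp add: tensor_times_tensor lam_linear_pair s iota_linear_pair tot.times_to_multiplier lam_mem
        lam_family(3)[OF s b])
  then have c: "\<Delta> a * (1 \<otimes>\<^sub>M tot.\<iota> b) = tot2.\<iota> (ract (1 \<otimes>\<^sub>M tot.\<iota> b) (column s a))"
    using total_comult_column[OF s, of a]
    by (metis mult.assoc tot2.to_multiplier_times[OF iota_leg_mem(1)])
  have "mul (slice_left \<epsilon> (column s a)) b = mul a b"
    by (simp add: slice_left_column[OF s] multiplier_balance[OF lam_mem[OF s]] lam_family(3)[OF s b])
  then show ?case using c slice_left_times by auto
next
  case (add x y)
  then obtain c d where "\<Delta> a * (1 \<otimes>\<^sub>M tot.\<iota> x) = tot2.\<iota> c" "slice_left \<epsilon> c = mul a x"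
    "\<Delta> a * (1 \<otimes>\<^sub>M tot.\<iota> y) = tot2.\<iota> d" "slice_left \<epsilon> d = mul a y" by blast
  then have "\<Delta> a * (1 \<otimes>\<^sub>M tot.\<iota> (x + y)) = tot2.\<iota> (c + d) \<and> slice_left \<epsilon> (c + d) = mul a (x + y)"
    by (simp add: clinear_add[OF tot.clinear_to_multiplier] clinear_add[OF tot2.clinear_to_multiplier]
        tensor_plus_lr_pair iota_linear_pair times_plus_lr_pair multiplier_linear_pair[OF total_comult_mem]
        clinear_add[OF clinear_slice(1)] mul_add)
  then show ?case by blast
qed

lemma comult_times_left:
  "\<exists>c. (tot.\<iota> a \<otimes>\<^sub>M 1) * \<Delta> b = tot2.\<iota> c \<and> slice_right \<epsilon> c = mul a b"
proof (induction a rule: total_induct)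
  case zero
  have "(tot.\<iota> 0 \<otimes>\<^sub>M 1) * \<Delta> b = tot2.\<iota> 0"
    by (simp add: clinear_0[OF tot.clinear_to_multiplier] clinear_0[OF tot2.clinear_to_multiplier]
        zero_tensor_lr_pair zero_times_lr_pair multiplier_linear_pair[OF total_comult_mem])
  then show ?case using clinear_0[OF clinear_slice(2)] by auto
next
  case (homog k l m r a)
  note a = homog
  have r: "r \<in> I" by (rule homogD[OF a])
  have "tot.\<iota> a \<otimes>\<^sub>M 1 = (tot.\<iota> a \<otimes>\<^sub>M 1) * R r"
    by (simp add: tensor_times_tensor rho_linear_pair r iota_linear_pair tot.to_multiplier_times rho_mem
        rho_family(4)[OF r a])
  then have c: "(tot.\<iota> a \<otimes>\<^sub>M 1) * \<Delta> b = tot2.\<iota> (lact (tot.\<iota> a \<otimes>\<^sub>M 1) (row r b))"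
    using total_comult_row(2)[OF r, of b]
    by (metis mult.assoc tot2.times_to_multiplier[OF iota_leg_mem(2)])
  have "mul a (slice_right \<epsilon> (row r b)) = mul a b"
    by (simp add: slice_right_row[OF r] multiplier_balance[OF rho_mem[OF r], symmetric] rho_family(4)[OF r a])
  then show ?case using c slice_right_times by auto
next
  case (add x y)
  then obtain c d where "(tot.\<iota> x \<otimes>\<^sub>M 1) * \<Delta> b = tot2.\<iota> c" "slice_right \<epsilon> c = mul x b"
    "(tot.\<iota> y \<otimes>\<^sub>M 1) * \<Delta> b = tot2.\<iota> d" "slice_right \<epsilon> d = mul y b" by blast
  then have "(tot.\<iota> (x + y) \<otimes>\<^sub>M 1) * \<Delta> b = tot2.\<iota> (c + d) \<and> slice_right \<epsilon> (c + d) = mul (x + y) b"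
    by (simp add: clinear_add[OF tot.clinear_to_multiplier] clinear_add[OF tot2.clinear_to_multiplier]
        plus_tensor_lr_pair iota_linear_pair plus_times_lr_pair multiplier_linear_pair[OF total_comult_mem]
        clinear_add[OF clinear_slice(2)] mul_add)
  then show ?case by blast
qed

text \<open>On the first legs \<open>v\<close> of \<open>\<Delta>\<^sub>r\<^sub>s(a)\<close> the counit satisfies \<open>\<epsilon>(v b) = \<epsilon>(v) \<epsilon>(b)\<close> if \<open>v\<close> and \<open>b\<close> are
  composable, and \<open>v b = 0\<close> otherwise.\<close>

lemma slice_left_mult_homog:
  assumes r: "r \<in> I" and s: "s \<in> I" and a: "homog k l m n a" and b: "homog k' l' m' n' b"
  shows "slice_left \<epsilon> (mul2 (comult_at X r s a) (b \<otimes> c))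
    = (if k' = l \<and> m' = s then \<epsilon> b *\<^sub>C mul (slice_left \<epsilon> (comult_at X r s a)) c else 0)"
proof -
  note bl = cbilinear_left[OF tot2.bilinear, of "b \<otimes> c"]
  have lin: "clinear (\<lambda>t. if k' = l \<and> m' = s then \<epsilon> b *\<^sub>C mul (slice_left \<epsilon> t) c else 0)"
    by (intro clinear_if clinear_scaleC clinear_zero
        clinear_compose[OF cbilinear_left[OF cbilinear_total_mult] clinear_slice(1)])
  show ?thesis
  proof (rule clinear_eq_on_span[OF clinear_compose[OF clinear_slice(1) bl] lin _
        comult_at_space[OF r s a, unfolded tensor_space_def]])
    fix t assume "t \<in> {v \<otimes> w |v w. v \<in> A k l r s \<and> w \<in> A r s m n}"
    then obtain v w where t: "t = v \<otimes> w" and v: "homog k l r s v"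
      using a r s by (auto simp: homog_def)
    show "slice_left \<epsilon> (mul2 t (b \<otimes> c)) = (if k' = l \<and> m' = s then \<epsilon> b *\<^sub>C mul (slice_left \<epsilon> t) c else 0)"
      by (simp add: t tensor_mult_pure cbilinear_total_mult slice_left_pure[OF total_counit_linear]
          total_counit_mult[OF v b] clinear_scale[OF cbilinear_left[OF cbilinear_total_mult]] scaleC_scaleC
          mult.commute)
  qed
qed

lemma slice_left_mult_homog':
  assumes r: "r \<in> I" and s: "s \<in> I" and c: "homog k l m n c" and a: "homog k' l' m' n' a"
  shows "slice_left \<epsilon> (mul2 (a \<otimes> b) (comult_at X s r c))
    = (if k = l' \<and> s = n' then \<epsilon> a *\<^sub>C mul b (slice_left \<epsilon> (comult_at X s r c)) else 0)"
proof -
  note bl = cbilinear_right[OF tot2.bilinear, of "a \<otimes> b"]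
  have lin: "clinear (\<lambda>t. if k = l' \<and> s = n' then \<epsilon> a *\<^sub>C mul b (slice_left \<epsilon> t) else 0)"
    by (intro clinear_if clinear_scaleC clinear_zero
        clinear_compose[OF cbilinear_right[OF cbilinear_total_mult] clinear_slice(1)])
  show ?thesis
  proof (rule clinear_eq_on_span[OF clinear_compose[OF clinear_slice(1) bl] lin _
        comult_at_space[OF s r c, unfolded tensor_space_def]])
    fix t assume "t \<in> {v \<otimes> w |v w. v \<in> A k l s r \<and> w \<in> A s r m n}"
    then obtain v w where t: "t = v \<otimes> w" and v: "homog k l s r v"
      using c r s by (auto simp: homog_def)
    show "slice_left \<epsilon> (mul2 (a \<otimes> b) t) = (if k = l' \<and> s = n' then \<epsilon> a *\<^sub>C mul b (slice_left \<epsilon> t) else 0)"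
      by (simp add: t tensor_mult_pure cbilinear_total_mult slice_left_pure[OF total_counit_linear]
          total_counit_mult[OF a v] clinear_scale[OF cbilinear_right[OF cbilinear_total_mult]] scaleC_scaleC)
  qed
qed

text \<open>With \<open>s\<close> the upper left index of \<open>c\<close>, both sides equal \<open>\<epsilon>(b) a c\<close> if \<open>m' = s\<close>, and \<open>0\<close> otherwise. On the
  left the conditions \<open>k' = l\<close> and \<open>s = l\<close> come in as well, but they hold whenever \<open>m' = s\<close> and
  \<open>\<epsilon>(b) a c \<noteq> 0\<close>.\<close>

lemma counit_weak_mult_left_homog:
  assumes a: "homog k l m n a" and b: "homog k' l' m' n' b" and c: "homog s p q' q c"
  shows "slice_left \<epsilon> (lact (\<Delta> a) (b \<otimes> c)) = slice_left \<epsilon> (lact ((1 \<otimes>\<^sub>M tot.\<iota> a) * E) (b \<otimes> c))"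
proof -
  have s: "s \<in> I" and m': "m' \<in> I" using homogD[OF c] homogD[OF b] by auto
  have bc: "lact (L s) (b \<otimes> c) = b \<otimes> c"
    by (simp add: lact_tensor_pure lam_linear_pair s lam_family(3)[OF s c])
  have "lact (\<Delta> a) (b \<otimes> c) = lact (\<Delta> a * L s) (b \<otimes> c)"
    by (simp add: bc)
  also have "\<dots> = mul2 (column s a) (b \<otimes> c)"
    by (simp add: total_comult_column[OF s])
  finally have "slice_left \<epsilon> (lact (\<Delta> a) (b \<otimes> c)) = slice_left \<epsilon> (mul2 (column s a) (b \<otimes> c))"
    by simp
  also have "\<dots> = (if k' = l \<and> m' = s then \<epsilon> b *\<^sub>C mul (slice_left \<epsilon> (column s a)) c else 0)"
    unfolding column_def clinear_sum[OF cbilinear_left[OF tot2.bilinear]] clinear_sum[OF clinear_slice(1)]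
      clinear_sum[OF cbilinear_left[OF cbilinear_total_mult]] complex_vector.scale_sum_right
    by (auto simp: slice_left_mult_homog[OF _ s a b] intro!: sum.neutral)
  also have "\<dots> = (if k' = l \<and> m' = s \<and> s = l then \<epsilon> b *\<^sub>C mul a c else 0)"
    unfolding slice_left_column[OF s] lam_family(4)[OF s a] by auto
  also have "\<dots> = (if m' = s then \<epsilon> b *\<^sub>C mul a c else 0)"
  proof -
    have "mul a c = 0" if "s \<noteq> l" using that by (simp add: total_mult_homog[OF a c])
    moreover have "\<epsilon> b = 0" if "k' \<noteq> m'" using that total_counit_homog_zero[OF b] by auto
    ultimately show ?thesis by auto
  qed
  finally have lhs: "slice_left \<epsilon> (lact (\<Delta> a) (b \<otimes> c)) = (if m' = s then \<epsilon> b *\<^sub>C mul a c else 0)" .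
  have "lact E (b \<otimes> c) = lact (E * L s) (b \<otimes> c)" by (simp add: bc)
  also have "\<dots> = (if m' = s then b \<otimes> c else 0)"
    by (auto simp: E_block(2)[OF s] lact_tensor_pure lam_linear_pair rho_linear_pair s lam_family(3)[OF s c]
        rho_family(3)[OF s b])
  finally have "lact ((1 \<otimes>\<^sub>M tot.\<iota> a) * E) (b \<otimes> c) = (if m' = s then b \<otimes> mul a c else 0)"
    by (simp add: lact_tensor_pure iota_linear_pair
        clinear_0[OF linear_pair_lact[OF multiplier_linear_pair[OF iota_leg_mem(1)]]])
  then show ?thesis
    by (simp add: lhs slice_left_pure[OF total_counit_linear] clinear_0[OF clinear_slice(1)])
qed

lemma counit_weak_mult_right_homog:
  assumes c: "homog k l m n c" and a: "homog k' l' m' n' a" and b: "homog p s q' q b"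
  shows "slice_left \<epsilon> (ract (\<Delta> c) (a \<otimes> b)) = slice_left \<epsilon> (ract (E * (1 \<otimes>\<^sub>M tot.\<iota> c)) (a \<otimes> b))"
proof -
  have s: "s \<in> I" using homogD[OF b] by auto
  have ab: "ract (L s) (a \<otimes> b) = a \<otimes> b"
    by (simp add: ract_tensor_pure lam_linear_pair s lam_family(4)[OF s b])
  have "ract (\<Delta> c) (a \<otimes> b) = ract (L s * \<Delta> c) (a \<otimes> b)"
    by (simp add: ab)
  also have "\<dots> = mul2 (a \<otimes> b) (row s c)"
    by (simp add: total_comult_row(1)[OF s])
  finally have "slice_left \<epsilon> (ract (\<Delta> c) (a \<otimes> b)) = slice_left \<epsilon> (mul2 (a \<otimes> b) (row s c))"
    by simp
  also have "\<dots> = (if k = l' \<and> s = n' then \<epsilon> a *\<^sub>C mul b (slice_left \<epsilon> (row s c)) else 0)"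
    unfolding row_def clinear_sum[OF cbilinear_right[OF tot2.bilinear]] clinear_sum[OF clinear_slice(1)]
      clinear_sum[OF cbilinear_right[OF cbilinear_total_mult]] complex_vector.scale_sum_right
    by (auto simp: slice_left_mult_homog'[OF _ s c a] intro!: sum.neutral)
  also have "\<dots> = (if k = l' \<and> s = n' \<and> s = k then \<epsilon> a *\<^sub>C mul b c else 0)"
    unfolding slice_left_row[OF s] lam_family(3)[OF s c] by auto
  also have "\<dots> = (if n' = s then \<epsilon> a *\<^sub>C mul b c else 0)"
  proof -
    have "mul b c = 0" if "s \<noteq> k" using that by (simp add: total_mult_homog[OF b c])
    moreover have "\<epsilon> a = 0" if "l' \<noteq> n'" using that total_counit_homog_zero[OF a] by auto
    ultimately show ?thesis by auto
  qed
  finally have lhs: "slice_left \<epsilon> (ract (\<Delta> c) (a \<otimes> b)) = (if n' = s then \<epsilon> a *\<^sub>C mul b c else 0)" .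
  have "ract E (a \<otimes> b) = ract (L s * E) (a \<otimes> b)" by (simp add: ab)
  also have "\<dots> = (if n' = s then a \<otimes> b else 0)"
    by (auto simp: E_block(1)[OF s] ract_tensor_pure lam_linear_pair rho_linear_pair s lam_family(4)[OF s b]
        rho_family(4)[OF s a])
  finally have "ract (E * (1 \<otimes>\<^sub>M tot.\<iota> c)) (a \<otimes> b) = (if n' = s then a \<otimes> mul b c else 0)"
    by (simp add: ract_tensor_pure iota_linear_pair
        clinear_0[OF linear_pair_ract[OF multiplier_linear_pair[OF iota_leg_mem(1)]]])
  then show ?thesis
    by (simp add: lhs slice_left_pure[OF total_counit_linear] clinear_0[OF clinear_slice(1)])
qed

lemma counit_weak_mult_left:
  "slice_left \<epsilon> (lact (\<Delta> a) (b \<otimes> c)) = slice_left \<epsilon> (lact ((1 \<otimes>\<^sub>M tot.\<iota> a) * E) (b \<otimes> c))"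
proof (induction a rule: total_induct)
  case (homog k l m n a)
  note a = homog
  have mem: "\<Delta> a \<in> tot2.M" "(1 \<otimes>\<^sub>M tot.\<iota> a) * E \<in> tot2.M"
    by (intro multipliers_times iota_leg_mem E_mem total_comult_mem)+
  note simps = pure_add_left pure_add_right clinear_add[OF clinear_slice(1)] clinear_0[OF clinear_slice(1)]
    mem[THEN multiplier_linear_pair, THEN linear_pair_lact, THEN clinear_add]
    mem[THEN multiplier_linear_pair, THEN linear_pair_lact, THEN clinear_0]
  show ?case
  proof (induction b rule: total_induct)
    case (homog k' l' m' n' b)
    note b = homog
    show ?case
    proof (induction c rule: total_induct)
      case (homog s p q' q c)
      show ?case by (rule counit_weak_mult_left_homog[OF a b homog])
    qed (simp_all only: simps pure_zero_right)
  qed (simp_all only: simps pure_zero_left)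
qed (simp_all add: clinear_0[OF total_comult_linear] clinear_add[OF total_comult_linear]
    clinear_0[OF tot.clinear_to_multiplier] clinear_add[OF tot.clinear_to_multiplier] tensor_zero_lr_pair
    tensor_plus_lr_pair iota_linear_pair clinear_add[OF clinear_slice(1)])

lemma counit_weak_mult_right:
  "slice_left \<epsilon> (ract (\<Delta> c) (a \<otimes> b)) = slice_left \<epsilon> (ract (E * (1 \<otimes>\<^sub>M tot.\<iota> c)) (a \<otimes> b))"
proof (induction c rule: total_induct)
  case (homog k l m n c)
  note c = homog
  have mem: "\<Delta> c \<in> tot2.M" "E * (1 \<otimes>\<^sub>M tot.\<iota> c) \<in> tot2.M"
    by (intro multipliers_times iota_leg_mem E_mem total_comult_mem)+
  note simps = pure_add_left pure_add_right clinear_add[OF clinear_slice(1)] clinear_0[OF clinear_slice(1)]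
    mem[THEN multiplier_linear_pair, THEN linear_pair_ract, THEN clinear_add]
    mem[THEN multiplier_linear_pair, THEN linear_pair_ract, THEN clinear_0]
  show ?case
  proof (induction a rule: total_induct)
    case (homog k' l' m' n' a)
    note a = homog
    show ?case
    proof (induction b rule: total_induct)
      case (homog p s q' q b)
      show ?case by (rule counit_weak_mult_right_homog[OF c a homog])
    qed (simp_all only: simps pure_zero_right)
  qed (simp_all only: simps pure_zero_left)
qed (simp_all add: clinear_0[OF total_comult_linear] clinear_add[OF total_comult_linear]
    clinear_0[OF tot.clinear_to_multiplier] clinear_add[OF tot.clinear_to_multiplier] tensor_zero_lr_pair
    tensor_plus_lr_pair iota_linear_pair clinear_add[OF clinear_slice(1)])

lemma counitality:
  "slice_left \<epsilon> (from_multiplier mul2 (\<Delta> a * (1 \<otimes>\<^sub>M tot.\<iota> b))) = mul a b"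
  "slice_right \<epsilon> (from_multiplier mul2 ((tot.\<iota> a \<otimes>\<^sub>M 1) * \<Delta> b)) = mul a b"
  using comult_times_right[of a b] comult_times_left[of a b]
  by (auto simp: tot2.from_multiplier_to_multiplier)

lemma subspace_range_iota: "csubspace (range tot2.\<iota>)"
proof (rule complex_vector.subspaceI)
  show "0 \<in> range tot2.\<iota>"
    using clinear_0[OF tot2.clinear_to_multiplier] by (metis rangeI)
  show "x + y \<in> range tot2.\<iota>" if xy: "x \<in> range tot2.\<iota>" "y \<in> range tot2.\<iota>" for x y
  proof -
    obtain s t where "x = tot2.\<iota> s" "y = tot2.\<iota> t" using xy by blast
    then have "x + y = tot2.\<iota> (s + t)" by (simp add: clinear_add[OF tot2.clinear_to_multiplier])
    then show ?thesis by blast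
  qed
  show "c *\<^sub>C x \<in> range tot2.\<iota>" if x: "x \<in> range tot2.\<iota>" for c x
  proof -
    obtain t where "x = tot2.\<iota> t" using x by blast
    then have "c *\<^sub>C x = tot2.\<iota> (c *\<^sub>C t)" by (simp add: clinear_scale[OF tot2.clinear_to_multiplier])
    then show ?thesis by blast
  qed
qed

lemma strong_multiplier:
  "cspan {\<Delta> a * (1 \<otimes>\<^sub>M tot.\<iota> b) | a b. True} \<union> cspan {(tot.\<iota> a \<otimes>\<^sub>M 1) * \<Delta> b | a b. True} \<subseteq> range tot2.\<iota>"
proof (intro Un_least complex_vector.span_minimal subspace_range_iota subsetI)
  show "x \<in> range tot2.\<iota>" if "x \<in> {\<Delta> a * (1 \<otimes>\<^sub>M tot.\<iota> b) | a b. True}" for x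
    using that comult_times_right by blast
  show "x \<in> range tot2.\<iota>" if "x \<in> {(tot.\<iota> a \<otimes>\<^sub>M 1) * \<Delta> b | a b. True}" for x
    using that comult_times_left by blast
qed

end

theorem proposition1p20:
  fixes X :: "('i, 'a::complex_vector) partial_bialgebra_data"
    and \<epsilon> :: "'a \<Rightarrow> complex"
    and \<Delta> :: "'a \<Rightarrow> ('a, 'a) tensor lr_pair"
    and \<Delta>1 :: "('a, 'a) tensor lr_pair"
    and \<iota> :: "'a \<Rightarrow> 'a lr_pair"
    and \<iota>2 :: "('a, 'a) tensor \<Rightarrow> ('a, 'a) tensor lr_pair"
  defines "\<epsilon> \<equiv> total_counit X"
    and "\<Delta> \<equiv> total_comult X"
    and "\<Delta>1 \<equiv> comult X 1"
    and "\<iota> \<equiv> to_multiplier (total_mult X)"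
    and "\<iota>2 \<equiv> to_multiplier (mult2 X)"
  assumes "partial_bialgebra X"
  shows
    \<comment> \<open>coassociativity\<close>
    "(\<forall>m\<in>multipliers (total_mult X). comult_id X (comult X m) = id_comult X (comult X m)) \<and>
    \<comment> \<open>counitality\<close>
     (\<forall>a b. slice_left \<epsilon> (from_multiplier (mult2 X) (\<Delta> a * (1 \<otimes>\<^sub>M \<iota> b))) = total_mult X a b \<and>
            slice_right \<epsilon> (from_multiplier (mult2 X) ((\<iota> a \<otimes>\<^sub>M 1) * \<Delta> b)) = total_mult X a b) \<and>
    \<comment> \<open>weak comultiplicativity of the unit\<close>
     (\<Delta>1 \<otimes>\<^sub>M 1) * multiplier_assoc (1 \<otimes>\<^sub>M \<Delta>1) = comult_id X \<Delta>1 \<and>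
     comult_id X \<Delta>1 = id_comult X \<Delta>1 \<and>
     id_comult X \<Delta>1 = multiplier_assoc (1 \<otimes>\<^sub>M \<Delta>1) * (\<Delta>1 \<otimes>\<^sub>M 1) \<and>
    \<comment> \<open>weak multiplicativity of the counit\<close>
     (\<forall>a b c.
        slice_left \<epsilon> (lact (\<Delta> a) (b \<otimes> c)) = slice_left \<epsilon> (lact ((1 \<otimes>\<^sub>M \<iota> a) * \<Delta>1) (b \<otimes> c)) \<and>
        slice_left \<epsilon> (ract (\<Delta> c) (a \<otimes> b)) = slice_left \<epsilon> (ract (\<Delta>1 * (1 \<otimes>\<^sub>M \<iota> c)) (a \<otimes> b))) \<and>
    \<comment> \<open>strong multiplier property\<close>
     cspan {\<Delta> a * (1 \<otimes>\<^sub>M \<iota> b) | a b. True} \<union> cspan {(\<iota> a \<otimes>\<^sub>M 1) * \<Delta> b | a b. True} \<subseteq> range \<iota>2"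
proof -
  note P = assms(6)
  have \<Delta>1: "\<Delta>1 = canonical_idempotent X"
    unfolding \<Delta>1_def by (rule partial_bialgebra.comult_one[OF P])
  show ?thesis
    unfolding \<Delta>1 \<epsilon>_def \<Delta>_def \<iota>_def \<iota>2_def
  proof (intro conjI ballI allI)
    show "comult_id X (comult X m) = id_comult X (comult X m)" if "m \<in> multipliers (total_mult X)" for m
      using that by (rule partial_bialgebra.comult_coassoc[OF P])
  qed (simp_all only: partial_bialgebra.counitality[OF P] partial_bialgebra.comult_id_E[OF P]
      partial_bialgebra.id_comult_E[OF P] partial_bialgebra.E_legs_commute[OF P]
      partial_bialgebra.counit_weak_mult_left[OF P] partial_bialgebra.counit_weak_mult_right[OF P]
      partial_bialgebra.strong_multiplier[OF P])
qed

end
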